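(* Let $u^n\in L^2(\Gamma_C)$, $y^{n-1}\in\mathcal V$ and $\xi^{n-1}\in L^2(\Omega)$ be such that $u^n\ge 0$ a.e. in $\Gamma_C$, $y^{n-1}\ge 0$ a.e. in $\Omega$ and $0\le \xi^{n-1}\le 1$ a.e. in $\Omega$. Then the problem of finding $(y^n,\xi^n)\in\mathcal V\times L^2(\Omega)$ such that $$A y^n=\xi^n+Bu^n+\overline{y}^{\,n-1}-\overline{\xi}^{\,n-1}\ \text{ in }\mathcal V',\qquad \xi^n\in\mathcal H(y^n)\ \text{ a.e. in }\Omega,$$ has one and only one solution, and this solution is given by the solution $(y^n,\xi^n)\in\mathcal V\times L^2(\Omega)$ of the complementarity system $$A y^n=\xi^n+Bu^n+\overline{y}^{\,n-1}-\overline{\xi}^{\,n-1}\ \text{ in }\mathcal V',\qquad y^n\ge 0,\ \ \xi^n\ge 0\ \text{ a.e. in }\Omega,\qquad (y^n,\xi^n)=0.$$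
   Context: $\Omega\subset\mathbb R^d$ ($d=1,2$) is a bounded open set with smooth boundary $\Gamma$, which is divided into three parts $\Gamma_N,\Gamma_D,\Gamma_C$. The inner products of $L^2(\Omega)$ and $L^2(\Gamma_C)$ are $(\cdot,\cdot)$ and $(\cdot,\cdot)_{\Gamma_C}$. The space $\mathcal V:=\{\phi\in H^1(\Omega):\phi=0\text{ on }\Gamma_D\}$ carries the $H^1(\Omega)$ norm; $\mathcal V'$ is its dual and $\langle\cdot,\cdot\rangle$ the duality pairing. Elements $f\in L^2(\Omega)$ are regarded as elements of $\mathcal V'$ via $\phi\mapsto(f,\phi)$. $\gamma_0$ is the trace operator on $H^1(\Omega)$. Fix a time step index $n$ and a step size $\tau>0$. Define the bounded linear operators $B:L^2(\Gamma_C)\to\mathcal V'$ and $A:\mathcal V\to\mathcal V'$ by $$\langle Bv,\phi\rangle:=\tau(v,\gamma_0\phi)_{\Gamma_C},\qquad \langle A\psi,\phi\rangle:=(\psi,\phi)+\tau(\kappa^n\nabla\psi,\nabla\phi),$$ where $\kappa^n\in L^\infty(\Omega)$ is a real-valued function such that $A$ is coercive on $\mathcal V$: there is $\underline\kappa>0$ with $\langle A\psi,\psi\rangle\ge\underline\kappa\|\psi\|_{H^1(\Omega)}^2$ for all $\psi\in\mathcal V$. For a given convection velocity field $\vec v(\cdot,t^n)$, let $X^n(x):=x-\tau\,\vec v(x,t^n)$; it is assumed that $X^n$ maps $\Omega$ to itself and that $\phi\mapsto\phi\circ X^n$ is well defined on a.e.-equivalence classes and maps $L^2(\Omega)$ to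 $L^2(\Omega)$. Write $\overline{\phi}^{\,n-1}:=\phi^{n-1}\circ X^n$. $\mathcal H$ is the set-valued map on $\mathbb R$ with $\mathcal H(s)=\{0\}$ if $s>0$, $\mathcal H(0)=[0,1]$, $\mathcal H(s)=\{1\}$ if $s<0$; the inclusion $\xi^n\in\mathcal H(y^n)$ is understood pointwise a.e. *)

theory Defs
  imports "HOL-Analysis.Analysis"
begin

text \<open>Functions in \<open>L\<^sup>2\<close> and \<open>H\<^sup>1\<close> are represented by everywhere defined functions, of which only
  the values on the relevant set matter, and only up to null sets.\<close>

subsection \<open>Smooth functions and smooth boundaries\<close>

primrec Ck_on :: "nat \<Rightarrow> ('a::euclidean_space \<Rightarrow> real) \<Rightarrow> 'a set \<Rightarrow> bool" where
  "Ck_on 0 f U \<longleftrightarrow> continuous_on U f"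
| "Ck_on (Suc k) f U \<longleftrightarrow> (\<forall>x\<in>U. f differentiable (at x)) \<and>
     (\<forall>i\<in>Basis. Ck_on k (\<lambda>x. frechet_derivative f (at x) i) U)"

text \<open>Only meaningful for open \<open>U\<close>.\<close>

definition smooth_on :: "('a::euclidean_space \<Rightarrow> real) \<Rightarrow> 'a set \<Rightarrow> bool" where
  "smooth_on f U \<longleftrightarrow> (\<forall>k. Ck_on k f U)"

text \<open>Near each boundary point the set is a strict sublevel set of a smooth function without
  critical points, so it lies locally on one side of a smooth hypersurface.\<close>

definition smooth_boundary :: "'a::euclidean_space set \<Rightarrow> bool" where
  "smooth_boundary \<Omega> \<longleftrightarrow> (\<forall>p\<in>frontier \<Omega>. \<exists>U \<rho>. open U \<and> p \<in> U \<and> smooth_on \<rho> U \<and>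
     (\<forall>x\<in>U. \<exists>h. frechet_derivative \<rho> (at x) h \<noteq> 0) \<and> \<Omega> \<inter> U = {x\<in>U. \<rho> x < 0})"

subsection \<open>Surface measure\<close>

text \<open>The factor is the usual normalisation, which makes the \<open>k\<close>-dimensional Hausdorff measure
  agree with the \<open>k\<close>-dimensional surface area; it equals 1 for \<open>k = 0\<close> and \<open>k = 1\<close>.
  In the case \<open>k = 0\<close> we have \<open>0 ^ 0 = 1\<close>, whence a counting measure.\<close>

definition hausdorff_gauge :: "nat \<Rightarrow> 'a::euclidean_space set \<Rightarrow> ennreal" where
  "hausdorff_gauge k S =
     (if S = {} then 0 else ennreal (unit_ball_vol (real k) / 2 ^ k * diameter S ^ k))"

definition hausdorff_content :: "nat \<Rightarrow> real \<Rightarrow> 'a::euclidean_space set \<Rightarrow> ennreal" where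
  "hausdorff_content k \<delta> A =
     (INF C\<in>{C :: nat \<Rightarrow> 'a set. A \<subseteq> (\<Union>i. C i) \<and> (\<forall>i. bounded (C i) \<and> diameter (C i) \<le> \<delta>)}.
        \<Sum>i. hausdorff_gauge k (C i))"

definition hausdorff_outer :: "nat \<Rightarrow> 'a::euclidean_space set \<Rightarrow> ennreal" where
  "hausdorff_outer k A = (SUP \<delta>\<in>{0<..}. hausdorff_content k \<delta> A)"

definition hausdorff_measure :: "nat \<Rightarrow> 'a::euclidean_space measure" where
  "hausdorff_measure k = measure_of UNIV (sets borel) (hausdorff_outer k)"

text \<open>By Caratheodory's criterion, \<open>hausdorff_measure k\<close> coincides with \<open>hausdorff_outer k\<close> on Borel
  sets; in particular it is not the null measure to which \<^const>\<open>measure_of\<close> defaults.\<close>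

lemma hausdorff_content_mono:
  assumes "A \<subseteq> B"
  shows "hausdorff_content k \<delta> A \<le> hausdorff_content k \<delta> B"
  unfolding hausdorff_content_def
proof (rule INF_superset_mono)
  show "{C :: nat \<Rightarrow> 'a set. B \<subseteq> (\<Union>i. C i) \<and> (\<forall>i. bounded (C i) \<and> diameter (C i) \<le> \<delta>)} \<subseteq>
      {C. A \<subseteq> (\<Union>i. C i) \<and> (\<forall>i. bounded (C i) \<and> diameter (C i) \<le> \<delta>)}"
    using assms by blast
qed (rule order_refl)

lemma hausdorff_content_antimono:
  assumes "\<delta> \<le> \<delta>'"
  shows "hausdorff_content k \<delta>' A \<le> hausdorff_content k \<delta> A"
  unfolding hausdorff_content_def
proof (rule INF_superset_mono)
  show "{C :: nat \<Rightarrow> 'a set. A \<subseteq> (\<Union>i. C i) \<and> (\<forall>i. bounded (C i) \<and> diameter (C i) \<le> \<delta>)} \<subseteq>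
      {C. A \<subseteq> (\<Union>i. C i) \<and> (\<forall>i. bounded (C i) \<and> diameter (C i) \<le> \<delta>')}"
    using order_trans[OF _ assms] by blast
qed (rule order_refl)

lemma hausdorff_outer_mono:
  assumes "A \<subseteq> B"
  shows "hausdorff_outer k A \<le> hausdorff_outer k B"
  unfolding hausdorff_outer_def
  by (rule SUP_subset_mono[OF order_refl]) (rule hausdorff_content_mono[OF assms])

lemma hausdorff_outer_empty: "hausdorff_outer k {} = 0"
proof -
  have "hausdorff_content k \<delta> ({} :: 'a set) \<le> 0" if "\<delta> > 0" for \<delta>
  proof -
    have "hausdorff_content k \<delta> ({} :: 'a set) \<le> (\<Sum>i::nat. hausdorff_gauge k ({} :: 'a set))"
      unfolding hausdorff_content_def
      by (rule INF_lower) (use that in simp)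
    then show ?thesis by (simp add: hausdorff_gauge_def)
  qed
  then have "hausdorff_outer k ({} :: 'a set) \<le> 0"
    unfolding hausdorff_outer_def by (intro SUP_least) simp
  then show ?thesis by simp
qed

lemma hausdorff_content_UN_le:
  "hausdorff_content k \<delta> (\<Union>i. A i) \<le> (\<Sum>i::nat. hausdorff_content k \<delta> (A i))"
proof (rule ennreal_le_epsilon)
  fix e :: real assume "0 < e" and fin: "(\<Sum>i. hausdorff_content k \<delta> (A i)) < top"
  then have *: "hausdorff_content k \<delta> (A n) < hausdorff_content k \<delta> (A n) + e * (1/2)^Suc n" for n
    by (auto simp add: less_top dest!: ennreal_suminf_lessD)
  have "\<exists>C. A n \<subseteq> (\<Union>i. C i) \<and> (\<forall>i. bounded (C i) \<and> diameter (C i) \<le> \<delta>) \<and>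
      (\<Sum>i. hausdorff_gauge k (C i)) \<le> hausdorff_content k \<delta> (A n) + e * (1/2)^Suc n"
    for n :: nat
  proof -
    obtain C where "A n \<subseteq> (\<Union>i. C i)" "\<forall>i. bounded (C i) \<and> diameter (C i) \<le> \<delta>"
      "(\<Sum>i. hausdorff_gauge k (C i)) < hausdorff_content k \<delta> (A n) + e * (1/2)^Suc n"
      using *[of n]
      unfolding hausdorff_content_def[of k \<delta> "A n", THEN arg_cong, of "\<lambda>z. z < _"] INF_less_iff
      by blast
    then show ?thesis by (auto intro!: exI[of _ C] less_imp_le)
  qed
  then have "\<exists>B. \<forall>n. A n \<subseteq> (\<Union>i. B n i) \<and> (\<forall>i. bounded (B n i) \<and> diameter (B n i) \<le> \<delta>) \<and>
      (\<Sum>i. hausdorff_gauge k (B n i)) \<le> hausdorff_content k \<delta> (A n) + e * (1/2)^Suc n"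
    by (intro choice allI)
  then obtain B where sub: "\<And>n. A n \<subseteq> (\<Union>i. B n i)"
    and small: "\<And>n i. bounded (B n i) \<and> diameter (B n i) \<le> \<delta>"
    and le: "\<And>n. (\<Sum>i. hausdorff_gauge k (B n i)) \<le> hausdorff_content k \<delta> (A n) + e * (1/2)^Suc n"
    by blast
  define C where "C = case_prod B o prod_decode"
  have A_C: "(\<Union>i. A i) \<subseteq> (\<Union>i. C i)"
    using sub by (auto simp add: C_def subset_eq) (metis prod.case prod_encode_inverse)
  have "hausdorff_content k \<delta> (\<Union>i. A i) \<le> (\<Sum>i. hausdorff_gauge k (C i))"
    unfolding hausdorff_content_def
    by (rule INF_lower) (use A_C small in \<open>auto simp: C_def split: prod.split\<close>)
  also have "\<dots> = (\<Sum>n. \<Sum>i. hausdorff_gauge k (B n i))"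
    using suminf_ennreal_2dimen[of "\<lambda>n. \<Sum>i. hausdorff_gauge k (B n i)"
        "\<lambda>p. hausdorff_gauge k (case_prod B p)"]
    by (simp add: C_def)
  also have "\<dots> \<le> (\<Sum>n. hausdorff_content k \<delta> (A n) + e * (1/2) ^ Suc n)"
    by (intro suminf_le le) auto
  also have "... = (\<Sum>n. hausdorff_content k \<delta> (A n)) + (\<Sum>n. ennreal e * ennreal ((1/2) ^ Suc n))"
    using \<open>0 < e\<close> by (subst suminf_add[symmetric])
                     (auto simp del: ennreal_suminf_cmult simp add: ennreal_mult[symmetric])
  also have "\<dots> = (\<Sum>n. hausdorff_content k \<delta> (A n)) + e"
    unfolding ennreal_suminf_cmult
    by (subst suminf_ennreal_eq[OF zero_le_power power_half_series]) auto
  finally show "hausdorff_content k \<delta> (\<Union>i. A i) \<le> (\<Sum>n. hausdorff_content k \<delta> (A n)) + e" .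
qed

lemma hausdorff_outer_UN_le:
  "hausdorff_outer k (\<Union>i. A i) \<le> (\<Sum>i::nat. hausdorff_outer k (A i))"
  unfolding hausdorff_outer_def[of k "\<Union>i. A i"]
proof (rule SUP_least)
  fix \<delta> :: real assume "\<delta> \<in> {0<..}"
  then have "hausdorff_content k \<delta> (A i) \<le> hausdorff_outer k (A i)" for i
    unfolding hausdorff_outer_def by (rule SUP_upper)
  then show "hausdorff_content k \<delta> (\<Union>i. A i) \<le> (\<Sum>i. hausdorff_outer k (A i))"
    by (intro order_trans[OF hausdorff_content_UN_le] suminf_le) auto
qed

lemma outer_measure_space_hausdorff: "outer_measure_space (Pow UNIV) (hausdorff_outer k)"
  by (simp add: outer_measure_space_def positive_def increasing_def countably_subadditive_def
      hausdorff_outer_empty hausdorff_outer_UN_le hausdorff_outer_mono)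

lemma hausdorff_outer_Un_le:
  fixes A B :: "'a::euclidean_space set"
  shows "hausdorff_outer k (A \<union> B) \<le> hausdorff_outer k A + hausdorff_outer k B"
proof -
  have "subadditive (Pow UNIV) (hausdorff_outer k :: 'a set \<Rightarrow> ennreal)"
    by (rule ring_of_sets.countably_subadditive_subadditive[OF ring_of_sets_Pow])
      (use outer_measure_space_hausdorff[where 'a = 'a, of k] in \<open>simp_all add: outer_measure_space_def\<close>)
  then have "hausdorff_outer k (A \<union> (B - A)) \<le> hausdorff_outer k A + hausdorff_outer k (B - A)"
    by (rule subadditiveD) auto
  also have "\<dots> \<le> hausdorff_outer k A + hausdorff_outer k B"
    by (intro add_left_mono hausdorff_outer_mono) auto
  finally show ?thesis by simp
qed

lemma hausdorff_outer_separated: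
  assumes "d > 0" and sep: "\<And>x y. x \<in> A \<Longrightarrow> y \<in> B \<Longrightarrow> dist x y \<ge> d"
  shows "hausdorff_outer k A + hausdorff_outer k B \<le> hausdorff_outer k (A \<union> B)"
proof -
  have main: "hausdorff_content k \<delta> A + hausdorff_content k \<delta> B \<le> hausdorff_content k \<delta> (A \<union> B)"
    if "\<delta> < d" "0 < \<delta>" for \<delta>
    unfolding hausdorff_content_def[of k \<delta> "A \<union> B"]
  proof (rule INF_greatest)
    fix C :: "nat \<Rightarrow> 'a set"
    assume "C \<in> {C. A \<union> B \<subseteq> (\<Union>i. C i) \<and> (\<forall>i. bounded (C i) \<and> diameter (C i) \<le> \<delta>)}"
    then have C: "A \<union> B \<subseteq> (\<Union>i. C i)" "\<And>i. bounded (C i)" "\<And>i. diameter (C i) \<le> \<delta>" by auto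
    define P where "P D i = (if C i \<inter> D = {} then {} else C i)" for D i
    have le: "hausdorff_content k \<delta> D \<le> (\<Sum>i. hausdorff_gauge k (P D i))" if "D \<subseteq> A \<union> B" for D
      unfolding hausdorff_content_def
    proof (rule INF_lower)
      have "D \<subseteq> (\<Union>i. P D i)" using that C(1) unfolding P_def by fastforce
      then show "P D \<in> {C. D \<subseteq> (\<Union>i. C i) \<and> (\<forall>i. bounded (C i) \<and> diameter (C i) \<le> \<delta>)}"
        using C(2,3) \<open>0 < \<delta>\<close> by (auto simp: P_def)
    qed
    have "C i \<inter> A = {} \<or> C i \<inter> B = {}" for i
    proof (rule ccontr)
      assume "\<not> ?thesis"
      then obtain x y where "x \<in> C i" "x \<in> A" "y \<in> C i" "y \<in> B" by auto
      then have "d \<le> dist x y" "dist x y \<le> \<delta>"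
        using sep C(3)[of i] diameter_bounded_bound[OF C(2)[of i], of x y] by auto
      with \<open>\<delta> < d\<close> show False by simp
    qed
    then have "hausdorff_gauge k (P A i) + hausdorff_gauge k (P B i) \<le> hausdorff_gauge k (C i)" for i
      by (auto simp: P_def hausdorff_gauge_def)
    then have "(\<Sum>i. hausdorff_gauge k (P A i) + hausdorff_gauge k (P B i)) \<le> (\<Sum>i. hausdorff_gauge k (C i))"
      by (intro suminf_le) auto
    then have "(\<Sum>i. hausdorff_gauge k (P A i)) + (\<Sum>i. hausdorff_gauge k (P B i))
        \<le> (\<Sum>i. hausdorff_gauge k (C i))"
      by (subst suminf_add) auto
    with le[of A] le[of B]
    show "hausdorff_content k \<delta> A + hausdorff_content k \<delta> B \<le> (\<Sum>i. hausdorff_gauge k (C i))"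
      by (meson Un_upper1 Un_upper2 add_mono order_trans)
  qed
  have "hausdorff_outer k A + hausdorff_outer k B =
      (SUP \<delta>\<in>{0<..}. hausdorff_content k \<delta> A + hausdorff_content k \<delta> B)"
    unfolding hausdorff_outer_def
  proof (rule SUP_add_directed_ennreal[symmetric])
    fix i j :: real assume "i \<in> {0<..}" "j \<in> {0<..}"
    then show "\<exists>l\<in>{0<..}. hausdorff_content k i A + hausdorff_content k j B
        \<le> hausdorff_content k l A + hausdorff_content k l B"
      by (intro bexI[of _ "min i j"] add_mono hausdorff_content_antimono) auto
  qed
  also have "\<dots> \<le> hausdorff_outer k (A \<union> B)"
  proof (rule SUP_least)
    fix \<delta> :: real assume "\<delta> \<in> {0<..}"
    define \<delta>' where "\<delta>' = min \<delta> (d/2)"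
    have \<delta>': "0 < \<delta>'" "\<delta>' < d" "\<delta>' \<le> \<delta>" using \<open>\<delta> \<in> _\<close> \<open>d > 0\<close> by (auto simp: \<delta>'_def)
    have "hausdorff_content k \<delta> A + hausdorff_content k \<delta> B
        \<le> hausdorff_content k \<delta>' A + hausdorff_content k \<delta>' B"
      by (intro add_mono hausdorff_content_antimono \<delta>')
    also have "\<dots> \<le> hausdorff_content k \<delta>' (A \<union> B)" by (rule main) (use \<delta>' in auto)
    also have "\<dots> \<le> hausdorff_outer k (A \<union> B)"
      unfolding hausdorff_outer_def by (rule SUP_upper) (use \<delta>' in auto)
    finally show "hausdorff_content k \<delta> A + hausdorff_content k \<delta> B \<le> hausdorff_outer k (A \<union> B)" .
  qed
  finally show ?thesis .
qed

lemma hausdorff_outer_infdist_separated: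
  assumes "s < r" "\<And>x. x \<in> A \<Longrightarrow> infdist x F \<ge> r" "\<And>x. x \<in> B \<Longrightarrow> infdist x F \<le> s"
  shows "hausdorff_outer k A + hausdorff_outer k B \<le> hausdorff_outer k (A \<union> B)"
proof (rule hausdorff_outer_separated)
  show "r - s > 0" using assms by simp
  show "r - s \<le> dist x y" if "x \<in> A" "y \<in> B" for x y
    using assms(2)[OF that(1)] assms(3)[OF that(2)] infdist_triangle[of x F y] by linarith
qed

lemma hausdorff_closed_split:
  fixes F T :: "'a::euclidean_space set"
  assumes "closed F"
  shows "hausdorff_outer k (T \<inter> F) + hausdorff_outer k (T - F) \<le> hausdorff_outer k T"
proof (cases "F = {} \<or> hausdorff_outer k T = top")
  case True
  then show ?thesis by (auto simp: hausdorff_outer_empty)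
next
  case False
  then have "F \<noteq> {}" and fin: "hausdorff_outer k T < top" by (auto simp: less_top)
  let ?h = "hausdorff_outer k"
  define A where "A n = {x\<in>T. infdist x F \<ge> 1 / real (n + 1)}" for n
  define R where "R n = {x\<in>T. 1 / real (n + 2) \<le> infdist x F \<and> infdist x F < 1 / real (n + 1)}" for n
  have part: "(\<Sum>j<N. ?h (R (2 * j + c))) \<le> ?h (\<Union>j<N. R (2 * j + c))" for N c
  proof (induction N)
    case (Suc N)
    have "?h (\<Union>j<N. R (2 * j + c)) + ?h (R (2 * N + c)) \<le>
        ?h ((\<Union>j<N. R (2 * j + c)) \<union> R (2 * N + c))"
    proof (cases "N = 0")
      case False
      show ?thesis
      proof (rule hausdorff_outer_infdist_separated)
        show "1 / real (2 * N + c + 1) < 1 / real (2 * N + c)"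
          using False by (intro divide_strict_left_mono) auto
        fix x assume "x \<in> (\<Union>j<N. R (2 * j + c))"
        then obtain j where "j < N" "1 / real (2 * j + c + 2) \<le> infdist x F" by (auto simp: R_def)
        moreover from this have "1 / real (2 * N + c) \<le> 1 / real (2 * j + c + 2)"
          by (intro divide_left_mono) auto
        ultimately show "1 / real (2 * N + c) \<le> infdist x F" by simp
      qed (auto simp: R_def)
    qed (simp add: hausdorff_outer_empty)
    moreover have "(\<Union>j<Suc N. R (2 * j + c)) = (\<Union>j<N. R (2 * j + c)) \<union> R (2 * N + c)"
      by (auto simp: less_Suc_eq)
    ultimately show ?case using Suc by (auto intro: order_trans add_right_mono)
  qed simp
  have parity: "(\<Sum>j. ?h (R (2 * j + c))) \<le> ?h T" for c
  proof (rule suminf_le_const[OF summableI])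
    fix N
    have "?h (\<Union>j<N. R (2 * j + c)) \<le> ?h T"
      by (rule hausdorff_outer_mono) (auto simp: R_def)
    with part show "(\<Sum>j<N. ?h (R (2 * j + c))) \<le> ?h T" by (rule order_trans)
  qed
  have sum2: "(\<Sum>j<2 * N. f j) = (\<Sum>j<N. f (2 * j)) + (\<Sum>j<N. f (2 * j + 1))"
    for f :: "nat \<Rightarrow> ennreal" and N
    by (induction N) (auto simp: algebra_simps)
  have "(\<Sum>j<N. ?h (R j)) \<le> ?h T + ?h T" for N
  proof -
    have "(\<Sum>j<N. ?h (R j)) \<le> (\<Sum>j<2 * N. ?h (R j))" by (rule sum_mono2) auto
    also have "\<dots> \<le> (\<Sum>j. ?h (R (2 * j + 0))) + (\<Sum>j. ?h (R (2 * j + 1)))"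
      unfolding sum2 by (intro add_mono) (auto intro!: sum_le_suminf summableI)
    also have "\<dots> \<le> ?h T + ?h T" by (intro add_mono parity)
    finally show ?thesis .
  qed
  then have "(\<Sum>j. ?h (R j)) \<le> ?h T + ?h T" by (intro suminf_le_const summableI)
  also have "\<dots> < top" using fin by simp
  finally have finR: "(\<Sum>j. ?h (R j)) < top" .
  show ?thesis
  proof (rule ennreal_le_epsilon)
    fix e :: real assume "e > 0"
    have "\<exists>n. (\<Sum>j. ?h (R (j + n))) \<le> e"
    proof (cases "(\<Sum>j. ?h (R j)) < ennreal e")
      case True
      then show ?thesis by (intro exI[of _ 0]) simp
    next
      case False
      have "(\<lambda>n. \<Sum>j<n. ?h (R j)) \<longlonglongrightarrow> (\<Sum>j. ?h (R j))" by (intro summable_LIMSEQ summableI)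
      from order_tendstoD(1)[OF this, of "(\<Sum>j. ?h (R j)) - e"]
      have "\<exists>n. (\<Sum>j. ?h (R j)) - e < (\<Sum>j<n. ?h (R j))"
        if "(\<Sum>j. ?h (R j)) - e < (\<Sum>j. ?h (R j))"
        using that eventually_happens'[OF sequentially_bot] by blast
      moreover have "(\<Sum>j. ?h (R j)) - e < (\<Sum>j. ?h (R j))"
      proof (rule ennreal_between)
        have "0 < ennreal e" using \<open>e > 0\<close> by simp
        with False show "0 < (\<Sum>j. ?h (R j))" by (meson not_less order_less_le_trans)
      qed (use \<open>e > 0\<close> finR in auto)
      ultimately obtain n where n: "(\<Sum>j. ?h (R j)) - e < (\<Sum>j<n. ?h (R j))"
        by blast
      have finn: "(\<Sum>j<n. ?h (R j)) < top"
        by (rule le_less_trans[OF sum_le_suminf finR]) auto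
      have "(\<Sum>j. ?h (R (j + n))) + (\<Sum>j<n. ?h (R j)) = (\<Sum>j. ?h (R j))"
        by (rule suminf_offset[symmetric]) (rule summableI)
      also have "\<dots> \<le> e + (\<Sum>j<n. ?h (R j))"
        using less_imp_le[OF n] unfolding ennreal_minus_le_iff by blast
      finally have "(\<Sum>j<n. ?h (R j)) + (\<Sum>j. ?h (R (j + n))) \<le> (\<Sum>j<n. ?h (R j)) + e"
        by (simp only: add.commute)
      then have "(\<Sum>j. ?h (R (j + n))) \<le> e"
        using less_imp_neq[OF finn] unfolding ennreal_add_left_cancel_le infinity_ennreal_def by blast
      then show ?thesis ..
    qed
    then obtain n where n: "(\<Sum>j. ?h (R (j + n))) \<le> e" ..
    have "T - F \<subseteq> A n \<union> (\<Union>j. R (j + n))"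
    proof
      fix x assume x: "x \<in> T - F"
      then have pos: "infdist x F > 0"
        using \<open>closed F\<close> \<open>F \<noteq> {}\<close> by (auto simp: in_closed_iff_infdist_zero infdist_nonneg order_less_le)
      show "x \<in> A n \<union> (\<Union>j. R (j + n))"
      proof (rule ccontr)
        assume "\<not> ?thesis"
        then have not: "x \<notin> A n" "\<And>j. x \<notin> R (j + n)" by auto
        have "infdist x F < 1 / real (n + j + 1)" for j
        proof (induction j)
          case 0 then show ?case using not(1) x by (auto simp: A_def)
        next
          case (Suc j) then show ?case using not(2)[of j] x by (auto simp: R_def algebra_simps)
        qed
        moreover obtain j where "1 / real (Suc j) < infdist x F" using nat_approx_posE[OF pos] by auto
        moreover have "1 / real (n + j + 1) \<le> 1 / real (Suc j)" by (intro divide_left_mono) auto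
        ultimately show False by (meson order.strict_trans2 order.asym)
      qed
    qed
    then have "?h (T - F) \<le> ?h (A n) + ?h (\<Union>j. R (j + n))"
      by (rule order_trans[OF hausdorff_outer_mono hausdorff_outer_Un_le])
    also have "\<dots> \<le> ?h (A n) + e"
      by (intro add_left_mono order_trans[OF hausdorff_outer_UN_le n])
    finally have "?h (T \<inter> F) + ?h (T - F) \<le> ?h (A n) + ?h (T \<inter> F) + e"
      by (metis add.assoc add.commute add_left_mono)
    also have "?h (A n) + ?h (T \<inter> F) \<le> ?h (A n \<union> (T \<inter> F))"
      by (rule hausdorff_outer_infdist_separated[of 0 "1 / real (n + 1)"]) (auto simp: A_def)
    also have "\<dots> \<le> ?h T" by (rule hausdorff_outer_mono) (auto simp: A_def)
    finally show "?h (T \<inter> F) + ?h (T - F) \<le> ?h T + e" by (simp add: add_right_mono)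
  qed
qed

lemma measure_space_hausdorff: "measure_space UNIV (sets borel) (hausdorff_outer k)"
proof -
  interpret P: sigma_algebra UNIV "Pow UNIV :: 'a set set" by (rule sigma_algebra_Pow)
  let ?L = "lambda_system UNIV (Pow UNIV) (hausdorff_outer k :: 'a set \<Rightarrow> ennreal)"
  have L: "measure_space UNIV ?L (hausdorff_outer k)"
    by (rule P.caratheodory_lemma[OF outer_measure_space_hausdorff])
  have "F \<in> ?L" if "closed F" for F
  proof -
    have "hausdorff_outer k (T \<inter> F) + hausdorff_outer k (T - F) = hausdorff_outer k T" for T
      using hausdorff_closed_split[OF that, of k T] hausdorff_outer_Un_le[of k "T \<inter> F" "T - F"]
      by (simp add: Int_Diff_Un)
    then show ?thesis by (subst P.lambda_system_eq) blast
  qed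
  then have "sigma_sets UNIV {F. closed F} \<subseteq> ?L"
    using L by (intro sigma_algebra.sigma_sets_subset) (auto simp: measure_space_def)
  then have "sets borel \<subseteq> ?L" by (simp add: borel_eq_closed)
  then show ?thesis
    using L by (rule measure_down[rotated 2]) (metis sets.sigma_algebra_axioms space_borel)
qed

lemma sets_hausdorff_measure [measurable_cong, simp]: "sets (hausdorff_measure k) = sets borel"
  by (simp add: hausdorff_measure_def) (metis sets.sigma_sets_eq space_borel)

lemma emeasure_hausdorff_measure:
  "A \<in> sets borel \<Longrightarrow> emeasure (hausdorff_measure k) A = hausdorff_outer k A"
  using measure_space_hausdorff[of k]
  by (intro emeasure_measure_of[OF hausdorff_measure_def]) (auto simp: measure_space_def)

text \<open>Surface measure on a (Borel) part \<open>S\<close> of a smooth hypersurface.\<close>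

definition surface_on :: "'a::euclidean_space set \<Rightarrow> 'a measure" where
  "surface_on S = restrict_space (hausdorff_measure (DIM('a) - 1)) S"

subsection \<open>Lebesgue and Sobolev spaces\<close>

definition Lsq :: "'a measure \<Rightarrow> ('a \<Rightarrow> real) set" where
  "Lsq M = {f. f \<in> borel_measurable M \<and> integrable M (\<lambda>x. (f x)\<^sup>2)}"

definition Lsq_inner :: "'a measure \<Rightarrow> ('a \<Rightarrow> real) \<Rightarrow> ('a \<Rightarrow> real) \<Rightarrow> real" where
  "Lsq_inner M f g = (LINT x|M. f x * g x)"

definition Lsq_norm :: "'a measure \<Rightarrow> ('a \<Rightarrow> real) \<Rightarrow> real" where
  "Lsq_norm M f = sqrt (Lsq_inner M f f)"

definition Linfty :: "'a measure \<Rightarrow> ('a \<Rightarrow> real) set" where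
  "Linfty M = {f. f \<in> borel_measurable M \<and> (\<exists>K. AE x in M. \<bar>f x\<bar> \<le> K)}"

definition test_function :: "'a::euclidean_space set \<Rightarrow> ('a \<Rightarrow> real) \<Rightarrow> bool" where
  "test_function \<Omega> \<psi> \<longleftrightarrow>
     smooth_on \<psi> UNIV \<and> (\<exists>K. compact K \<and> K \<subseteq> \<Omega> \<and> (\<forall>x. x \<notin> K \<longrightarrow> \<psi> x = 0))"

definition has_weak_gradient ::
    "'a::euclidean_space set \<Rightarrow> ('a \<Rightarrow> real) \<Rightarrow> ('a \<Rightarrow> 'a) \<Rightarrow> bool" where
  "has_weak_gradient \<Omega> \<phi> g \<longleftrightarrow>
     (\<forall>i\<in>Basis. (\<lambda>x. g x \<bullet> i) \<in> Lsq (lebesgue_on \<Omega>) \<and>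
        (\<forall>\<psi>. test_function \<Omega> \<psi> \<longrightarrow>
           Lsq_inner (lebesgue_on \<Omega>) \<phi> (\<lambda>x. frechet_derivative \<psi> (at x) i) =
           - Lsq_inner (lebesgue_on \<Omega>) (\<lambda>x. g x \<bullet> i) \<psi>))"

definition H1 :: "'a::euclidean_space set \<Rightarrow> ('a \<Rightarrow> real) set" where
  "H1 \<Omega> = {\<phi> \<in> Lsq (lebesgue_on \<Omega>). \<exists>g. has_weak_gradient \<Omega> \<phi> g}"

text \<open>For open \<open>\<Omega>\<close>, the weak gradient is unique up to null sets.\<close>

definition weak_grad :: "'a::euclidean_space set \<Rightarrow> ('a \<Rightarrow> real) \<Rightarrow> 'a \<Rightarrow> 'a" where
  "weak_grad \<Omega> \<phi> = (SOME g. has_weak_gradient \<Omega> \<phi> g)"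

definition H1_norm :: "'a::euclidean_space set \<Rightarrow> ('a \<Rightarrow> real) \<Rightarrow> real" where
  "H1_norm \<Omega> \<phi> = sqrt (Lsq_inner (lebesgue_on \<Omega>) \<phi> \<phi> +
     (LINT x|lebesgue_on \<Omega>. weak_grad \<Omega> \<phi> x \<bullet> weak_grad \<Omega> \<phi> x))"

text \<open>The trace operator is the bounded linear operator \<open>H\<^sup>1(\<Omega>) \<rightarrow> L\<^sup>2(\<Gamma>)\<close> that continuously extends
  the restriction to \<open>\<Gamma>\<close> of functions that are smooth up to the boundary: the trace of \<open>\<phi>\<close> is the
  limit of the boundary values of such functions tending to \<open>\<phi>\<close> in \<open>H\<^sup>1(\<Omega>)\<close>.  On a bounded open set
  with smooth boundary it exists and is unique up to null sets.\<close>

definition is_trace_operator ::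
    "'a::euclidean_space set \<Rightarrow> (('a \<Rightarrow> real) \<Rightarrow> 'a \<Rightarrow> real) \<Rightarrow> bool" where
  "is_trace_operator \<Omega> \<gamma> \<longleftrightarrow>
     (\<forall>\<phi>\<in>H1 \<Omega>. \<gamma> \<phi> \<in> Lsq (surface_on (frontier \<Omega>))) \<and>
     (\<forall>\<phi>\<in>H1 \<Omega>. \<forall>\<psi>\<in>H1 \<Omega>. AE x in surface_on (frontier \<Omega>).
        \<gamma> (\<lambda>z. \<phi> z + \<psi> z) x = \<gamma> \<phi> x + \<gamma> \<psi> x) \<and>
     (\<forall>\<phi>\<in>H1 \<Omega>. \<forall>c. AE x in surface_on (frontier \<Omega>). \<gamma> (\<lambda>z. c * \<phi> z) x = c * \<gamma> \<phi> x) \<and>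
     (\<exists>C. \<forall>\<phi>\<in>H1 \<Omega>. Lsq_norm (surface_on (frontier \<Omega>)) (\<gamma> \<phi>) \<le> C * H1_norm \<Omega> \<phi>) \<and>
     (\<forall>\<phi>. smooth_on \<phi> UNIV \<longrightarrow> (AE x in surface_on (frontier \<Omega>). \<gamma> \<phi> x = \<phi> x)) \<and>
     (\<forall>\<phi>\<in>H1 \<Omega>. \<exists>\<phi>s :: nat \<Rightarrow> 'a \<Rightarrow> real. (\<forall>k. smooth_on (\<phi>s k) UNIV) \<and>
        (\<lambda>k. H1_norm \<Omega> (\<lambda>x. \<phi>s k x - \<phi> x)) \<longlonglongrightarrow> 0 \<and>
        (\<lambda>k. Lsq_norm (surface_on (frontier \<Omega>)) (\<lambda>x. \<phi>s k x - \<gamma> \<phi> x)) \<longlonglongrightarrow> 0)"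

definition V_space :: "'a::euclidean_space set \<Rightarrow> 'a set \<Rightarrow> (('a \<Rightarrow> real) \<Rightarrow> 'a \<Rightarrow> real) \<Rightarrow>
    ('a \<Rightarrow> real) set" where
  "V_space \<Omega> \<Gamma>D \<gamma> = {\<phi> \<in> H1 \<Omega>. AE x in surface_on \<Gamma>D. \<gamma> \<phi> x = 0}"

subsection \<open>The semi-discrete problem\<close>

text \<open>An element of the dual of \<open>V\<close> is represented by a functional of which only the values on \<open>V\<close>
  matter.\<close>

definition dual_eq :: "('a \<Rightarrow> real) set \<Rightarrow> (('a \<Rightarrow> real) \<Rightarrow> real) \<Rightarrow> (('a \<Rightarrow> real) \<Rightarrow> real) \<Rightarrow> bool"
  where "dual_eq V F G \<longleftrightarrow> (\<forall>\<phi>\<in>V. F \<phi> = G \<phi>)"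

definition L2_dual :: "'a::euclidean_space set \<Rightarrow> ('a \<Rightarrow> real) \<Rightarrow> ('a \<Rightarrow> real) \<Rightarrow> real" where
  "L2_dual \<Omega> f = (\<lambda>\<phi>. Lsq_inner (lebesgue_on \<Omega>) f \<phi>)"

definition A_op :: "'a::euclidean_space set \<Rightarrow> real \<Rightarrow> ('a \<Rightarrow> real) \<Rightarrow>
    ('a \<Rightarrow> real) \<Rightarrow> ('a \<Rightarrow> real) \<Rightarrow> real" where
  "A_op \<Omega> \<tau> \<kappa> \<psi> = (\<lambda>\<phi>. Lsq_inner (lebesgue_on \<Omega>) \<psi> \<phi> +
     \<tau> * (LINT x|lebesgue_on \<Omega>. (\<kappa> x *\<^sub>R weak_grad \<Omega> \<psi> x) \<bullet> weak_grad \<Omega> \<phi> x))"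

definition B_op :: "'a::euclidean_space set \<Rightarrow> (('a \<Rightarrow> real) \<Rightarrow> 'a \<Rightarrow> real) \<Rightarrow> real \<Rightarrow>
    ('a \<Rightarrow> real) \<Rightarrow> ('a \<Rightarrow> real) \<Rightarrow> real" where
  "B_op \<Gamma>C \<gamma> \<tau> v = (\<lambda>\<phi>. \<tau> * Lsq_inner (surface_on \<Gamma>C) v (\<gamma> \<phi>))"

definition coercive_on :: "'a::euclidean_space set \<Rightarrow> ('a \<Rightarrow> real) set \<Rightarrow>
    (('a \<Rightarrow> real) \<Rightarrow> ('a \<Rightarrow> real) \<Rightarrow> real) \<Rightarrow> bool" where
  "coercive_on \<Omega> V T \<longleftrightarrow> (\<exists>c>0. \<forall>\<psi>\<in>V. T \<psi> \<psi> \<ge> c * (H1_norm \<Omega> \<psi>)\<^sup>2)"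

definition L2_composition_map :: "'a::euclidean_space set \<Rightarrow> ('a \<Rightarrow> 'a) \<Rightarrow> bool" where
  "L2_composition_map \<Omega> X \<longleftrightarrow> X ` \<Omega> \<subseteq> \<Omega> \<and>
     (\<forall>\<phi>\<in>Lsq (lebesgue_on \<Omega>). \<forall>\<psi>\<in>Lsq (lebesgue_on \<Omega>).
        (AE x in lebesgue_on \<Omega>. \<phi> x = \<psi> x) \<longrightarrow>
        (AE x in lebesgue_on \<Omega>. (\<phi> \<circ> X) x = (\<psi> \<circ> X) x)) \<and>
     (\<forall>\<phi>\<in>Lsq (lebesgue_on \<Omega>). \<phi> \<circ> X \<in> Lsq (lebesgue_on \<Omega>))"

definition Hmap :: "real \<Rightarrow> real set" where
  "Hmap s = (if s > 0 then {0} else if s = 0 then {0..1} else {1})"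

definition state_equation :: "'a::euclidean_space set \<Rightarrow> 'a set \<Rightarrow> 'a set \<Rightarrow>
    (('a \<Rightarrow> real) \<Rightarrow> 'a \<Rightarrow> real) \<Rightarrow> real \<Rightarrow> ('a \<Rightarrow> real) \<Rightarrow> ('a \<Rightarrow> 'a) \<Rightarrow>
    ('a \<Rightarrow> real) \<Rightarrow> ('a \<Rightarrow> real) \<Rightarrow> ('a \<Rightarrow> real) \<Rightarrow> ('a \<Rightarrow> real) \<Rightarrow> ('a \<Rightarrow> real) \<Rightarrow> bool" where
  "state_equation \<Omega> \<Gamma>D \<Gamma>C \<gamma> \<tau> \<kappa> X u yp \<xi>p y \<xi> \<longleftrightarrow>
     dual_eq (V_space \<Omega> \<Gamma>D \<gamma>) (A_op \<Omega> \<tau> \<kappa> y)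
       (\<lambda>\<phi>. L2_dual \<Omega> \<xi> \<phi> + B_op \<Gamma>C \<gamma> \<tau> u \<phi> + L2_dual \<Omega> (yp \<circ> X) \<phi> - L2_dual \<Omega> (\<xi>p \<circ> X) \<phi>)"

definition solves_inclusion :: "'a::euclidean_space set \<Rightarrow> 'a set \<Rightarrow> 'a set \<Rightarrow>
    (('a \<Rightarrow> real) \<Rightarrow> 'a \<Rightarrow> real) \<Rightarrow> real \<Rightarrow> ('a \<Rightarrow> real) \<Rightarrow> ('a \<Rightarrow> 'a) \<Rightarrow>
    ('a \<Rightarrow> real) \<Rightarrow> ('a \<Rightarrow> real) \<Rightarrow> ('a \<Rightarrow> real) \<Rightarrow> ('a \<Rightarrow> real) \<Rightarrow> ('a \<Rightarrow> real) \<Rightarrow> bool" where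
  "solves_inclusion \<Omega> \<Gamma>D \<Gamma>C \<gamma> \<tau> \<kappa> X u yp \<xi>p y \<xi> \<longleftrightarrow>
     y \<in> V_space \<Omega> \<Gamma>D \<gamma> \<and> \<xi> \<in> Lsq (lebesgue_on \<Omega>) \<and>
     state_equation \<Omega> \<Gamma>D \<Gamma>C \<gamma> \<tau> \<kappa> X u yp \<xi>p y \<xi> \<and>
     (AE x in lebesgue_on \<Omega>. \<xi> x \<in> Hmap (y x))"

definition solves_complementarity :: "'a::euclidean_space set \<Rightarrow> 'a set \<Rightarrow> 'a set \<Rightarrow>
    (('a \<Rightarrow> real) \<Rightarrow> 'a \<Rightarrow> real) \<Rightarrow> real \<Rightarrow> ('a \<Rightarrow> real) \<Rightarrow> ('a \<Rightarrow> 'a) \<Rightarrow>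
    ('a \<Rightarrow> real) \<Rightarrow> ('a \<Rightarrow> real) \<Rightarrow> ('a \<Rightarrow> real) \<Rightarrow> ('a \<Rightarrow> real) \<Rightarrow> ('a \<Rightarrow> real) \<Rightarrow> bool" where
  "solves_complementarity \<Omega> \<Gamma>D \<Gamma>C \<gamma> \<tau> \<kappa> X u yp \<xi>p y \<xi> \<longleftrightarrow>
     y \<in> V_space \<Omega> \<Gamma>D \<gamma> \<and> \<xi> \<in> Lsq (lebesgue_on \<Omega>) \<and>
     state_equation \<Omega> \<Gamma>D \<Gamma>C \<gamma> \<tau> \<kappa> X u yp \<xi>p y \<xi> \<and>
     (AE x in lebesgue_on \<Omega>. y x \<ge> 0) \<and> (AE x in lebesgue_on \<Omega>. \<xi> x \<ge> 0) \<and>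
     Lsq_inner (lebesgue_on \<Omega>) y \<xi> = 0"

end

theory Submission
  imports Defs
begin

text \<open>The equation is the Euler-Lagrange inclusion of a strictly convex energy: writing \<open>F\<close> for the load
  \<open>B u + (y_prev - \<xi>_prev) \<circ> X\<close>, one minimises \<open>A(y, y)/2 + \<integral> max (-y) 0 - F(y)\<close> over \<open>V\<close>. By the
  parallelogram identity minimising sequences are Cauchy in \<open>H\<^sup>1\<close>. Testing with the negative part of
  the minimiser, and using \<open>F(\<phi>) \<ge> - \<integral> \<phi>\<close> for \<open>\<phi> \<ge> 0\<close>, shows \<open>y \<ge> 0\<close>. The functional
  \<open>A y - F\<close> is then bounded by the \<open>L\<^sup>1\<close> norm, so it is represented by some \<open>\<xi>\<close> in \<open>L\<^sup>2\<close>, and since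
  \<open>V\<close> is dense in \<open>L\<^sup>2\<close> the variational inequality can be localised to give \<open>0 \<le> \<xi> \<le> 1\<close> and
  \<open>y \<xi> = 0\<close>. Thus one pair solves both systems; as \<open>(\<xi> - \<xi>') (y - y') \<le> 0\<close> for any two solutions of
  either system, coercivity makes the solution of each of them unique, and hence both coincide.

  The negative part of an \<open>H\<^sup>1\<close> function is the limit of smooth functions of \<open>y\<close>, which themselves
  are limits of smooth functions of the smooth approximants of \<open>y\<close> provided by the trace operator;
  this controls weak gradients and traces at the same time.\<close>

subsection \<open>The space \<open>L\<^sup>2\<close>\<close>

text \<open>Pointwise, the subdifferential of \<open>max (- s) 0\<close> is \<open>- Hmap s\<close>,
  which is where the penalty in the energy comes from. It has slope -1 on negative values, and
  (\<open>y_prev\<close> - \<open>\<xi>_prev\<close>) composed with \<open>X\<close> is at least -1: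
  the penalty saved by removing the negative part pays for the load that may be lost, and this
  balance keeps the minimiser nonnegative. Two obstacles shape the rest. Localising requires
  directions such as the indicator of {\<xi> < 0}, which in general do not lie in V; this is what
  density is for. And the negative part has a derivative that jumps at 0, while approximants of y
  may take either sign on {y = 0}, so that their cut-off gradients need not converge pointwise
  there. Hence the two limits are taken one after the other: for a fixed smooth function with
  continuous derivative the approximants tend to y, and only then is the smoothing removed, with y
  held fixed.\<close>

lemma Lsq_measurable: "f \<in> Lsq M \<Longrightarrow> f \<in> borel_measurable M"
  by (simp add: Lsq_def)

lemma Lsq_integrable_mult:
  assumes "f \<in> Lsq M" "g \<in> Lsq M"
  shows "integrable M (\<lambda>x. f x * g x)"
proof (rule Bochner_Integration.integrable_bound[of M "\<lambda>x. (f x)\<^sup>2 + (g x)\<^sup>2"])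
  show "integrable M (\<lambda>x. (f x)\<^sup>2 + (g x)\<^sup>2)" using assms by (simp add: Lsq_def)
  show "(\<lambda>x. f x * g x) \<in> borel_measurable M"
    using assms by (intro borel_measurable_times Lsq_measurable)
  have "norm (a * b) \<le> norm (a\<^sup>2 + b\<^sup>2)" for a b :: real
  proof -
    have "2 * (\<bar>a\<bar> * \<bar>b\<bar>) \<le> a\<^sup>2 + b\<^sup>2"
      using sum_squares_bound[of "\<bar>a\<bar>" "\<bar>b\<bar>"] by (simp only: power2_abs mult.assoc)
    then have "\<bar>a\<bar> * \<bar>b\<bar> \<le> \<bar>a\<^sup>2 + b\<^sup>2\<bar>" using zero_le_power2[of a] zero_le_power2[of b] by linarith
    then show ?thesis by (simp only: real_norm_def abs_mult)
  qed
  then show "AE x in M. norm (f x * g x) \<le> norm ((f x)\<^sup>2 + (g x)\<^sup>2)" by simp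
qed

lemma Lsq_lincomb:
  assumes "f \<in> Lsq M" "g \<in> Lsq M"
  shows "(\<lambda>x. a * f x + b * g x) \<in> Lsq M"
proof -
  have "integrable M (\<lambda>x. a\<^sup>2 * (f x)\<^sup>2 + 2 * a * b * (f x * g x) + b\<^sup>2 * (g x)\<^sup>2)"
    using assms by (intro Bochner_Integration.integrable_add integrable_mult_right Lsq_integrable_mult)
      (auto simp: Lsq_def)
  then show ?thesis
    using assms unfolding Lsq_def by (auto simp: power2_eq_square algebra_simps)
qed

lemma Lsq_add: "f \<in> Lsq M \<Longrightarrow> g \<in> Lsq M \<Longrightarrow> (\<lambda>x. f x + g x) \<in> Lsq M"
  using Lsq_lincomb[of f M g 1 1] by simp

lemma Lsq_diff: "f \<in> Lsq M \<Longrightarrow> g \<in> Lsq M \<Longrightarrow> (\<lambda>x. f x - g x) \<in> Lsq M"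
  using Lsq_lincomb[of f M g 1 "-1"] by simp

lemma Lsq_cmult: "f \<in> Lsq M \<Longrightarrow> (\<lambda>x. c * f x) \<in> Lsq M"
  using Lsq_lincomb[of f M f c 0] by simp

lemma Lsq_uminus: "f \<in> Lsq M \<Longrightarrow> (\<lambda>x. - f x) \<in> Lsq M"
  using Lsq_cmult[of f M "-1"] by simp

lemma Lsq_bound:
  assumes "f \<in> Lsq M" "g \<in> borel_measurable M" "AE x in M. \<bar>g x\<bar> \<le> c * \<bar>f x\<bar>"
  shows "g \<in> Lsq M"
proof -
  have "integrable M (\<lambda>x. (g x)\<^sup>2)"
  proof (rule Bochner_Integration.integrable_bound)
    show "integrable M (\<lambda>x. c\<^sup>2 * (f x)\<^sup>2)" using assms(1) by (simp add: Lsq_def)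
    show "AE x in M. norm ((g x)\<^sup>2) \<le> norm (c\<^sup>2 * (f x)\<^sup>2)"
      using assms(3)
    proof eventually_elim
      case (elim x)
      then have "\<bar>g x\<bar>\<^sup>2 \<le> (c * \<bar>f x\<bar>)\<^sup>2" by (intro power_mono) auto
      then show ?case by (simp add: power_mult_distrib)
    qed
  qed (use assms in simp)
  then show ?thesis using assms by (simp add: Lsq_def)
qed

lemma Lsq_bounded_mult:
  assumes "f \<in> Lsq M" "g \<in> borel_measurable M" "AE x in M. \<bar>g x\<bar> \<le> c"
  shows "(\<lambda>x. g x * f x) \<in> Lsq M"
proof (rule Lsq_bound[OF assms(1), where c = c])
  show "(\<lambda>x. g x * f x) \<in> borel_measurable M"
    using assms(2) Lsq_measurable[OF assms(1)] by (rule borel_measurable_times)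
  show "AE x in M. \<bar>g x * f x\<bar> \<le> c * \<bar>f x\<bar>"
    using assms(3) by eventually_elim (simp add: abs_mult mult_right_mono)
qed

lemma Lsq_bounded_finite:
  assumes "finite_measure M" "g \<in> borel_measurable M" "AE x in M. \<bar>g x\<bar> \<le> c"
  shows "g \<in> Lsq M"
proof (rule Lsq_bound[where f = "\<lambda>_. 1" and c = c])
  interpret finite_measure M by fact
  show "(\<lambda>_. 1) \<in> Lsq M" by (simp add: Lsq_def)
qed (use assms in auto)

lemma Lsq_integrable_finite:
  assumes "finite_measure M" "f \<in> Lsq M"
  shows "integrable M f"
  using Lsq_integrable_mult[OF assms(2) Lsq_bounded_finite[OF assms(1), of "\<lambda>_. 1" 1]] by simp

section \<open>Inner product and norm of L2\<close>

lemma Lsq_inner_commute: "Lsq_inner M f g = Lsq_inner M g f"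
  by (simp add: Lsq_inner_def mult.commute)

lemma Lsq_inner_lincomb_left:
  assumes "f \<in> Lsq M" "g \<in> Lsq M" "h \<in> Lsq M"
  shows "Lsq_inner M (\<lambda>x. a * f x + b * g x) h = a * Lsq_inner M f h + b * Lsq_inner M g h"
proof -
  have "Lsq_inner M (\<lambda>x. a * f x + b * g x) h = (LINT x|M. a * (f x * h x) + b * (g x * h x))"
    unfolding Lsq_inner_def by (rule Bochner_Integration.integral_cong) (auto simp: algebra_simps)
  then show ?thesis
    using assms by (simp add: Lsq_inner_def Lsq_integrable_mult)
qed

lemma Lsq_inner_lincomb_right:
  assumes "f \<in> Lsq M" "g \<in> Lsq M" "h \<in> Lsq M"
  shows "Lsq_inner M h (\<lambda>x. a * f x + b * g x) = a * Lsq_inner M h f + b * Lsq_inner M h g"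
  using Lsq_inner_lincomb_left[OF assms] by (simp add: Lsq_inner_commute)

lemma Lsq_inner_diff_left:
  "f \<in> Lsq M \<Longrightarrow> g \<in> Lsq M \<Longrightarrow> h \<in> Lsq M \<Longrightarrow>
    Lsq_inner M (\<lambda>x. f x - g x) h = Lsq_inner M f h - Lsq_inner M g h"
  using Lsq_inner_lincomb_left[of f M g h 1 "-1"] by simp

lemma Lsq_inner_diff_right:
  "f \<in> Lsq M \<Longrightarrow> g \<in> Lsq M \<Longrightarrow> h \<in> Lsq M \<Longrightarrow>
    Lsq_inner M h (\<lambda>x. f x - g x) = Lsq_inner M h f - Lsq_inner M h g"
  using Lsq_inner_lincomb_right[of f M g h 1 "-1"] by simp

lemma Lsq_inner_cong_AE:
  assumes "AE x in M. f x = f' x" "AE x in M. g x = g' x"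
    and "f \<in> borel_measurable M" "f' \<in> borel_measurable M"
    and "g \<in> borel_measurable M" "g' \<in> borel_measurable M"
  shows "Lsq_inner M f g = Lsq_inner M f' g'"
  unfolding Lsq_inner_def by (rule integral_cong_AE) (use assms in auto)

lemma Lsq_inner_self_nonneg: "0 \<le> Lsq_inner M f f"
  by (simp add: Lsq_inner_def)

lemma Lsq_norm_nonneg: "0 \<le> Lsq_norm M f"
  by (simp add: Lsq_norm_def Lsq_inner_self_nonneg)

lemma Lsq_norm_power2: "(Lsq_norm M f)\<^sup>2 = Lsq_inner M f f"
  by (simp add: Lsq_norm_def Lsq_inner_self_nonneg)

lemma Lsq_norm_cong_AE:
  assumes "AE x in M. f x = f' x" "f \<in> borel_measurable M" "f' \<in> borel_measurable M"
  shows "Lsq_norm M f = Lsq_norm M f'"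
  unfolding Lsq_norm_def using Lsq_inner_cong_AE[of f f' M f f'] assms by auto

lemma Lsq_norm_minus_commute: "Lsq_norm M (\<lambda>x. f x - g x) = Lsq_norm M (\<lambda>x. g x - f x)"
  by (simp add: Lsq_norm_def Lsq_inner_def algebra_simps)

lemma Lsq_inner_self_eq_0:
  assumes "f \<in> Lsq M" "Lsq_inner M f f = 0"
  shows "AE x in M. f x = 0"
  using integral_nonneg_eq_0_iff_AE[OF Lsq_integrable_mult[OF assms(1,1)]] assms(2)
  by (simp add: Lsq_inner_def)

lemma Lsq_norm_eq_0: "f \<in> Lsq M \<Longrightarrow> Lsq_norm M f = 0 \<Longrightarrow> AE x in M. f x = 0"
  using Lsq_inner_self_eq_0[of f M] by (simp add: Lsq_norm_def)

lemma Lsq_norm_mono: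
  assumes "f \<in> Lsq M" "g \<in> borel_measurable M" "AE x in M. \<bar>g x\<bar> \<le> c * \<bar>f x\<bar>" "0 \<le> c"
  shows "Lsq_norm M g \<le> c * Lsq_norm M f"
proof -
  have g: "g \<in> Lsq M" by (rule Lsq_bound[OF assms(1-3)])
  have "Lsq_inner M g g \<le> (LINT x|M. c\<^sup>2 * (f x * f x))"
    unfolding Lsq_inner_def
  proof (rule integral_mono_AE)
    show "AE x in M. g x * g x \<le> c\<^sup>2 * (f x * f x)"
      using assms(3)
    proof eventually_elim
      case (elim x)
      then have "\<bar>g x\<bar>\<^sup>2 \<le> (c * \<bar>f x\<bar>)\<^sup>2" by (intro power_mono) auto
      then show ?case by (simp add: power_mult_distrib) (simp add: power2_eq_square)
    qed
  qed (use assms(1) g in \<open>auto intro: Lsq_integrable_mult\<close>)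
  then have "Lsq_inner M g g \<le> c\<^sup>2 * Lsq_inner M f f" by (simp add: Lsq_inner_def)
  then have "sqrt (Lsq_inner M g g) \<le> sqrt (c\<^sup>2 * Lsq_inner M f f)" by (rule real_sqrt_le_mono)
  then show ?thesis using assms(4) by (simp add: Lsq_norm_def real_sqrt_mult)
qed

lemma Lsq_inner_self_lincomb:
  assumes "f \<in> Lsq M" "g \<in> Lsq M"
  shows "Lsq_inner M (\<lambda>x. a * f x + b * g x) (\<lambda>x. a * f x + b * g x) =
    a\<^sup>2 * Lsq_inner M f f + 2 * a * b * Lsq_inner M f g + b\<^sup>2 * Lsq_inner M g g"
proof -
  have "(\<lambda>x. a * f x + b * g x) \<in> Lsq M" using assms by (rule Lsq_lincomb)
  then show ?thesis
    using assms Lsq_inner_commute[of M g f]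
    by (simp add: Lsq_inner_lincomb_left Lsq_inner_lincomb_right power2_eq_square algebra_simps)
qed

text \<open>The quadratic form ||s f + t g||^2 in (s, t) is nonnegative. If ||g|| > 0, a suitable
  pair (s, t) gives the claim; if ||g|| = 0, the form is affine in t, which forces the mixed term to
  vanish.\<close>

lemma Cauchy_Schwarz_Lsq:
  assumes "f \<in> Lsq M" "g \<in> Lsq M"
  shows "\<bar>Lsq_inner M f g\<bar> \<le> Lsq_norm M f * Lsq_norm M g"
proof -
  let ?b = "Lsq_inner M f g" and ?a = "Lsq_inner M f f" and ?c = "Lsq_inner M g g"
  have pos: "0 \<le> s\<^sup>2 * ?a + 2 * s * t * ?b + t\<^sup>2 * ?c" for s t
    using Lsq_inner_self_nonneg[of M "\<lambda>x. s * f x + t * g x"] Lsq_inner_self_lincomb[OF assms, of s t]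
    by simp
  have "?b\<^sup>2 \<le> ?a * ?c"
  proof (cases "?c = 0")
    case True
    have "?b = 0"
    proof (rule ccontr)
      assume nz: "?b \<noteq> 0"
      \<comment> \<open>The value of t is chosen so that the right-hand side equals -1.\<close>
      have "0 \<le> ?a - 2 * ((?a + 1) / (2 * ?b)) * ?b"
        using pos[of 1 "- ((?a + 1) / (2 * ?b))"] True by simp
      then show False using nz by (simp add: field_simps)
    qed
    then show ?thesis using True by simp
  next
    case False
    then have c: "?c > 0" using Lsq_inner_self_nonneg[of M g] by linarith
    have "0 \<le> ?c * (?c * ?a - ?b\<^sup>2)"
      using pos[of ?c "- ?b"] by (simp add: power2_eq_square algebra_simps)
    then have "0 \<le> ?c * ?a - ?b\<^sup>2" using c by (simp add: zero_le_mult_iff)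
    then show ?thesis by (simp add: mult.commute)
  qed
  then have "sqrt (?b\<^sup>2) \<le> sqrt (?a * ?c)" by (rule real_sqrt_le_mono)
  then show ?thesis by (simp add: Lsq_norm_def real_sqrt_mult)
qed

lemma Lsq_norm_triangle:
  assumes "f \<in> Lsq M" "g \<in> Lsq M"
  shows "Lsq_norm M (\<lambda>x. f x + g x) \<le> Lsq_norm M f + Lsq_norm M g"
proof (rule power2_le_imp_le)
  have "(Lsq_norm M (\<lambda>x. f x + g x))\<^sup>2 = Lsq_inner M f f + 2 * Lsq_inner M f g + Lsq_inner M g g"
    using Lsq_inner_self_lincomb[OF assms, of 1 1] by (simp add: Lsq_norm_power2)
  also have "\<dots> \<le> (Lsq_norm M f)\<^sup>2 + 2 * (Lsq_norm M f * Lsq_norm M g) + (Lsq_norm M g)\<^sup>2"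
    using Cauchy_Schwarz_Lsq[OF assms] by (simp add: Lsq_norm_power2)
  also have "\<dots> = (Lsq_norm M f + Lsq_norm M g)\<^sup>2" by (simp add: power2_sum)
  finally show "(Lsq_norm M (\<lambda>x. f x + g x))\<^sup>2 \<le> (Lsq_norm M f + Lsq_norm M g)\<^sup>2" .
qed (simp add: Lsq_norm_nonneg)

lemma Lsq_norm_triangle_diff:
  assumes "f \<in> Lsq M" "g \<in> Lsq M" "h \<in> Lsq M"
  shows "Lsq_norm M (\<lambda>x. f x - h x) \<le> Lsq_norm M (\<lambda>x. f x - g x) + Lsq_norm M (\<lambda>x. g x - h x)"
  using Lsq_norm_triangle[of "\<lambda>x. f x - g x" M "\<lambda>x. g x - h x"] assms by (simp add: Lsq_diff)

text \<open>Membership is part of the notion because \<open>Lsq_norm\<close> carries no information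
  outside L2: the Bochner integral of a function that is not integrable is 0.\<close>

definition Lsq_lim :: "'a measure \<Rightarrow> (nat \<Rightarrow> 'a \<Rightarrow> real) \<Rightarrow> ('a \<Rightarrow> real) \<Rightarrow> bool" where
  "Lsq_lim M f g \<longleftrightarrow> (\<forall>n. f n \<in> Lsq M) \<and> g \<in> Lsq M \<and> (\<lambda>n. Lsq_norm M (\<lambda>x. f n x - g x)) \<longlonglongrightarrow> 0"

lemma Lsq_lim_inner:
  assumes "Lsq_lim M f f'" "Lsq_lim M g g'"
  shows "(\<lambda>n. Lsq_inner M (f n) (g n)) \<longlonglongrightarrow> Lsq_inner M f' g'"
proof (rule LIM_zero_cancel, rule tendsto_rabs_zero_cancel, rule tendsto_sandwich[OF _ _ tendsto_const])
  let ?d = "\<lambda>n. Lsq_norm M (\<lambda>x. f n x - f' x)" and ?e = "\<lambda>n. Lsq_norm M (\<lambda>x. g n x - g' x)"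
  note [simp] = assms[unfolded Lsq_lim_def]
  have "\<bar>Lsq_inner M (f n) (g n) - Lsq_inner M f' g'\<bar> \<le>
      ?d n * ?e n + ?d n * Lsq_norm M g' + Lsq_norm M f' * ?e n" for n
  proof -
    \<comment> \<open>Expanding around the limits leaves only factors that are fixed or tend to 0,
      so no separate bound on the norms of \<open>f n\<close> and \<open>g n\<close> enters.\<close>
    have eq: "Lsq_inner M (f n) (g n) - Lsq_inner M f' g' =
        Lsq_inner M (\<lambda>x. f n x - f' x) (\<lambda>x. g n x - g' x) + Lsq_inner M (\<lambda>x. f n x - f' x) g'
        + Lsq_inner M f' (\<lambda>x. g n x - g' x)"
      by (simp add: Lsq_inner_diff_left Lsq_inner_diff_right Lsq_diff)
    have "\<bar>Lsq_inner M (\<lambda>x. f n x - f' x) (\<lambda>x. g n x - g' x)\<bar> \<le> ?d n * ?e n"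
      "\<bar>Lsq_inner M (\<lambda>x. f n x - f' x) g'\<bar> \<le> ?d n * Lsq_norm M g'"
      "\<bar>Lsq_inner M f' (\<lambda>x. g n x - g' x)\<bar> \<le> Lsq_norm M f' * ?e n"
      by (intro Cauchy_Schwarz_Lsq; simp add: Lsq_diff)+
    then show ?thesis unfolding eq by linarith
  qed
  then show "\<forall>\<^sub>F n in sequentially. \<bar>Lsq_inner M (f n) (g n) - Lsq_inner M f' g'\<bar> \<le>
      ?d n * ?e n + ?d n * Lsq_norm M g' + Lsq_norm M f' * ?e n" by simp
  have "(\<lambda>n. ?d n * ?e n + ?d n * Lsq_norm M g' + Lsq_norm M f' * ?e n) \<longlonglongrightarrow>
      0 * 0 + 0 * Lsq_norm M g' + Lsq_norm M f' * 0"
    by (intro tendsto_intros) auto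
  then show "(\<lambda>n. ?d n * ?e n + ?d n * Lsq_norm M g' + Lsq_norm M f' * ?e n) \<longlonglongrightarrow> 0" by simp
qed simp

lemma Lsq_lim_const: "g \<in> Lsq M \<Longrightarrow> Lsq_lim M (\<lambda>n. g) g"
  by (simp add: Lsq_lim_def Lsq_norm_def Lsq_inner_def)

lemma Lsq_lim_diff_const:
  assumes "Lsq_lim M f g" "h \<in> Lsq M"
  shows "Lsq_lim M (\<lambda>n x. f n x - h x) (\<lambda>x. g x - h x)"
  using assms by (simp add: Lsq_lim_def Lsq_diff)

text \<open>Membership of the limit is concluded together with the bound, so that the lemma applies
  to a difference \<open>f n - g\<close> before anything is known about the integrability of
  \<open>g\<close>.\<close>

lemma Lsq_Fatou:
  assumes h: "\<And>k. h k \<in> Lsq M" and lim: "AE x in M. (\<lambda>k. h k x) \<longlonglongrightarrow> g x"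
    and g: "g \<in> borel_measurable M"
    and e: "\<forall>\<^sub>F k in sequentially. Lsq_norm M (h k) \<le> e"
  shows "g \<in> Lsq M \<and> Lsq_norm M g \<le> e"
proof -
  have e0: "0 \<le> e"
    using eventually_happens'[OF sequentially_bot e] Lsq_norm_nonneg order_trans by blast
  have "(\<integral>\<^sup>+x. ennreal ((g x)\<^sup>2) \<partial>M) = (\<integral>\<^sup>+x. liminf (\<lambda>k. ennreal ((h k x)\<^sup>2)) \<partial>M)"
  proof (rule nn_integral_cong_AE)
    show "AE x in M. ennreal ((g x)\<^sup>2) = liminf (\<lambda>k. ennreal ((h k x)\<^sup>2))"
      using lim
    proof eventually_elim
      case (elim x)
      then have "(\<lambda>k. ennreal ((h k x)\<^sup>2)) \<longlonglongrightarrow> ennreal ((g x)\<^sup>2)"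
        by (intro tendsto_ennrealI tendsto_power)
      from lim_imp_Liminf[OF sequentially_bot this] show ?case by simp
    qed
  qed
  also have "\<dots> \<le> liminf (\<lambda>k. \<integral>\<^sup>+x. ennreal ((h k x)\<^sup>2) \<partial>M)"
    using Lsq_measurable[OF h] by (intro nn_integral_liminf) simp
  also have "\<dots> \<le> liminf (\<lambda>k::nat. ennreal (e\<^sup>2))"
  proof (rule Liminf_mono, use e in eventually_elim)
    case (elim k)
    have "(\<integral>\<^sup>+x. ennreal ((h k x)\<^sup>2) \<partial>M) = ennreal (LINT x|M. (h k x)\<^sup>2)"
      using h by (intro nn_integral_eq_integral) (auto simp: Lsq_def)
    also have "(LINT x|M. (h k x)\<^sup>2) = (Lsq_norm M (h k))\<^sup>2"
      by (simp add: Lsq_norm_power2) (simp add: Lsq_inner_def power2_eq_square)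
    also have "\<dots> \<le> e\<^sup>2" using elim by (intro power_mono Lsq_norm_nonneg)
    finally show ?case by (simp add: ennreal_leI)
  qed
  also have "\<dots> = ennreal (e\<^sup>2)" by (rule Liminf_const) simp
  finally have le: "(\<integral>\<^sup>+x. ennreal ((g x)\<^sup>2) \<partial>M) \<le> ennreal (e\<^sup>2)" .
  have int: "integrable M (\<lambda>x. (g x)\<^sup>2)"
    using le g by (intro integrableI_bounded) (auto simp: le_less_trans)
  have "ennreal (LINT x|M. (g x)\<^sup>2) \<le> ennreal (e\<^sup>2)"
    using le nn_integral_eq_integral[OF int] by simp
  then have "Lsq_inner M g g \<le> e\<^sup>2"
    by (simp add: Lsq_inner_def power2_eq_square e0)
  then have "Lsq_norm M g \<le> e"
    unfolding Lsq_norm_def using e0 real_le_lsqrt by auto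
  with int g show ?thesis by (simp add: Lsq_def)
qed

text \<open>Fatou's lemma for the differences \<open>f k - g\<close> bounds the norm of
  \<open>h - g\<close> by every e > 0.\<close>

lemma Lsq_lim_AE_unique:
  assumes "Lsq_lim M f g" "AE x in M. (\<lambda>k. f k x) \<longlonglongrightarrow> h x" "h \<in> borel_measurable M"
  shows "AE x in M. g x = h x"
proof -
  note [simp] = assms(1)[unfolded Lsq_lim_def]
  have *: "(\<lambda>x. h x - g x) \<in> Lsq M \<and> Lsq_norm M (\<lambda>x. h x - g x) \<le> e" if "e > 0" for e
  proof (rule Lsq_Fatou[where h = "\<lambda>k x. f k x - g x"])
    show "AE x in M. (\<lambda>k. f k x - g x) \<longlonglongrightarrow> h x - g x"
      using assms(2) by eventually_elim (intro tendsto_intros)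
    show "\<forall>\<^sub>F k in sequentially. Lsq_norm M (\<lambda>x. f k x - g x) \<le> e"
      using order_tendstoD(2)[of "\<lambda>k. Lsq_norm M (\<lambda>x. f k x - g x)" 0 sequentially e] that
      by (auto elim!: eventually_mono)
    show "(\<lambda>x. h x - g x) \<in> borel_measurable M"
      using assms(3) by (intro borel_measurable_diff) (simp_all add: Lsq_measurable)
  qed (simp add: Lsq_diff)
  have "Lsq_norm M (\<lambda>x. h x - g x) \<le> 0"
    by (rule field_le_epsilon) (use * in auto)
  then have "Lsq_norm M (\<lambda>x. h x - g x) = 0" using Lsq_norm_nonneg[of M "\<lambda>x. h x - g x"] by linarith
  then have "AE x in M. h x - g x = 0" using * Lsq_norm_eq_0 zero_less_one by blast
  then show ?thesis by eventually_elim simp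
qed

lemma Lsq_lim_unique:
  assumes "Lsq_lim M f g" "Lsq_lim M f h"
  shows "AE x in M. g x = h x"
proof -
  have [simp]: "f n \<in> Lsq M" "g \<in> Lsq M" "h \<in> Lsq M" for n using assms by (auto simp: Lsq_lim_def)
  have lim: "(\<lambda>n. Lsq_norm M (\<lambda>x. f n x - g x) + Lsq_norm M (\<lambda>x. f n x - h x)) \<longlonglongrightarrow> 0 + 0"
    using assms by (intro tendsto_add) (simp_all add: Lsq_lim_def)
  have le: "Lsq_norm M (\<lambda>x. g x - h x) \<le> Lsq_norm M (\<lambda>x. f n x - g x) + Lsq_norm M (\<lambda>x. f n x - h x)"
    for n
    using Lsq_norm_triangle_diff[of g M "f n" h] Lsq_norm_minus_commute[of M g "f n"] by simp
  have "Lsq_norm M (\<lambda>x. g x - h x) \<le> 0 + 0"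
    by (rule LIMSEQ_le_const[OF lim]) (intro exI allI impI le)
  then have "Lsq_norm M (\<lambda>x. g x - h x) = 0" using Lsq_norm_nonneg[of M "\<lambda>x. g x - h x"] by linarith
  then have "AE x in M. g x - h x = 0" by (intro Lsq_norm_eq_0 Lsq_diff) simp_all
  then show ?thesis by eventually_elim simp
qed

text \<open>Along indices where consecutive differences \<open>d k\<close> have norm below 2^-k, the
  sum of \<open>2 ^ k * (d k x)\<^sup>2\<close> has integral at most 2, so it is finite a.e.; up to
  a geometric series it dominates the telescoping sum. Weighting the squares works on every measure
  space, whereas summing the L1 norms would call for a finite measure. The condition
  \<open>r k \<ge> k\<close> is enough to preserve limits.\<close>

lemma Lsq_Cauchy_fast_subseq:
  assumes f: "\<And>n. f n \<in> Lsq M"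
    and C: "\<And>e. e > 0 \<Longrightarrow> \<exists>N. \<forall>m\<ge>N. \<forall>n\<ge>N. Lsq_norm M (\<lambda>x. f m x - f n x) < e"
  obtains r where "\<And>k::nat. r k \<ge> k" "AE x in M. convergent (\<lambda>k. f (r k) x)"
proof -
  have "\<exists>N. \<forall>k. \<forall>m\<ge>N k. \<forall>n\<ge>N k. Lsq_norm M (\<lambda>x. f m x - f n x) < (1/2) ^ k"
    by (intro choice allI C) simp
  then obtain N where N: "\<And>k m n. m \<ge> N k \<Longrightarrow> n \<ge> N k \<Longrightarrow> Lsq_norm M (\<lambda>x. f m x - f n x) < (1/2::real) ^ k"
    by blast
  \<comment> \<open>The partial sums of thresholds are increasing and at least \<open>N k\<close>,
    so both indices in \<open>d k\<close> lie beyond \<open>N k\<close>; the summand k gives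
    \<open>r k \<ge> k\<close>.\<close>
  define r where "r k = (\<Sum>j\<le>k. N j) + k" for k
  have rN: "r k \<ge> N k" "r (Suc k) \<ge> r k" for k
    by (auto simp: r_def intro: trans_le_add1 member_le_sum)
  define d where "d k x = f (r (Suc k)) x - f (r k) x" for k x
  have d: "d k \<in> Lsq M" for k unfolding d_def by (intro Lsq_diff f)
  have [measurable]: "d k \<in> borel_measurable M" for k by (rule Lsq_measurable[OF d])
  have dk: "2 ^ k * Lsq_inner M (d k) (d k) \<le> (1/2) ^ k" for k
  proof -
    have "Lsq_norm M (d k) < (1/2) ^ k"
      unfolding d_def using rN(1)[of k] rN(2)[of k] by (intro N) auto
    from power_mono[OF less_imp_le[OF this] Lsq_norm_nonneg, of 2]
    have "2 ^ k * Lsq_inner M (d k) (d k) \<le> 2 ^ k * ((1/2) ^ k)\<^sup>2"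
      by (intro mult_left_mono) (auto simp: Lsq_norm_power2)
    also have "\<dots> = (1/2) ^ k" by (simp add: power2_eq_square power_divide)
    finally show ?thesis .
  qed
  have "(\<integral>\<^sup>+x. (\<Sum>k. ennreal (2 ^ k * (d k x)\<^sup>2)) \<partial>M) = (\<Sum>k. \<integral>\<^sup>+x. ennreal (2 ^ k * (d k x)\<^sup>2) \<partial>M)"
    by (intro nn_integral_suminf) simp
  also have "\<dots> = (\<Sum>k. ennreal (2 ^ k * Lsq_inner M (d k) (d k)))"
  proof (rule suminf_cong)
    fix k
    show "(\<integral>\<^sup>+x. ennreal (2 ^ k * (d k x)\<^sup>2) \<partial>M) = ennreal (2 ^ k * Lsq_inner M (d k) (d k))"
      using d[of k] by (subst nn_integral_eq_integral) (auto simp: Lsq_def Lsq_inner_def power2_eq_square)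
  qed
  also have "\<dots> \<le> (\<Sum>k. ennreal ((1/2) ^ k))"
    by (intro suminf_le ennreal_leI dk) auto
  also have "\<dots> = ennreal (\<Sum>k. (1/2) ^ k)"
    by (rule suminf_ennreal2) (auto intro: summable_geometric)
  finally have "(\<integral>\<^sup>+x. (\<Sum>k. ennreal (2 ^ k * (d k x)\<^sup>2)) \<partial>M) \<noteq> \<infinity>" by (auto simp: top_unique)
  then have "AE x in M. (\<Sum>k. ennreal (2 ^ k * (d k x)\<^sup>2)) \<noteq> \<infinity>"
    by (intro nn_integral_PInf_AE) simp
  then have "AE x in M. convergent (\<lambda>k. f (r k) x)"
  proof eventually_elim
    case (elim x)
    then have s: "summable (\<lambda>k. 2 ^ k * (d k x)\<^sup>2)"
      by (intro summable_suminf_not_top) auto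
    \<comment> \<open>If |d| exceeds 2^-k, then 1 is at most 2^k |d|, and multiplying by |d| bounds
      |d| by 2^k d^2.\<close>
    have le: "\<bar>d k x\<bar> \<le> (1/2) ^ k + 2 ^ k * (d k x)\<^sup>2" for k
    proof (cases "\<bar>d k x\<bar> \<le> (1/2) ^ k")
      case False
      then have "1 * \<bar>d k x\<bar> \<le> (2 ^ k * \<bar>d k x\<bar>) * \<bar>d k x\<bar>"
        by (intro mult_right_mono) (auto simp: field_simps)
      also have "(2 ^ k * \<bar>d k x\<bar>) * \<bar>d k x\<bar> = 2 ^ k * (d k x)\<^sup>2"
        by (simp add: power2_eq_square mult.assoc)
      finally show ?thesis by (simp add: add_increasing)
    qed (simp add: add_increasing2)
    have "summable (\<lambda>k. d k x)"
      by (rule summable_comparison_test'[of "\<lambda>k. (1/2) ^ k + 2 ^ k * (d k x)\<^sup>2" 0])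
        (use s le in \<open>auto intro: summable_add summable_geometric\<close>)
    then have "convergent (\<lambda>k. f (r 0) x + (\<Sum>j<k. d j x))"
      using summable_LIMSEQ convergent_def tendsto_add[OF tendsto_const] by blast
    moreover have "f (r 0) x + (\<Sum>j<k. d j x) = f (r k) x" for k
      by (induction k) (auto simp: d_def)
    ultimately show ?case by simp
  qed
  moreover have "r k \<ge> k" for k by (simp add: r_def)
  ultimately show ?thesis using that by blast
qed

text \<open>The limit is built pointwise from an a.e. convergent subsequence. With n fixed, Fatou's
  lemma for \<open>f n - f (r k)\<close> as k grows carries the Cauchy bound over to
  \<open>f n - g\<close>, for the whole sequence.\<close>

lemma Lsq_complete:
  assumes f: "\<And>n. f n \<in> Lsq M"
    and C: "\<And>e. e > 0 \<Longrightarrow> \<exists>N. \<forall>m\<ge>N. \<forall>n\<ge>N. Lsq_norm M (\<lambda>x. f m x - f n x) < e"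
  obtains g where "Lsq_lim M f g"
proof -
  obtain r where r: "\<And>k::nat. r k \<ge> k" and conv: "AE x in M. convergent (\<lambda>k. f (r k) x)"
    using Lsq_Cauchy_fast_subseq[OF f C] by blast
  define g where "g x = lim (\<lambda>k. f (r k) x)" for x
  have gm: "g \<in> borel_measurable M"
    unfolding g_def using f by (intro borel_measurable_lim_metric) (auto intro: Lsq_measurable)
  have tail: "\<exists>N. \<forall>n\<ge>N. (\<lambda>x. f n x - g x) \<in> Lsq M \<and> Lsq_norm M (\<lambda>x. f n x - g x) \<le> e" if e: "e > 0" for e
  proof -
    obtain N where N: "\<forall>m\<ge>N. \<forall>n\<ge>N. Lsq_norm M (\<lambda>x. f m x - f n x) < e" using C[OF e] by blast
    have "(\<lambda>x. f n x - g x) \<in> Lsq M \<and> Lsq_norm M (\<lambda>x. f n x - g x) \<le> e" if n: "n \<ge> N" for n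
    proof (rule Lsq_Fatou[where h = "\<lambda>k x. f n x - f (r k) x"])
      show "AE x in M. (\<lambda>k. f n x - f (r k) x) \<longlonglongrightarrow> f n x - g x"
        using conv by eventually_elim (intro tendsto_diff tendsto_const, simp add: g_def convergent_LIMSEQ_iff)
      show "\<forall>\<^sub>F k in sequentially. Lsq_norm M (\<lambda>x. f n x - f (r k) x) \<le> e"
        using N n r by (intro eventually_sequentiallyI[of N]) (meson less_imp_le order_trans)
      show "(\<lambda>x. f n x - g x) \<in> borel_measurable M"
        by (intro borel_measurable_diff Lsq_measurable f gm)
    qed (intro Lsq_diff f)
    then show ?thesis by blast
  qed
  obtain N where "(\<lambda>x. f N x - g x) \<in> Lsq M" using tail[of 1] by auto
  then have "(\<lambda>x. f N x - (f N x - g x)) \<in> Lsq M" by (rule Lsq_diff[OF f])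
  then have g: "g \<in> Lsq M" by simp
  have "(\<lambda>n. Lsq_norm M (\<lambda>x. f n x - g x)) \<longlonglongrightarrow> 0"
  proof (rule LIMSEQ_I)
    fix e :: real assume "e > 0"
    then obtain N where "\<forall>n\<ge>N. Lsq_norm M (\<lambda>x. f n x - g x) \<le> e / 2" using tail[of "e/2"] by auto
    then have "\<forall>n\<ge>N. norm (Lsq_norm M (\<lambda>x. f n x - g x) - 0) < e"
      using \<open>e > 0\<close> by (auto simp: Lsq_norm_nonneg intro: le_less_trans)
    then show "\<exists>N. \<forall>n\<ge>N. norm (Lsq_norm M (\<lambda>x. f n x - g x) - 0) < e" ..
  qed
  then show ?thesis using that f g by (simp add: Lsq_lim_def)
qed

text \<open>A convergent sequence is Cauchy, so a subsequence has some a.e. limit, and that limit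
  must agree with \<open>g\<close> a.e.\<close>

lemma Lsq_lim_AE_subseq:
  assumes "Lsq_lim M f g"
  obtains r where "\<And>k::nat. r k \<ge> k" "AE x in M. (\<lambda>k. f (r k) x) \<longlonglongrightarrow> g x"
proof -
  note [simp] = assms[unfolded Lsq_lim_def]
  have C: "\<exists>N. \<forall>m\<ge>N. \<forall>n\<ge>N. Lsq_norm M (\<lambda>x. f m x - f n x) < e" if "e > 0" for e
  proof -
    have "\<forall>\<^sub>F k in sequentially. Lsq_norm M (\<lambda>x. f k x - g x) < e / 2"
      using order_tendstoD(2)[of "\<lambda>k. Lsq_norm M (\<lambda>x. f k x - g x)" 0 sequentially "e/2"] that by simp
    then obtain N where N: "\<And>n. n \<ge> N \<Longrightarrow> Lsq_norm M (\<lambda>x. f n x - g x) < e / 2"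
      by (auto simp: eventually_sequentially)
    have "Lsq_norm M (\<lambda>x. f m x - f n x) < e" if "m \<ge> N" "n \<ge> N" for m n
      using N[OF that(1)] N[OF that(2)] Lsq_norm_triangle_diff[of "f m" M g "f n"]
        Lsq_norm_minus_commute[of M g "f n"] by simp
    then show ?thesis by blast
  qed
  obtain r where r: "\<And>k::nat. r k \<ge> k" and conv: "AE x in M. convergent (\<lambda>k. f (r k) x)"
    using Lsq_Cauchy_fast_subseq[of f M] C by auto
  define h where "h x = lim (\<lambda>k. f (r k) x)" for x
  have hm: "h \<in> borel_measurable M"
    unfolding h_def by (intro borel_measurable_lim_metric) (auto intro: Lsq_measurable)
  have lim: "AE x in M. (\<lambda>k. f (r k) x) \<longlonglongrightarrow> h x"
    using conv by eventually_elim (auto simp: h_def convergent_LIMSEQ_iff)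
  have "filterlim r at_top sequentially"
    by (rule filterlim_at_top_mono[OF filterlim_ident]) (use r in auto)
  then have "(\<lambda>k. Lsq_norm M (\<lambda>x. f (r k) x - g x)) \<longlonglongrightarrow> 0"
    by (rule filterlim_compose[rotated]) simp
  then have "Lsq_lim M (\<lambda>k. f (r k)) g" by (simp add: Lsq_lim_def)
  from Lsq_lim_AE_unique[OF this lim hm] lim have "AE x in M. (\<lambda>k. f (r k) x) \<longlonglongrightarrow> g x"
    by eventually_elim simp
  with r show ?thesis using that by blast
qed

lemma Lsq_lim_subseq:
  assumes "Lsq_lim M f g" "\<And>k::nat. r k \<ge> k"
  shows "Lsq_lim M (\<lambda>k. f (r k)) g"
proof -
  have "filterlim r at_top sequentially"
    by (rule filterlim_at_top_mono[OF filterlim_ident]) (use assms in auto)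
  then have "(\<lambda>k. Lsq_norm M (\<lambda>x. f (r k) x - g x)) \<longlonglongrightarrow> 0"
    by (rule filterlim_compose[rotated]) (use assms in \<open>simp add: Lsq_lim_def\<close>)
  then show ?thesis using assms by (simp add: Lsq_lim_def)
qed

lemma Lsq_dominated_lim:
  assumes "w \<in> Lsq M" "\<And>n. f n \<in> borel_measurable M" "g \<in> borel_measurable M"
    and lim: "AE x in M. (\<lambda>n. f n x) \<longlonglongrightarrow> g x" and bd: "\<And>n. AE x in M. \<bar>f n x\<bar> \<le> c * \<bar>w x\<bar>"
  shows "Lsq_lim M f g"
proof -
  have fL: "f n \<in> Lsq M" for n by (rule Lsq_bound[OF assms(1) assms(2) bd])
  have "AE x in M. \<forall>n. \<bar>f n x\<bar> \<le> c * \<bar>w x\<bar>" using bd by (simp add: AE_all_countable)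
  with lim have gb: "AE x in M. \<bar>g x\<bar> \<le> c * \<bar>w x\<bar>"
  proof eventually_elim
    case (elim x)
    then show ?case by (intro LIMSEQ_le_const2[OF tendsto_rabs]) auto
  qed
  then have gL: "g \<in> Lsq M" by (intro Lsq_bound[OF assms(1,3)])
  have "(\<lambda>n. LINT x|M. (f n x - g x)\<^sup>2) \<longlonglongrightarrow> (LINT x|M. 0)"
  proof (rule integral_dominated_convergence[where w = "\<lambda>x. (2 * c)\<^sup>2 * (w x)\<^sup>2"])
    show "integrable M (\<lambda>x. (2 * c)\<^sup>2 * (w x)\<^sup>2)" using assms(1) by (simp add: Lsq_def)
    show "AE x in M. (\<lambda>n. (f n x - g x)\<^sup>2) \<longlonglongrightarrow> 0"
      using lim
    proof eventually_elim
      case (elim x)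
      have "(\<lambda>n. (f n x - g x)\<^sup>2) \<longlonglongrightarrow> (g x - g x)\<^sup>2" by (intro tendsto_intros elim)
      then show ?case by simp
    qed
    fix n
    show "AE x in M. norm ((f n x - g x)\<^sup>2) \<le> (2 * c)\<^sup>2 * (w x)\<^sup>2"
      using gb bd[of n]
    proof eventually_elim
      case (elim x)
      then have "\<bar>f n x - g x\<bar>\<^sup>2 \<le> (2 * c * \<bar>w x\<bar>)\<^sup>2" by (intro power_mono) auto
      then show ?case by (simp add: power_mult_distrib)
    qed
  qed (use assms(2,3) in auto)
  then have "(\<lambda>n. sqrt (LINT x|M. (f n x - g x)\<^sup>2)) \<longlonglongrightarrow> sqrt 0"
    by (intro tendsto_real_sqrt) simp
  then show ?thesis using fL gL
    by (simp add: Lsq_lim_def Lsq_norm_def Lsq_inner_def power2_eq_square)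
qed

subsection \<open>Smooth functions\<close>

abbreviation pderivative :: "('a::euclidean_space \<Rightarrow> real) \<Rightarrow> 'a \<Rightarrow> 'a \<Rightarrow> real" where
  "pderivative f i \<equiv> \<lambda>x. frechet_derivative f (at x) i"

abbreviation smooth :: "('a::euclidean_space \<Rightarrow> real) \<Rightarrow> bool" where
  "smooth f \<equiv> smooth_on f UNIV"

lemma Ck_on_UNIV_continuous: "Ck_on k f UNIV \<Longrightarrow> continuous_on UNIV f"
  by (cases k) (auto intro!: continuous_at_imp_continuous_on differentiable_imp_continuous_within)

text \<open>Continuity is not a clause of \<open>Ck_on (Suc k)\<close>; it is recovered from
  differentiability at the bottom of the recursion.\<close>

lemma Ck_on_SucD: "Ck_on (Suc k) f UNIV \<Longrightarrow> Ck_on k f UNIV"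
proof (induction k arbitrary: f)
  case 0
  from Ck_on_UNIV_continuous[OF this] show ?case by simp
next
  case (Suc k)
  have "Ck_on k (pderivative f i) UNIV" if "i \<in> Basis" for i
    using Suc.prems that by (intro Suc.IH) (subst (asm) Ck_on.simps, blast)
  moreover have "\<forall>x\<in>UNIV. f differentiable (at x)" using Suc.prems by simp
  ultimately show ?case by simp
qed

lemma smooth_differentiable: "smooth f \<Longrightarrow> f differentiable (at x)"
  unfolding smooth_on_def by (drule spec[of _ "Suc 0"]) simp

lemma smooth_pderivative: "smooth f \<Longrightarrow> i \<in> Basis \<Longrightarrow> smooth (pderivative f i)"
proof -
  assume f: "smooth f" and i: "i \<in> Basis"
  have "Ck_on (Suc k) f UNIV" for k using f unfolding smooth_on_def by (rule spec)
  then show ?thesis using i by (simp add: smooth_on_def)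
qed

lemma smooth_continuous_on: "smooth f \<Longrightarrow> continuous_on UNIV f"
  unfolding smooth_on_def by (drule spec[of _ 0]) simp

lemma smooth_has_derivative:
  "smooth f \<Longrightarrow> (f has_derivative frechet_derivative f (at x)) (at x)"
  using smooth_differentiable frechet_derivative_works by blast

lemma smooth_onI: "(\<And>k. Ck_on k f UNIV) \<Longrightarrow> smooth f"
  by (simp add: smooth_on_def)

text \<open>By uniqueness of derivatives, a closed form found by the usual rules may replace the
  \<open>frechet_derivative\<close> in the recursion.\<close>

lemma Ck_on_SucI:
  assumes "\<And>x. (f has_derivative f' x) (at x)" "\<And>i. i \<in> Basis \<Longrightarrow> Ck_on k (\<lambda>x. f' x i) UNIV"
  shows "Ck_on (Suc k) f UNIV"
proof -
  have "frechet_derivative f (at x) = f' x" for x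
    using frechet_derivative_at[OF assms(1)] by simp
  then show ?thesis using assms by (auto simp: differentiable_def)
qed

lemma Ck_on_const: "Ck_on k (\<lambda>x. c) UNIV"
  by (induction k arbitrary: c) auto

lemma Ck_on_add: "Ck_on k f UNIV \<Longrightarrow> Ck_on k g UNIV \<Longrightarrow> Ck_on k (\<lambda>x. f x + g x) UNIV"
proof (induction k arbitrary: f g)
  case 0 then show ?case by (auto intro: continuous_intros)
next
  case (Suc k)
  then show ?case
    by (intro Ck_on_SucI[where f' = "\<lambda>x v. frechet_derivative f (at x) v + frechet_derivative g (at x) v"]
        has_derivative_add) (auto simp: frechet_derivative_works)
qed

lemma Ck_on_mult: "Ck_on k f UNIV \<Longrightarrow> Ck_on k g UNIV \<Longrightarrow> Ck_on k (\<lambda>x. f x * g x) UNIV"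
proof (induction k arbitrary: f g)
  case 0 then show ?case by (auto intro: continuous_intros)
next
  case (Suc k)
  have fg: "Ck_on k f UNIV" "Ck_on k g UNIV" using Suc.prems by (auto intro: Ck_on_SucD)
  show ?case
  proof (rule Ck_on_SucI)
    fix x
    show "((\<lambda>x. f x * g x) has_derivative
        (\<lambda>v. f x * frechet_derivative g (at x) v + frechet_derivative f (at x) v * g x)) (at x)"
      using Suc.prems by (intro has_derivative_mult) (auto simp: frechet_derivative_works)
  next
    fix i :: 'a assume "i \<in> Basis"
    then show "Ck_on k (\<lambda>x. f x * pderivative g i x + pderivative f i x * g x) UNIV"
      using Suc.prems fg by (intro Ck_on_add Suc.IH) auto
  qed
qed

lemma smooth_const: "smooth (\<lambda>x. c)"
  by (intro smooth_onI Ck_on_const)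

lemma smooth_add: "smooth f \<Longrightarrow> smooth g \<Longrightarrow> smooth (\<lambda>x. f x + g x)"
  by (simp add: smooth_on_def Ck_on_add)

lemma smooth_mult: "smooth f \<Longrightarrow> smooth g \<Longrightarrow> smooth (\<lambda>x. f x * g x)"
  by (simp add: smooth_on_def Ck_on_mult)

lemma smooth_diff: "smooth f \<Longrightarrow> smooth g \<Longrightarrow> smooth (\<lambda>x. f x - g x)"
  using smooth_add[OF _ smooth_mult[OF smooth_const[of "-1"]], of f g] by simp

lemma smooth_inner: "smooth (\<lambda>x. x \<bullet> v)"
proof (rule smooth_onI)
  fix k show "Ck_on k (\<lambda>x. x \<bullet> v) UNIV"
  proof (cases k)
    case (Suc j)
    show ?thesis unfolding Suc
      by (rule Ck_on_SucI[where f' = "\<lambda>x u. u \<bullet> v"])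
        (auto intro: Ck_on_const derivative_eq_intros)
  qed (auto intro: continuous_intros)
qed

lemma smooth_prod: "finite I \<Longrightarrow> (\<And>i. i \<in> I \<Longrightarrow> smooth (f i)) \<Longrightarrow> smooth (\<lambda>x. \<Prod>i\<in>I. f i x)"
  by (induction I rule: finite_induct) (auto intro: smooth_const smooth_mult)

text \<open>Supplying the whole tower of derivatives of the outer function lets the induction on the
  order, with n general, pass from \<open>G n\<close> to \<open>G (Suc n)\<close>.\<close>

lemma smooth_compose:
  assumes G: "\<And>n s. (G n has_real_derivative G (Suc n) s) (at s)" and f: "smooth f"
  shows "smooth (\<lambda>x. G n (f x))"
proof (rule smooth_onI)
  fix k show "Ck_on k (\<lambda>x. G n (f x)) UNIV"
  proof (induction k arbitrary: n)
    case 0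
    have "continuous_on UNIV (G n)" by (intro DERIV_continuous_on) (use G has_field_derivative_at_within in blast)
    then show ?case using continuous_on_compose2[OF _ smooth_continuous_on[OF f]] by auto
  next
    case (Suc k)
    show ?case
    proof (rule Ck_on_SucI)
      fix x show "((\<lambda>x. G n (f x)) has_derivative (\<lambda>v. G (Suc n) (f x) * frechet_derivative f (at x) v)) (at x)"
        by (rule has_derivative_compose[OF smooth_has_derivative[OF f]])
          (use G in \<open>simp add: has_field_derivative_def\<close>)
    next
      fix i :: 'a assume "i \<in> Basis"
      then show "Ck_on k (\<lambda>x. G (Suc n) (f x) * pderivative f i x) UNIV"
        by (intro Ck_on_mult Suc.IH) (use smooth_pderivative[OF f] in \<open>auto simp: smooth_on_def\<close>)
    qed
  qed
qed

text \<open>The exponent plays the role of the tower index, since differentiation turns a into a -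
  1. \<open>smooth_compose\<close> asks for derivatives on the whole real line, but here only
  positive arguments are controlled.\<close>

lemma smooth_powr:
  assumes f: "smooth f" and pos: "\<And>x. f x > 0"
  shows "smooth (\<lambda>x. f x powr a)"
proof (rule smooth_onI)
  fix k show "Ck_on k (\<lambda>x. f x powr a) UNIV"
  proof (induction k arbitrary: a)
    case 0
    have "continuous_on UNIV (\<lambda>x. f x powr a)"
      by (rule continuous_on_powr[OF smooth_continuous_on[OF f] continuous_on_const])
        (use pos in \<open>auto simp: less_imp_neq[symmetric]\<close>)
    then show ?case by simp
  next
    case (Suc k)
    show ?case
    proof (rule Ck_on_SucI)
      fix x
      have "((\<lambda>s. s powr a) has_real_derivative a * f x powr (a - 1)) (at (f x))"
        using pos by (rule has_real_derivative_powr)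
      then show "((\<lambda>x. f x powr a) has_derivative (\<lambda>v. a * f x powr (a - 1) * frechet_derivative f (at x) v)) (at x)"
        by (intro has_derivative_compose[OF smooth_has_derivative[OF f]]) (simp add: has_field_derivative_def)
    next
      fix i :: 'a assume "i \<in> Basis"
      then show "Ck_on k (\<lambda>x. a * f x powr (a - 1) * pderivative f i x) UNIV"
        by (intro Ck_on_mult Ck_on_const Suc.IH) (use smooth_pderivative[OF f] in \<open>auto simp: smooth_on_def\<close>)
    qed
  qed
qed

lemma pderivative_compose:
  assumes "(G has_real_derivative G') (at (f x))" "f differentiable (at x)"
  shows "pderivative (\<lambda>x. G (f x)) i x = G' * pderivative f i x"
proof -
  have "((\<lambda>x. G (f x)) has_derivative (\<lambda>v. G' * frechet_derivative f (at x) v)) (at x)"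
    by (rule has_derivative_compose[of f "frechet_derivative f (at x)"])
      (use assms in \<open>simp_all add: has_field_derivative_def frechet_derivative_works\<close>)
  from fun_cong[OF frechet_derivative_at[OF this], of i] show ?thesis by simp
qed

lemma pderivative_mult:
  assumes "smooth f" "smooth g"
  shows "pderivative (\<lambda>x. f x * g x) i x = f x * pderivative g i x + pderivative f i x * g x"
  using fun_cong[OF frechet_derivative_at[OF has_derivative_mult[OF smooth_has_derivative[OF assms(1)]
        smooth_has_derivative[OF assms(2)], of x]], of i] by simp

subsection \<open>Bump functions\<close>

text \<open>Allowing a polynomial in \<open>1 / s\<close> makes the family closed under differentiation.\<close>

definition flat_exp :: "real poly \<Rightarrow> real \<Rightarrow> real" where
  "flat_exp p s = (if s > 0 then poly p (1 / s) * exp (- (1 / s)) else 0)"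

lemma poly_times_exp_minus_tendsto_0: "((\<lambda>t. poly p t * exp (- t)) \<longlongrightarrow> (0::real)) at_top"
proof -
  have "((\<lambda>t. \<Sum>i\<le>degree p. coeff p i * (t ^ i / exp t)) \<longlongrightarrow> (\<Sum>i\<le>degree p. coeff p i * 0)) at_top"
    by (intro tendsto_sum tendsto_mult tendsto_const tendsto_power_div_exp_0)
  then show ?thesis by (simp add: poly_altdef sum_distrib_right exp_minus divide_inverse mult.assoc)
qed

text \<open>With t = 1/s the operator d/ds is -t^2 d/dt, and the t-derivative of p(t) exp(-t) is (p'
  - p)(t) exp(-t). This gives the polynomial t^2 (p - p').\<close>

lemma flat_exp_has_derivative:
  "(flat_exp p has_real_derivative flat_exp ([:0, 0, 1:] * (p - pderiv p)) s) (at s)"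
proof -
  consider "s > 0" | "s < 0" | "s = 0" by linarith
  then show ?thesis
  proof cases
    case 1
    have "((\<lambda>s. poly p (1 / s) * exp (- (1 / s))) has_real_derivative
        flat_exp ([:0, 0, 1:] * (p - pderiv p)) s) (at s)"
      unfolding flat_exp_def using 1
      by (auto intro!: derivative_eq_intros DERIV_chain2[OF poly_DERIV]
          simp: power2_eq_square field_simps)
    then show ?thesis
      by (rule has_field_derivative_transform_within_open[of _ _ _ "{0<..}"])
        (use 1 in \<open>auto simp: flat_exp_def\<close>)
  next
    case 2
    have "((\<lambda>s. 0) has_real_derivative flat_exp ([:0, 0, 1:] * (p - pderiv p)) s) (at s)"
      using 2 by (simp add: flat_exp_def)
    then show ?thesis
      by (rule has_field_derivative_transform_within_open[of _ _ _ "{..<0}"])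
        (use 2 in \<open>auto simp: flat_exp_def\<close>)
  next
    case 3
    \<comment> \<open>At 0 the difference quotient is t p(t) exp(-t) with t = 1/s tending to
      infinity; the extra factor t is the polynomial \<open>[:0, 1:]\<close>.\<close>
    have "((\<lambda>s. poly ([:0, 1:] * p) (inverse s) * exp (- inverse s)) \<longlongrightarrow> 0) (at_right 0)"
      by (rule filterlim_compose[OF poly_times_exp_minus_tendsto_0 filterlim_inverse_at_top_right])
    then have R: "((\<lambda>s. flat_exp p s / s) \<longlongrightarrow> 0) (at_right 0)"
      by (rule Lim_transform_eventually)
        (auto simp: eventually_at_filter flat_exp_def divide_inverse mult_ac intro!: always_eventually)
    have L: "((\<lambda>s. flat_exp p s / s) \<longlongrightarrow> 0) (at_left 0)"
      by (rule Lim_transform_eventually[OF tendsto_const])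
        (auto simp: eventually_at_filter flat_exp_def intro!: always_eventually)
    show ?thesis
      using filterlim_split_at[OF L R] 3 by (simp add: has_field_derivative_iff flat_exp_def)
  qed
qed

lemma smooth_flat_exp: "smooth f \<Longrightarrow> smooth (\<lambda>x. flat_exp p (f x))"
  using smooth_compose[of "\<lambda>n. flat_exp (((\<lambda>p. [:0, 0, 1:] * (p - pderiv p)) ^^ n) p)" f 0]
    flat_exp_has_derivative by simp

text \<open>\<open>flat_exp 1\<close> is exp(-1/s) for s > 0. Since exp(-1/(n c)) tends to 1 for
  each c > 0, rescaling the argument alone makes the bumps tend to the indicator of the open box,
  while all of them vanish outside that box.\<close>

definition box_bump :: "'a::euclidean_space \<Rightarrow> 'a \<Rightarrow> nat \<Rightarrow> 'a \<Rightarrow> real" where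
  "box_bump a b n x = (\<Prod>i\<in>Basis. flat_exp 1 (real (Suc n) * (x \<bullet> i - a \<bullet> i)) *
      flat_exp 1 (real (Suc n) * (b \<bullet> i - x \<bullet> i)))"

lemma smooth_box_bump: "smooth (box_bump a b n)"
  unfolding box_bump_def
  by (intro smooth_prod smooth_mult smooth_flat_exp smooth_diff smooth_const smooth_inner finite_Basis)

lemma flat_exp_1_bounds: "0 \<le> flat_exp 1 s" "flat_exp 1 s \<le> 1"
  by (auto simp: flat_exp_def)

lemma box_bump_bounds: "0 \<le> box_bump a b n x" "box_bump a b n x \<le> 1"
  unfolding box_bump_def
  by (intro prod_nonneg ballI mult_nonneg_nonneg flat_exp_1_bounds)
    (intro prod_le_1 conjI mult_nonneg_nonneg mult_le_one flat_exp_1_bounds)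

lemma box_bump_outside: "x \<notin> box a b \<Longrightarrow> box_bump a b n x = 0"
proof -
  assume "x \<notin> box a b"
  then obtain i where i: "i \<in> Basis" "\<not> (a \<bullet> i < x \<bullet> i \<and> x \<bullet> i < b \<bullet> i)"
    by (auto simp: mem_box)
  then show ?thesis
    unfolding box_bump_def
    by (intro prod_zero[OF finite_Basis] bexI[of _ i]) (auto simp: flat_exp_def zero_less_mult_iff)
qed

lemma box_bump_tendsto: "(\<lambda>n. box_bump a b n x) \<longlonglongrightarrow> indicator (box a b) x"
proof (cases "x \<in> box a b")
  case True
  have F: "(\<lambda>n. flat_exp 1 (real (Suc n) * c)) \<longlonglongrightarrow> 1" if "c > 0" for c
  proof -
    have "(\<lambda>n. exp (- (inverse (real (Suc n)) * inverse c))) \<longlonglongrightarrow> exp (- (0 * inverse c))"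
      by (intro tendsto_intros LIMSEQ_inverse_real_of_nat)
    then show ?thesis using that by (simp add: flat_exp_def zero_less_mult_iff divide_inverse)
  qed
  have "(\<lambda>n. box_bump a b n x) \<longlonglongrightarrow> (\<Prod>i\<in>(Basis :: 'a set). 1 * 1)"
    unfolding box_bump_def
    by (intro tendsto_prod tendsto_mult F) (use True in \<open>auto simp: mem_box\<close>)
  then show ?thesis using True by simp
qed (simp add: box_bump_outside)

lemma test_function_box_bump:
  assumes "cbox a b \<subseteq> \<Omega>" shows "test_function \<Omega> (box_bump a b n)"
  unfolding test_function_def
proof (intro conjI smooth_box_bump exI[of _ "cbox a b"] allI impI)
  show "box_bump a b n x = 0" if "x \<notin> cbox a b" for x
    using that box_subset_cbox[of a b] by (intro box_bump_outside) auto
qed (use assms in auto)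

subsection \<open>The fundamental lemma of the calculus of variations\<close>

text \<open>The difference quotients of \<open>F\<close> have integral 0 by translation invariance.\<close>

lemma integral_pderivative_compact_support:
  fixes F :: "'a::euclidean_space \<Rightarrow> real"
  assumes F: "smooth F" and K: "compact K" "\<And>x. x \<notin> K \<Longrightarrow> F x = 0" and i: "i \<in> Basis"
  shows "(LINT x|lborel. pderivative F i x) = 0"
proof -
  define P where "P = pderivative F i"
  have contP: "continuous_on UNIV P" and contF: "continuous_on UNIV F"
    unfolding P_def using smooth_continuous_on smooth_pderivative F i by blast+
  have [measurable]: "F \<in> borel_measurable borel" "P \<in> borel_measurable borel"
    using contP contF by (auto intro: borel_measurable_continuous_onI)
  have P0: "P x = 0" if "x \<notin> K" for x
  proof -
    have "frechet_derivative F (at x) = frechet_derivative (\<lambda>_. 0) (at x)"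
      by (rule frechet_derivative_transform_within_open[of _ _ "- K"])
        (use that K F in \<open>auto simp: smooth_differentiable compact_imp_closed\<close>)
    then show ?thesis by (simp add: P_def)
  qed
  have "bounded (P ` K)"
    by (intro compact_imp_bounded compact_continuous_image continuous_on_subset[OF contP] K) auto
  then obtain L where L: "\<And>x. x \<in> K \<Longrightarrow> \<bar>P x\<bar> \<le> L" "L > 0"
    unfolding bounded_pos by auto
  have PL: "\<bar>P x\<bar> \<le> L" for x using L P0 by (cases "x \<in> K") auto
  have der: "((\<lambda>t. F (x + t *\<^sub>R i)) has_real_derivative P (x + t *\<^sub>R i)) (at t)" for x t
  proof -
    have "((\<lambda>t. F (x + t *\<^sub>R i)) has_derivative (\<lambda>s. frechet_derivative F (at (x + t *\<^sub>R i)) (s *\<^sub>R i))) (at t)"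
      by (rule has_derivative_compose[OF _ smooth_has_derivative[OF F]]) (auto intro!: derivative_eq_intros)
    moreover have "frechet_derivative F (at y) (s *\<^sub>R i) = P y * s" for y s
      using linear_scale[OF linear_frechet_derivative[OF smooth_differentiable[OF F, of y]], of s i]
      by (simp add: P_def mult.commute)
    ultimately show ?thesis by (simp add: has_field_derivative_def)
  qed
  define D where "D n x = (F (x + inverse (real (Suc n)) *\<^sub>R i) - F x) / inverse (real (Suc n))" for n x
  have DL: "\<bar>D n x\<bar> \<le> L" for n x
  proof -
    have "\<exists>z>0. z < inverse (real (Suc n)) \<and> F (x + inverse (real (Suc n)) *\<^sub>R i) - F (x + 0 *\<^sub>R i) =
        (inverse (real (Suc n)) - 0) * P (x + z *\<^sub>R i)"
      by (rule MVT2) (auto intro: der)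
    then obtain z where "F (x + inverse (real (Suc n)) *\<^sub>R i) - F x = inverse (real (Suc n)) * P (x + z *\<^sub>R i)"
      by auto
    then show ?thesis using PL by (simp add: D_def)
  qed
  have Dlim: "(\<lambda>n. D n x) \<longlonglongrightarrow> P x" for x
  proof -
    have "((\<lambda>h. (F (x + h *\<^sub>R i) - F x) / h) \<longlongrightarrow> P x) (at 0)"
      using DERIV_D[OF der[of x 0]] by simp
    moreover have "filterlim (\<lambda>n. inverse (real (Suc n))) (at 0) sequentially"
      unfolding filterlim_at using LIMSEQ_inverse_real_of_nat by (auto intro!: always_eventually)
    ultimately show ?thesis unfolding D_def by (rule filterlim_compose)
  qed
  obtain R where R: "\<And>x. x \<in> K \<Longrightarrow> norm x \<le> R"
    using compact_imp_bounded[OF K(1)] unfolding bounded_iff by blast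
  \<comment> \<open>The shifts have length at most 1, so the ball of radius R + 1 contains the
    supports of all difference quotients and its indicator can dominate them.\<close>
  have Dsupp: "D n x = 0" if "x \<notin> cball 0 (R + 1)" for n x
  proof -
    have "norm x > R + 1" using that by simp
    moreover have "norm (inverse (real (Suc n)) *\<^sub>R i) \<le> 1"
      using i by (simp add: field_simps)
    ultimately have "norm (x + inverse (real (Suc n)) *\<^sub>R i) > R" "norm x > R"
      using norm_diff_ineq[of x "inverse (real (Suc n)) *\<^sub>R i"] norm_ge_zero[of "inverse (real (Suc n)) *\<^sub>R i"] by linarith+
    then have "F (x + inverse (real (Suc n)) *\<^sub>R i) = 0" "F x = 0"
      using R K(2) by (meson not_less)+
    then show ?thesis by (simp add: D_def)
  qed
  have "(\<lambda>n. LINT x|lborel. D n x) \<longlonglongrightarrow> (LINT x|lborel. P x)"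
  proof (rule integral_dominated_convergence[where w = "\<lambda>x. L * indicator (cball 0 (R + 1)) x"])
    show "integrable lborel (\<lambda>x::'a. L * indicator (cball 0 (R + 1)) x)"
      by (intro integrable_mult_right integrable_real_indicator) (auto simp: emeasure_lborel_cball_finite[unfolded infinity_ennreal_def])
    show "AE x in lborel. norm (D n x) \<le> L * indicator (cball 0 (R + 1)) x" for n
      using DL Dsupp by (auto simp: indicator_def)
    show "D n \<in> borel_measurable lborel" for n
      unfolding D_def[abs_def] by simp
  qed (auto simp: Dlim)
  moreover have "(LINT x|lborel. D n x) = 0" for n
  proof -
    let ?c = "inverse (real (Suc n)) *\<^sub>R i"
    have "integrable lborel (\<lambda>x. indicator K x *\<^sub>R F x)"
      by (rule borel_integrable_compact[OF K(1)]) (rule continuous_on_subset[OF contF], simp)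
    moreover have "(\<lambda>x. indicator K x *\<^sub>R F x) = F" by (rule ext) (use K(2) in \<open>auto simp: indicator_def\<close>)
    ultimately have intF: "integrable lborel F" by simp
    have intF': "integrable lborel (\<lambda>x. F (?c + x))"
      using integrable_distr_eq[of "(+) ?c" lborel lborel F] intF lborel_distr_plus[of ?c]
      by (simp cong: distr_cong)
    have "(LINT x|lborel. F (?c + x)) = (LINT x|lborel. F x)"
      using integral_distr[of "(+) ?c" lborel lborel F] lborel_distr_plus[of ?c]
      by (simp cong: distr_cong)
    then have "(LINT x|lborel. (F (?c + x) - F x) / inverse (real (Suc n))) = 0"
      using intF intF' by (simp del: of_nat_Suc inverse_inverse_eq)
    then show ?thesis unfolding D_def by (simp only: add.commute[of _ ?c])
  qed
  ultimately show ?thesis using LIMSEQ_unique[OF _ tendsto_const] by (simp add: P_def) 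
qed

text \<open>Open boxes are stable under intersection and generate the Borel sets, so inside a fixed
  box the integral of \<open>g\<close> over every Borel set vanishes by Dynkin induction. The sets
  where \<open>g\<close> is positive or negative then show that \<open>g\<close> is 0 a.e. in that
  box, and countably many boxes cover \<Omega>.\<close>

lemma AE_lborel_eq_0_if_box_integrals:
  fixes g :: "'a::euclidean_space \<Rightarrow> real"
  assumes \<Omega>: "open \<Omega>" and g: "integrable lborel g"
    and box: "\<And>a b. cbox a b \<subseteq> \<Omega> \<Longrightarrow> (LINT x:box a b|lborel. g x) = 0"
  shows "AE x in lborel. x \<in> \<Omega> \<longrightarrow> g x = 0"
proof -
  have [measurable]: "g \<in> borel_measurable lborel" using g by simp
  have on_box: "AE x in lborel. x \<in> cbox c d \<longrightarrow> g x = 0" if cd: "cbox c d \<subseteq> \<Omega>" for c d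
  proof -
    have set_int: "set_integrable lborel A g" if "A \<in> sets borel" for A
      using integrable_mult_indicator[OF _ g, of A] that by (simp add: set_integrable_def)
    have null: "(LINT x:A \<inter> box c d|lborel. g x) = 0" if "A \<in> sets borel" for A
    proof -
      let ?G = "range (\<lambda>(a, b). box a b) :: 'a set set"
      have "Int_stable ?G"
      proof (rule Int_stableI)
        fix A B assume "A \<in> ?G" "B \<in> ?G"
        then obtain a b c d where "A = box a b" "B = box c d" by auto
        then have "A \<inter> B = (\<lambda>(a, b). box a b) (\<Sum>i\<in>Basis. max (a \<bullet> i) (c \<bullet> i) *\<^sub>R i,
            \<Sum>i\<in>Basis. min (b \<bullet> i) (d \<bullet> i) *\<^sub>R i)"
          by (simp add: box_Int_box)
        then show "A \<inter> B \<in> ?G" by (rule range_eqI)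
      qed
      moreover have "?G \<subseteq> Pow UNIV" "A \<in> sigma_sets UNIV ?G"
        using that by (auto simp: borel_eq_box)
      ultimately show ?thesis
      proof (induction rule: sigma_sets_induct_disjoint)
        case (basic A)
        then obtain a b where "A = box a b" by auto
        then obtain a' b' where ab: "A \<inter> box c d = box a' b'" by (auto simp: box_Int_box)
        show ?case
        \<comment> \<open>Only a nonempty open box has the closed box as its closure, and this is
          what places \<open>cbox a' b'\<close> inside \<open>cbox c d\<close> and thus inside
          \<Omega>.\<close>
        proof (cases "box a' b' = {}")
          case False
          then have "cbox a' b' = closure (box a' b')" by (simp add: closure_box)
          also have "\<dots> \<subseteq> cbox c d"
            using ab box_subset_cbox[of c d] by (intro closure_minimal) auto
          finally show ?thesis using ab box cd by auto
        qed (simp add: ab set_lebesgue_integral_def)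
      next
        case empty
        show ?case by (simp add: set_lebesgue_integral_def)
      next
        case (compl A)
        then have A: "A \<in> sets borel" by (auto simp: borel_eq_box)
        have "(LINT x:box c d|lborel. g x) =
            (LINT x:(A \<inter> box c d) \<union> ((UNIV - A) \<inter> box c d)|lborel. g x)"
          by (rule arg_cong[where f = "\<lambda>S. LINT x:S|lborel. g x"]) auto
        also have "\<dots> = (LINT x:A \<inter> box c d|lborel. g x) + (LINT x:(UNIV - A) \<inter> box c d|lborel. g x)"
          using A by (intro set_integral_Un set_int) auto
        finally show ?case using compl box[OF cd] by simp
      next
        case (union A)
        then have A: "A i \<in> sets borel" for i by (auto simp: borel_eq_box)
        have "(LINT x:(\<Union>i. A i \<inter> box c d)|lborel. g x) = (\<Sum>i. LINT x:A i \<inter> box c d|lborel. g x)"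
        proof (rule lebesgue_integral_countable_add)
          show "(A i \<inter> box c d) \<inter> (A j \<inter> box c d) = {}" if "i \<noteq> j" for i j
            using union(1) that by (auto simp: disjoint_family_on_def)
        qed (use A in \<open>auto intro!: set_int\<close>)
        moreover have "\<Union> (range A) \<inter> box c d = (\<Union>i. A i \<inter> box c d)" by auto
        ultimately show ?case by (simp only: union(3) suminf_zero)
      qed
    qed
    have pos: "AE x in lborel. x \<in> box c d \<longrightarrow> \<not> s * g x > 0" for s :: real
    proof -
      define A where "A = {x. s * g x > 0}"
      have A: "A \<in> sets borel" unfolding A_def by measurable
      define h where "h x = indicator (A \<inter> box c d) x *\<^sub>R (s * g x)" for x
      have "(LINT x|lborel. h x) = s * (LINT x:A \<inter> box c d|lborel. g x)"
        by (simp add: h_def set_lebesgue_integral_def mult.left_commute flip: integral_mult_right_zero)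
      then have "(LINT x|lborel. h x) = 0" using null[OF A] by simp
      moreover have "integrable lborel h"
        unfolding h_def using A g by (intro integrable_mult_indicator) auto
      moreover have "AE x in lborel. 0 \<le> h x" by (auto simp: h_def A_def indicator_def)
      ultimately have "AE x in lborel. h x = 0" using integral_nonneg_eq_0_iff_AE by blast
      then show ?thesis by eventually_elim (auto simp: h_def A_def indicator_def split: if_splits)
    qed
    \<comment> \<open>The integrals live on open boxes, but the countable cover of \<Omega> below
      consists of closed ones.\<close>
    have "cbox c d - box c d \<in> null_sets lborel"
    proof -
      have "negligible (cbox c d - box c d)" by (rule negligible_frontier_interval)
      then have "cbox c d - box c d \<in> null_sets lebesgue" by (simp add: negligible_iff_null_sets)
      then show ?thesis by (subst (asm) null_sets_completion_iff) auto
    qed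
    then have "AE x in lborel. x \<notin> cbox c d - box c d" by (rule AE_not_in)
    with pos[of 1] pos[of "-1"] show ?thesis
      by eventually_elim (auto simp: not_less)
  qed
  obtain \<D> where \<D>: "countable \<D>" "\<D> \<subseteq> Pow \<Omega>" "\<And>X. X \<in> \<D> \<Longrightarrow> \<exists>a b. X = cbox a b" "\<Union>\<D> = \<Omega>"
    using open_countable_Union_open_cbox[OF \<Omega>] by metis
  have "AE x in lborel. x \<in> X \<longrightarrow> g x = 0" if "X \<in> \<D>" for X
    using \<D>(2) \<D>(3)[OF that] that on_box by blast
  then have "AE x in lborel. \<forall>X\<in>\<D>. x \<in> X \<longrightarrow> g x = 0"
    by (subst AE_ball_countable[OF \<D>(1)]) blast
  then show ?thesis by eventually_elim (use \<D>(4) in auto)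
qed

lemma integral_lebesgue_on_vanishing:
  fixes g :: "'a::euclidean_space \<Rightarrow> real"
  assumes "\<Omega> \<in> sets lebesgue" "g \<in> borel_measurable borel" "\<And>x. x \<notin> \<Omega> \<Longrightarrow> g x = 0"
  shows "(LINT x|lebesgue_on \<Omega>. g x) = (LINT x|lborel. g x)"
proof -
  have "(LINT x|lebesgue_on \<Omega>. g x) = (LINT x|lebesgue. indicator \<Omega> x *\<^sub>R g x)"
    using assms(1) by (intro integral_restrict_space) simp
  also have "(\<lambda>x. indicator \<Omega> x *\<^sub>R g x) = g" by (rule ext) (use assms(3) in \<open>auto simp: indicator_def\<close>)
  also have "(LINT x|lebesgue. g x) = (LINT x|lborel. g x)"
    using assms(2) by (intro integral_completion) simp
  finally show ?thesis .
qed

section \<open>Integration by parts and the fundamental lemma on a bounded open set\<close>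

locale bounded_open_set =
  fixes \<Omega> :: "'a::euclidean_space set"
  assumes open_\<Omega>: "open \<Omega>" and bounded_\<Omega>: "bounded \<Omega>"
begin

abbreviation M :: "'a measure" where "M \<equiv> lebesgue_on \<Omega>"

lemma \<Omega>_lebesgue: "\<Omega> \<in> sets lebesgue"
  using open_\<Omega> by simp

lemma finite_measure_M: "finite_measure M"
  by (intro finite_measure_lebesgue_on lmeasurable_open bounded_\<Omega> open_\<Omega>)

lemma continuous_measurable: "continuous_on UNIV f \<Longrightarrow> f \<in> borel_measurable M"
  by (intro continuous_imp_measurable_on_sets_lebesgue \<Omega>_lebesgue) (rule continuous_on_subset, auto)

lemma continuous_Lsq:
  fixes f :: "'a \<Rightarrow> real"
  assumes "continuous_on UNIV f" shows "f \<in> Lsq M"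
proof -
  have "bounded (f ` closure \<Omega>)"
    by (intro compact_imp_bounded compact_continuous_image continuous_on_subset[OF assms])
      (use bounded_\<Omega> in \<open>auto simp: compact_closure\<close>)
  then obtain c where "\<And>x. x \<in> closure \<Omega> \<Longrightarrow> \<bar>f x\<bar> \<le> c" unfolding bounded_iff by auto
  then have "AE x in M. \<bar>f x\<bar> \<le> c"
    using closure_subset[of \<Omega>] by (intro AE_I2) auto
  then show ?thesis by (intro Lsq_bounded_finite finite_measure_M continuous_measurable assms)
qed

lemma smooth_Lsq: "smooth f \<Longrightarrow> f \<in> Lsq M"
  by (intro continuous_Lsq smooth_continuous_on)

lemma test_function_smooth: "test_function \<Omega> \<psi> \<Longrightarrow> smooth \<psi>"
  by (simp add: test_function_def)

text \<open>The product of \<open>f\<close> and \<psi> has compact support inside \<Omega>, so its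
  partial derivative has integral 0 over the whole space and vanishes off \<Omega>; the product rule
  splits it.\<close>

lemma integration_by_parts:
  assumes f: "smooth f" and \<psi>: "test_function \<Omega> \<psi>" and i: "i \<in> Basis"
  shows "Lsq_inner M f (pderivative \<psi> i) = - Lsq_inner M (pderivative f i) \<psi>"
proof -
  note s = test_function_smooth[OF \<psi>]
  obtain K where K: "compact K" "K \<subseteq> \<Omega>" "\<And>x. x \<notin> K \<Longrightarrow> \<psi> x = 0"
    using \<psi> unfolding test_function_def by auto
  have F: "smooth (\<lambda>x. f x * \<psi> x)" by (intro smooth_mult f s)
  have vanish: "pderivative (\<lambda>x. f x * \<psi> x) i x = 0" if "x \<notin> \<Omega>" for x
  proof -
    have "frechet_derivative (\<lambda>x. f x * \<psi> x) (at x) = frechet_derivative (\<lambda>_. 0) (at x)"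
      by (rule frechet_derivative_transform_within_open[of _ _ "- K"])
        (use that K F in \<open>auto simp: smooth_differentiable compact_imp_closed\<close>)
    then show ?thesis by simp
  qed
  have "0 = (LINT x|lborel. pderivative (\<lambda>x. f x * \<psi> x) i x)"
    by (rule integral_pderivative_compact_support[OF F K(1) _ i, symmetric]) (simp add: K(3))
  also have "\<dots> = (LINT x|M. pderivative (\<lambda>x. f x * \<psi> x) i x)"
    by (intro integral_lebesgue_on_vanishing[symmetric] \<Omega>_lebesgue vanish
        borel_measurable_continuous_onI smooth_continuous_on smooth_pderivative F i)
  also have "\<dots> = (LINT x|M. f x * pderivative \<psi> i x + pderivative f i x * \<psi> x)"
    by (simp add: pderivative_mult[OF f s])
  also have "\<dots> = Lsq_inner M f (pderivative \<psi> i) + Lsq_inner M (pderivative f i) \<psi>"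
    unfolding Lsq_inner_def
    by (intro Bochner_Integration.integral_add Lsq_integrable_mult smooth_Lsq smooth_pderivative f s i)
  finally show ?thesis by simp
qed

lemma smooth_has_weak_gradient:
  assumes "smooth f"
  shows "has_weak_gradient \<Omega> f (\<lambda>x. \<Sum>i\<in>Basis. pderivative f i x *\<^sub>R i)"
  unfolding has_weak_gradient_def
  using assms by (auto simp: inner_sum_left_Basis intro: integration_by_parts smooth_Lsq smooth_pderivative)

lemma smooth_H1: "smooth f \<Longrightarrow> f \<in> H1 \<Omega>"
  unfolding H1_def using smooth_has_weak_gradient smooth_Lsq by blast

text \<open>The bumps are test functions bounded by 1 that tend to indicators of boxes, so by
  dominated convergence the integral of \<open>f\<close> over every closed box in \<Omega> reduces
  to the vanishing pairings, up to the null boundary of the box.\<close>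

theorem fundamental_lemma:
  assumes f: "f \<in> Lsq M" and zero: "\<And>\<psi>. test_function \<Omega> \<psi> \<Longrightarrow> Lsq_inner M f \<psi> = 0"
  shows "AE x in M. f x = 0"
proof -
  have intf: "integrable M f" by (rule Lsq_integrable_finite[OF finite_measure_M f])
  define F where "F x = indicator \<Omega> x *\<^sub>R f x" for x
  have intF: "integrable lebesgue F"
    unfolding F_def using integrable_restrict_space[of \<Omega> lebesgue f] intf \<Omega>_lebesgue by simp
  then have "F \<in> borel_measurable lebesgue" by simp
  \<comment> \<open>The argument with generators of the Borel sets needs a Borel function, while the
    extension of \<open>f\<close> by 0 is only Lebesgue measurable.\<close>
  then obtain g where g: "g \<in> borel_measurable lborel" and Fg: "AE x in lborel. F x = g x"
    using completion_ex_borel_measurable_real by blast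
  have Fg': "AE x in lebesgue. F x = g x" using Fg by (rule AE_completion)
  have g': "g \<in> borel_measurable lebesgue" by (rule measurable_completion[OF g])
  have "integrable lebesgue g"
    using integrable_cong_AE[OF borel_measurable_integrable[OF intF] g' Fg'] intF by simp
  then have intg: "integrable lborel g" using integrable_completion[OF g] by simp
  have box: "(LINT x:box a b|lborel. g x) = 0" if ab: "cbox a b \<subseteq> \<Omega>" for a b
  proof -
    have bm: "(indicator (box a b) :: 'a \<Rightarrow> real) \<in> borel_measurable M"
      by (intro measurable_restrict_space1 measurable_completion) simp
    have "(\<lambda>n. Lsq_inner M f (box_bump a b n)) \<longlonglongrightarrow> (LINT x|M. f x * indicator (box a b) x)"
      unfolding Lsq_inner_def
    proof (rule integral_dominated_convergence[where w = "\<lambda>x. \<bar>f x\<bar>"])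
      show "AE x in M. (\<lambda>n. f x * box_bump a b n x) \<longlonglongrightarrow> f x * indicator (box a b) x"
        by (intro AE_I2 tendsto_mult tendsto_const box_bump_tendsto)
      show "AE x in M. norm (f x * box_bump a b n x) \<le> \<bar>f x\<bar>" for n
        using box_bump_bounds[of a b n] by (intro AE_I2) (auto simp: abs_mult intro: mult_left_le)
      show "(\<lambda>x. f x * box_bump a b n x) \<in> borel_measurable M" for n
        by (intro borel_measurable_times Lsq_measurable[OF f] continuous_measurable
            smooth_continuous_on smooth_box_bump)
    qed (use intf bm Lsq_measurable[OF f] in auto)
    then have 0: "(LINT x|M. f x * indicator (box a b) x) = 0"
      using zero[OF test_function_box_bump[OF ab]] LIMSEQ_unique[OF _ tendsto_const] by auto
    have "(LINT x|M. f x * indicator (box a b) x) =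
        (LINT x|lebesgue. indicator \<Omega> x *\<^sub>R (f x * indicator (box a b) x))"
      using \<Omega>_lebesgue by (intro integral_restrict_space) simp
    also have "\<dots> = (LINT x|lebesgue. indicator (box a b) x *\<^sub>R F x)"
      by (rule Bochner_Integration.integral_cong) (auto simp: F_def)
    also have "\<dots> = (LINT x|lebesgue. indicator (box a b) x *\<^sub>R g x)"
    proof (rule integral_cong_AE)
      show "AE x in lebesgue. indicator (box a b) x *\<^sub>R F x = indicator (box a b) x *\<^sub>R g x"
        using Fg' by eventually_elim simp
    qed (use g' borel_measurable_integrable[OF intF] in
        \<open>simp_all add: borel_measurable_times borel_measurable_indicator\<close>)
    also have "\<dots> = (LINT x:box a b|lborel. g x)"
      unfolding set_lebesgue_integral_def using g by (intro integral_completion) simp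
    finally show ?thesis using 0 by simp
  qed
  have "AE x in lborel. x \<in> \<Omega> \<longrightarrow> g x = 0"
    by (rule AE_lborel_eq_0_if_box_integrals[OF open_\<Omega> intg box])
  then have "AE x in lebesgue. x \<in> \<Omega> \<longrightarrow> g x = 0" by (rule AE_completion)
  with Fg' have "AE x in lebesgue. x \<in> \<Omega> \<longrightarrow> f x = 0"
    by eventually_elim (auto simp: F_def)
  then show ?thesis using \<Omega>_lebesgue by (subst AE_restrict_space_iff) simp_all
qed

end

subsection \<open>The space \<open>H\<^sup>1\<close>\<close>

lemma tendsto_0_squeeze:
  fixes f g :: "nat \<Rightarrow> real"
  assumes "\<And>n. 0 \<le> f n" "\<And>n. f n \<le> g n" "g \<longlonglongrightarrow> 0"
  shows "f \<longlonglongrightarrow> 0"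
  by (rule tendsto_sandwich[OF _ _ tendsto_const assms(3)]) (use assms in auto)

text \<open>The condition \<open>G 0 = 0\<close> turns the Lipschitz bound into |G s| \<le> C |s|,
  which keeps the compositions in L2 on any measure space.\<close>

lemma Lsq_lim_Lipschitz:
  assumes f: "Lsq_lim M f g" and G: "\<And>s t. \<bar>G s - G t\<bar> \<le> C * \<bar>s - t\<bar>" and G0: "G 0 = 0"
    and Gm: "G \<in> borel_measurable borel" and C: "0 \<le> C"
  shows "Lsq_lim M (\<lambda>n x. G (f n x)) (\<lambda>x. G (g x))"
proof -
  have fL: "f n \<in> Lsq M" "g \<in> Lsq M" for n using f by (auto simp: Lsq_lim_def)
  have GL: "(\<lambda>x. G (h x)) \<in> Lsq M" if h: "h \<in> Lsq M" for h
    using G[of _ 0] G0 by (intro Lsq_bound[OF h, where c = C] measurable_compose[OF Lsq_measurable[OF h] Gm] AE_I2) auto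
  have le: "Lsq_norm M (\<lambda>x. G (f n x) - G (g x)) \<le> C * Lsq_norm M (\<lambda>x. f n x - g x)" for n
    using G C by (intro Lsq_norm_mono Lsq_diff fL AE_I2 Lsq_measurable[OF Lsq_diff[OF GL[OF fL(1)] GL[OF fL(2)]]]) auto
  have "(\<lambda>n. C * Lsq_norm M (\<lambda>x. f n x - g x)) \<longlonglongrightarrow> 0"
    using f by (intro tendsto_mult_right_zero) (simp add: Lsq_lim_def)
  then have "(\<lambda>n. Lsq_norm M (\<lambda>x. G (f n x) - G (g x))) \<longlonglongrightarrow> 0"
    by (rule tendsto_0_squeeze[OF Lsq_norm_nonneg le])
  then show ?thesis using GL fL by (simp add: Lsq_lim_def)
qed

text \<open>Split a_n f_n - b g into a_n (f_n - g), which the uniform bound controls, and (a_n - b)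
  g, which tends to 0 by dominated convergence.\<close>

lemma Lsq_lim_bounded_mult:
  assumes f: "Lsq_lim M f g" and a: "\<And>n x. \<bar>a n x\<bar> \<le> C" "\<And>n. a n \<in> borel_measurable M" "b \<in> borel_measurable M"
    and lim: "AE x in M. (\<lambda>n. a n x) \<longlonglongrightarrow> b x"
  shows "Lsq_lim M (\<lambda>n x. a n x * f n x) (\<lambda>x. b x * g x)"
proof -
  have fL: "f n \<in> Lsq M" "g \<in> Lsq M" for n using f by (auto simp: Lsq_lim_def)
  have C: "0 \<le> C" using a(1) abs_ge_zero order_trans by blast
  have ag: "Lsq_lim M (\<lambda>n x. a n x * g x) (\<lambda>x. b x * g x)"
  proof (rule Lsq_dominated_lim[OF fL(2)])
    show "AE x in M. (\<lambda>n. a n x * g x) \<longlonglongrightarrow> b x * g x"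
      using lim by eventually_elim (intro tendsto_mult tendsto_const)
    show "AE x in M. \<bar>a n x * g x\<bar> \<le> C * \<bar>g x\<bar>" for n
      by (intro AE_I2) (simp add: abs_mult a(1) mult_right_mono)
  qed (intro borel_measurable_times a Lsq_measurable[OF fL(2)])+
  have af: "(\<lambda>x. a n x * f n x) \<in> Lsq M" for n
    by (intro Lsq_bounded_mult[where c = C] fL a AE_I2)
  have ag': "(\<lambda>x. a n x * g x) \<in> Lsq M" "(\<lambda>x. b x * g x) \<in> Lsq M" for n
    using ag by (auto simp: Lsq_lim_def)
  have le: "Lsq_norm M (\<lambda>x. a n x * f n x - b x * g x) \<le>
      C * Lsq_norm M (\<lambda>x. f n x - g x) + Lsq_norm M (\<lambda>x. a n x * g x - b x * g x)" for n
  proof -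
    have "Lsq_norm M (\<lambda>x. a n x * f n x - a n x * g x) \<le> C * Lsq_norm M (\<lambda>x. f n x - g x)"
    proof (intro Lsq_norm_mono Lsq_diff fL AE_I2 C Lsq_measurable[OF Lsq_diff[OF af ag'(1)]])
      fix x
      have "\<bar>a n x * f n x - a n x * g x\<bar> = \<bar>a n x\<bar> * \<bar>f n x - g x\<bar>"
        by (simp add: right_diff_distrib flip: abs_mult)
      then show "\<bar>a n x * f n x - a n x * g x\<bar> \<le> C * \<bar>f n x - g x\<bar>"
        by (simp add: a(1) mult_right_mono)
    qed
    then show ?thesis using Lsq_norm_triangle_diff[OF af ag'(1) ag'(2), of n n] by linarith
  qed
  have "(\<lambda>n. C * Lsq_norm M (\<lambda>x. f n x - g x) + Lsq_norm M (\<lambda>x. a n x * g x - b x * g x)) \<longlonglongrightarrow> 0"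
    using f ag by (intro tendsto_add_zero tendsto_mult_right_zero) (simp_all add: Lsq_lim_def)
  then have "(\<lambda>n. Lsq_norm M (\<lambda>x. a n x * f n x - b x * g x)) \<longlonglongrightarrow> 0"
    by (rule tendsto_0_squeeze[OF Lsq_norm_nonneg le])
  then show ?thesis using af ag' by (simp add: Lsq_lim_def)
qed

lemma Lsq_lim_cong_AE:
  assumes "Lsq_lim M f g" "\<And>n. AE x in M. f n x = f' n x" "AE x in M. g x = g' x"
    and m: "\<And>n. f' n \<in> borel_measurable M" "g' \<in> borel_measurable M"
  shows "Lsq_lim M f' g'"
proof -
  have fL: "f n \<in> Lsq M" "g \<in> Lsq M" for n using assms(1) by (auto simp: Lsq_lim_def)
  have f': "f' n \<in> Lsq M" for n
    by (rule Lsq_bound[OF fL(1)[of n] m(1), where c = 1]) (use assms(2)[of n] in \<open>auto elim!: eventually_mono\<close>)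
  have g': "g' \<in> Lsq M"
    by (rule Lsq_bound[OF fL(2) m(2), where c = 1]) (use assms(3) in \<open>auto elim!: eventually_mono\<close>)
  have "Lsq_norm M (\<lambda>x. f n x - g x) = Lsq_norm M (\<lambda>x. f' n x - g' x)" for n
  proof (rule Lsq_norm_cong_AE)
    show "AE x in M. f n x - g x = f' n x - g' x"
      using assms(2)[of n] assms(3) by eventually_elim simp
  qed (intro Lsq_measurable Lsq_diff fL f' g')+
  then show ?thesis using assms(1) f' g' by (simp add: Lsq_lim_def)
qed

section \<open>Weak gradients and the H1 norm\<close>

context bounded_open_set
begin

lemma has_weak_gradient_Lsq: "has_weak_gradient \<Omega> \<phi> g \<Longrightarrow> i \<in> Basis \<Longrightarrow> (\<lambda>x. g x \<bullet> i) \<in> Lsq M"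
  by (simp add: has_weak_gradient_def)

lemma H1_Lsq: "\<phi> \<in> H1 \<Omega> \<Longrightarrow> \<phi> \<in> Lsq M"
  by (simp add: H1_def)

lemma H1_has_weak_grad: "\<phi> \<in> H1 \<Omega> \<Longrightarrow> has_weak_gradient \<Omega> \<phi> (weak_grad \<Omega> \<phi>)"
proof -
  assume "\<phi> \<in> H1 \<Omega>"
  then have "\<exists>g. has_weak_gradient \<Omega> \<phi> g" by (simp add: H1_def)
  then show ?thesis unfolding weak_grad_def by (rule someI_ex)
qed

lemma H1I: "\<phi> \<in> Lsq M \<Longrightarrow> has_weak_gradient \<Omega> \<phi> g \<Longrightarrow> \<phi> \<in> H1 \<Omega>"
  by (auto simp: H1_def)

lemma weak_grad_Lsq: "\<phi> \<in> H1 \<Omega> \<Longrightarrow> i \<in> Basis \<Longrightarrow> (\<lambda>x. weak_grad \<Omega> \<phi> x \<bullet> i) \<in> Lsq M"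
  using H1_has_weak_grad has_weak_gradient_Lsq by blast

lemma test_function_pderivative_Lsq: "test_function \<Omega> \<psi> \<Longrightarrow> i \<in> Basis \<Longrightarrow> pderivative \<psi> i \<in> Lsq M"
  by (intro smooth_Lsq smooth_pderivative test_function_smooth)

text \<open>The fundamental lemma is applied to each component of the difference. Up to null sets
  \<open>weak_grad\<close> therefore does not depend on the choice in its definition, and any
  gradient found by computation may stand in for it.\<close>

lemma has_weak_gradient_unique:
  assumes g: "has_weak_gradient \<Omega> \<phi> g" and h: "has_weak_gradient \<Omega> \<phi> h"
  shows "AE x in M. g x = h x"
proof -
  have "AE x in M. g x \<bullet> i - h x \<bullet> i = 0" if i: "i \<in> Basis" for i
  proof (rule fundamental_lemma)
    note gh = has_weak_gradient_Lsq[OF g i] has_weak_gradient_Lsq[OF h i]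
    show "(\<lambda>x. g x \<bullet> i - h x \<bullet> i) \<in> Lsq M" by (intro Lsq_diff gh)
    fix \<psi> assume \<psi>: "test_function \<Omega> \<psi>"
    have "Lsq_inner M (\<lambda>x. g x \<bullet> i - h x \<bullet> i) \<psi> =
        Lsq_inner M (\<lambda>x. g x \<bullet> i) \<psi> - Lsq_inner M (\<lambda>x. h x \<bullet> i) \<psi>"
      by (intro Lsq_inner_diff_left gh smooth_Lsq test_function_smooth \<psi>)
    moreover have "Lsq_inner M \<phi> (pderivative \<psi> i) = - Lsq_inner M (\<lambda>x. g x \<bullet> i) \<psi>"
      "Lsq_inner M \<phi> (pderivative \<psi> i) = - Lsq_inner M (\<lambda>x. h x \<bullet> i) \<psi>"
      using g h \<psi> i unfolding has_weak_gradient_def by blast+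
    ultimately show "Lsq_inner M (\<lambda>x. g x \<bullet> i - h x \<bullet> i) \<psi> = 0" by simp
  qed
  then have "AE x in M. \<forall>i\<in>Basis. g x \<bullet> i - h x \<bullet> i = 0"
    by (intro AE_finite_allI finite_Basis)
  then show ?thesis by eventually_elim (simp add: euclidean_eq_iff[where 'a = 'a])
qed

lemma weak_grad_eq_AE: "\<phi> \<in> Lsq M \<Longrightarrow> has_weak_gradient \<Omega> \<phi> g \<Longrightarrow> AE x in M. weak_grad \<Omega> \<phi> x = g x"
  by (rule has_weak_gradient_unique[OF H1_has_weak_grad[OF H1I]])

lemma has_weak_gradient_lincomb:
  assumes L: "\<phi> \<in> Lsq M" "\<psi> \<in> Lsq M" and g: "has_weak_gradient \<Omega> \<phi> g" and h: "has_weak_gradient \<Omega> \<psi> h"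
  shows "has_weak_gradient \<Omega> (\<lambda>x. a * \<phi> x + b * \<psi> x) (\<lambda>x. a *\<^sub>R g x + b *\<^sub>R h x)"
  unfolding has_weak_gradient_def
proof (intro ballI conjI allI impI)
  fix i :: 'a assume i: "i \<in> Basis"
  note gh = has_weak_gradient_Lsq[OF g i] has_weak_gradient_Lsq[OF h i]
  have eq: "(\<lambda>x. (a *\<^sub>R g x + b *\<^sub>R h x) \<bullet> i) = (\<lambda>x. a * (g x \<bullet> i) + b * (h x \<bullet> i))"
    by (simp add: inner_add_left)
  show "(\<lambda>x. (a *\<^sub>R g x + b *\<^sub>R h x) \<bullet> i) \<in> Lsq M" unfolding eq by (intro Lsq_lincomb gh)
  fix \<eta> assume \<eta>: "test_function \<Omega> \<eta>"
  have "Lsq_inner M \<phi> (pderivative \<eta> i) = - Lsq_inner M (\<lambda>x. g x \<bullet> i) \<eta>"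
    "Lsq_inner M \<psi> (pderivative \<eta> i) = - Lsq_inner M (\<lambda>x. h x \<bullet> i) \<eta>"
    using g h \<eta> i unfolding has_weak_gradient_def by blast+
  then show "Lsq_inner M (\<lambda>x. a * \<phi> x + b * \<psi> x) (pderivative \<eta> i) =
      - Lsq_inner M (\<lambda>x. (a *\<^sub>R g x + b *\<^sub>R h x) \<bullet> i) \<eta>"
    unfolding eq
    by (simp add: Lsq_inner_lincomb_left L gh test_function_pderivative_Lsq[OF \<eta> i]
        smooth_Lsq[OF test_function_smooth[OF \<eta>]])
qed

lemma H1_lincomb: "\<phi> \<in> H1 \<Omega> \<Longrightarrow> \<psi> \<in> H1 \<Omega> \<Longrightarrow> (\<lambda>x. a * \<phi> x + b * \<psi> x) \<in> H1 \<Omega>"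
  by (rule H1I[OF Lsq_lincomb[OF H1_Lsq H1_Lsq]
        has_weak_gradient_lincomb[OF H1_Lsq H1_Lsq H1_has_weak_grad H1_has_weak_grad]])

lemma H1_diff: "\<phi> \<in> H1 \<Omega> \<Longrightarrow> \<psi> \<in> H1 \<Omega> \<Longrightarrow> (\<lambda>x. \<phi> x - \<psi> x) \<in> H1 \<Omega>"
  using H1_lincomb[of \<phi> \<psi> 1 "-1"] by simp

lemma has_weak_gradient_diff:
  assumes "\<phi> \<in> Lsq M" "\<psi> \<in> Lsq M" "has_weak_gradient \<Omega> \<phi> g" "has_weak_gradient \<Omega> \<psi> h"
  shows "has_weak_gradient \<Omega> (\<lambda>x. \<phi> x - \<psi> x) (\<lambda>x. g x - h x)"
  using has_weak_gradient_lincomb[OF assms, of 1 "-1"] by simp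

text \<open>For a fixed test function both sides of the defining identity are continuous in L2, so
  the weak gradient is a closed operator. Completeness, the chain rule and the negative part all
  rest on this.\<close>

lemma has_weak_gradient_lim:
  assumes g: "\<And>n. has_weak_gradient \<Omega> (f n) (g n)" and f: "Lsq_lim M f y"
    and h: "\<And>i. i \<in> Basis \<Longrightarrow> Lsq_lim M (\<lambda>n x. g n x \<bullet> i) (\<lambda>x. h x \<bullet> i)"
  shows "has_weak_gradient \<Omega> y h"
  unfolding has_weak_gradient_def
proof (intro ballI conjI allI impI)
  fix i :: 'a assume i: "i \<in> Basis"
  show "(\<lambda>x. h x \<bullet> i) \<in> Lsq M" using h[OF i] by (simp add: Lsq_lim_def)
  fix \<psi> assume \<psi>: "test_function \<Omega> \<psi>"
  have "(\<lambda>n. Lsq_inner M (f n) (pderivative \<psi> i)) \<longlonglongrightarrow> Lsq_inner M y (pderivative \<psi> i)"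
    by (intro Lsq_lim_inner f Lsq_lim_const test_function_pderivative_Lsq \<psi> i)
  moreover have "(\<lambda>n. - Lsq_inner M (\<lambda>x. g n x \<bullet> i) \<psi>) \<longlonglongrightarrow> - Lsq_inner M (\<lambda>x. h x \<bullet> i) \<psi>"
    by (intro tendsto_minus Lsq_lim_inner h Lsq_lim_const smooth_Lsq test_function_smooth \<psi> i)
  moreover have "Lsq_inner M (f n) (pderivative \<psi> i) = - Lsq_inner M (\<lambda>x. g n x \<bullet> i) \<psi>" for n
    using g \<psi> i unfolding has_weak_gradient_def by blast
  ultimately show "Lsq_inner M y (pderivative \<psi> i) = - Lsq_inner M (\<lambda>x. h x \<bullet> i) \<psi>"
    using LIMSEQ_unique by auto
qed

lemma integral_inner_Basis:
  fixes g h :: "'a \<Rightarrow> 'a"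
  assumes "\<And>i. i \<in> Basis \<Longrightarrow> (\<lambda>x. g x \<bullet> i) \<in> Lsq M" "\<And>i. i \<in> Basis \<Longrightarrow> (\<lambda>x. h x \<bullet> i) \<in> Lsq M"
  shows "(LINT x|M. g x \<bullet> h x) = (\<Sum>i\<in>Basis. Lsq_inner M (\<lambda>x. g x \<bullet> i) (\<lambda>x. h x \<bullet> i))"
  unfolding Lsq_inner_def
  by (subst Bochner_Integration.integral_sum[symmetric]) (auto intro: Lsq_integrable_mult assms simp flip: euclidean_inner)

lemma H1_norm_power2:
  assumes L: "\<phi> \<in> Lsq M" and g: "has_weak_gradient \<Omega> \<phi> g"
  shows "(H1_norm \<Omega> \<phi>)\<^sup>2 = (Lsq_norm M \<phi>)\<^sup>2 + (\<Sum>i\<in>Basis. (Lsq_norm M (\<lambda>x. g x \<bullet> i))\<^sup>2)"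
proof -
  have H: "\<phi> \<in> H1 \<Omega>" by (rule H1I[OF L g])
  have "(LINT x|M. weak_grad \<Omega> \<phi> x \<bullet> weak_grad \<Omega> \<phi> x) = (\<Sum>i\<in>Basis. (Lsq_norm M (\<lambda>x. weak_grad \<Omega> \<phi> x \<bullet> i))\<^sup>2)"
    by (simp add: integral_inner_Basis weak_grad_Lsq[OF H] Lsq_norm_power2)
  also have "\<dots> = (\<Sum>i\<in>Basis. (Lsq_norm M (\<lambda>x. g x \<bullet> i))\<^sup>2)"
  proof (rule sum.cong[OF refl])
    fix i :: 'a assume i: "i \<in> Basis"
    have "Lsq_norm M (\<lambda>x. weak_grad \<Omega> \<phi> x \<bullet> i) = Lsq_norm M (\<lambda>x. g x \<bullet> i)"
    proof (rule Lsq_norm_cong_AE)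
      show "AE x in M. weak_grad \<Omega> \<phi> x \<bullet> i = g x \<bullet> i"
        using weak_grad_eq_AE[OF L g] by eventually_elim simp
    qed (intro Lsq_measurable weak_grad_Lsq[OF H i] has_weak_gradient_Lsq[OF g i])+
    then show "(Lsq_norm M (\<lambda>x. weak_grad \<Omega> \<phi> x \<bullet> i))\<^sup>2 = (Lsq_norm M (\<lambda>x. g x \<bullet> i))\<^sup>2" by simp
  qed
  finally have "(LINT x|M. weak_grad \<Omega> \<phi> x \<bullet> weak_grad \<Omega> \<phi> x) = (\<Sum>i\<in>Basis. (Lsq_norm M (\<lambda>x. g x \<bullet> i))\<^sup>2)" .
  then show ?thesis
    unfolding H1_norm_def
    by (subst real_sqrt_pow2) (auto simp: Lsq_norm_power2 Lsq_inner_self_nonneg intro!: add_nonneg_nonneg sum_nonneg)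
qed

lemma H1_norm_nonneg: "\<phi> \<in> H1 \<Omega> \<Longrightarrow> 0 \<le> H1_norm \<Omega> \<phi>"
  unfolding H1_norm_def
  by (intro real_sqrt_ge_zero add_nonneg_nonneg Lsq_inner_self_nonneg Bochner_Integration.integral_nonneg inner_ge_zero)

lemma Lsq_norm_le_H1_norm:
  assumes "\<phi> \<in> Lsq M" "has_weak_gradient \<Omega> \<phi> g"
  shows "Lsq_norm M \<phi> \<le> H1_norm \<Omega> \<phi>" "i \<in> Basis \<Longrightarrow> Lsq_norm M (\<lambda>x. g x \<bullet> i) \<le> H1_norm \<Omega> \<phi>"
proof -
  have nn: "0 \<le> H1_norm \<Omega> \<phi>" by (rule H1_norm_nonneg[OF H1I[OF assms]])
  show "Lsq_norm M \<phi> \<le> H1_norm \<Omega> \<phi>"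
    by (rule power2_le_imp_le[OF _ nn]) (simp add: H1_norm_power2[OF assms] sum_nonneg)
  assume "i \<in> Basis"
  then have "(Lsq_norm M (\<lambda>x. g x \<bullet> i))\<^sup>2 \<le> (\<Sum>i\<in>Basis. (Lsq_norm M (\<lambda>x. g x \<bullet> i))\<^sup>2)"
    by (intro member_le_sum) auto
  then show "Lsq_norm M (\<lambda>x. g x \<bullet> i) \<le> H1_norm \<Omega> \<phi>"
    by (intro power2_le_imp_le[OF _ nn]) (simp add: H1_norm_power2[OF assms] add_increasing)
qed

section \<open>Convergence and completeness in H1\<close>

definition H1_lim :: "(nat \<Rightarrow> 'a \<Rightarrow> real) \<Rightarrow> ('a \<Rightarrow> real) \<Rightarrow> bool" where
  "H1_lim f y \<longleftrightarrow> (\<forall>n. f n \<in> H1 \<Omega>) \<and> y \<in> H1 \<Omega> \<and> (\<lambda>n. H1_norm \<Omega> (\<lambda>x. f n x - y x)) \<longlonglongrightarrow> 0"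

text \<open>Nothing is assumed about weak differentiability of the limit: it follows from closedness
  of the weak gradient.\<close>

lemma H1_limI:
  assumes g: "\<And>n. has_weak_gradient \<Omega> (f n) (g n)" and f: "Lsq_lim M f y"
    and h: "\<And>i. i \<in> Basis \<Longrightarrow> Lsq_lim M (\<lambda>n x. g n x \<bullet> i) (\<lambda>x. h x \<bullet> i)"
  shows "H1_lim f y"
proof -
  have wh: "has_weak_gradient \<Omega> y h" by (rule has_weak_gradient_lim[OF g f h])
  have fL: "f n \<in> Lsq M" "y \<in> Lsq M" for n using f by (auto simp: Lsq_lim_def)
  have eq: "(H1_norm \<Omega> (\<lambda>x. f n x - y x))\<^sup>2 = (Lsq_norm M (\<lambda>x. f n x - y x))\<^sup>2 +
      (\<Sum>i\<in>Basis. (Lsq_norm M (\<lambda>x. g n x \<bullet> i - h x \<bullet> i))\<^sup>2)" for n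
    using H1_norm_power2[OF Lsq_diff[OF fL] has_weak_gradient_diff[OF fL g wh], of n]
    by (simp add: inner_diff_left)
  have "(\<lambda>n. (Lsq_norm M (\<lambda>x. f n x - y x))\<^sup>2 +
      (\<Sum>i\<in>Basis. (Lsq_norm M (\<lambda>x. g n x \<bullet> i - h x \<bullet> i))\<^sup>2)) \<longlonglongrightarrow> 0\<^sup>2 + (\<Sum>i\<in>(Basis :: 'a set). 0\<^sup>2)"
    using f h by (intro tendsto_intros) (auto simp: Lsq_lim_def)
  then have "(\<lambda>n. (H1_norm \<Omega> (\<lambda>x. f n x - y x))\<^sup>2) \<longlonglongrightarrow> 0" by (simp add: eq)
  then have "(\<lambda>n. sqrt ((H1_norm \<Omega> (\<lambda>x. f n x - y x))\<^sup>2)) \<longlonglongrightarrow> sqrt 0" by (rule tendsto_real_sqrt)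
  moreover have "f n \<in> H1 \<Omega>" "y \<in> H1 \<Omega>" for n by (rule H1I[OF fL(1) g], rule H1I[OF fL(2) wh])
  ultimately show ?thesis by (simp add: H1_lim_def H1_norm_nonneg H1_diff)
qed

lemma H1_limD:
  assumes "H1_lim f y"
  shows "Lsq_lim M f y"
    and "i \<in> Basis \<Longrightarrow> Lsq_lim M (\<lambda>n x. weak_grad \<Omega> (f n) x \<bullet> i) (\<lambda>x. weak_grad \<Omega> y x \<bullet> i)"
proof -
  have H: "f n \<in> H1 \<Omega>" "y \<in> H1 \<Omega>" for n using assms by (auto simp: H1_lim_def)
  note d = has_weak_gradient_diff[OF H1_Lsq H1_Lsq H1_has_weak_grad H1_has_weak_grad, OF H(1) H(2) H(1) H(2)]
  have lim: "(\<lambda>n. H1_norm \<Omega> (\<lambda>x. f n x - y x)) \<longlonglongrightarrow> 0" using assms by (simp add: H1_lim_def)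
  have "Lsq_norm M (\<lambda>x. f n x - y x) \<le> H1_norm \<Omega> (\<lambda>x. f n x - y x)" for n
    by (rule Lsq_norm_le_H1_norm(1)[OF H1_Lsq[OF H1_diff[OF H]] d])
  then have "(\<lambda>n. Lsq_norm M (\<lambda>x. f n x - y x)) \<longlonglongrightarrow> 0"
    by (rule tendsto_0_squeeze[OF Lsq_norm_nonneg _ lim])
  then show "Lsq_lim M f y" using H by (simp add: Lsq_lim_def H1_Lsq)
  assume i: "i \<in> Basis"
  have "Lsq_norm M (\<lambda>x. weak_grad \<Omega> (f n) x \<bullet> i - weak_grad \<Omega> y x \<bullet> i) \<le> H1_norm \<Omega> (\<lambda>x. f n x - y x)" for n
    using Lsq_norm_le_H1_norm(2)[OF H1_Lsq[OF H1_diff[OF H]] d i] by (simp add: inner_diff_left)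
  then have "(\<lambda>n. Lsq_norm M (\<lambda>x. weak_grad \<Omega> (f n) x \<bullet> i - weak_grad \<Omega> y x \<bullet> i)) \<longlonglongrightarrow> 0"
    by (rule tendsto_0_squeeze[OF Lsq_norm_nonneg _ lim])
  then show "Lsq_lim M (\<lambda>n x. weak_grad \<Omega> (f n) x \<bullet> i) (\<lambda>x. weak_grad \<Omega> y x \<bullet> i)"
    using H i by (simp add: Lsq_lim_def weak_grad_Lsq)
qed

text \<open>The functions and each component of their gradients are Cauchy in L2 separately;
  closedness makes the limit of the gradients the gradient of the limit.\<close>

theorem H1_complete:
  assumes f: "\<And>n. f n \<in> H1 \<Omega>"
    and C: "\<And>e. e > 0 \<Longrightarrow> \<exists>N. \<forall>m\<ge>N. \<forall>n\<ge>N. H1_norm \<Omega> (\<lambda>x. f m x - f n x) < e"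
  obtains y where "H1_lim f y"
proof -
  note d = has_weak_gradient_diff[OF H1_Lsq H1_Lsq H1_has_weak_grad H1_has_weak_grad, OF f f f f]
  note le = Lsq_norm_le_H1_norm[OF H1_Lsq[OF H1_diff[OF f f]] d]
  have "\<exists>N. \<forall>m\<ge>N. \<forall>n\<ge>N. Lsq_norm M (\<lambda>x. f m x - f n x) < e" if "e > 0" for e
    using C[OF that] le_less_trans[OF le(1)] by fast
  then obtain y where y: "Lsq_lim M f y" using Lsq_complete[of f M] f H1_Lsq by blast
  have "\<exists>h. Lsq_lim M (\<lambda>n x. weak_grad \<Omega> (f n) x \<bullet> i) h" if i: "i \<in> Basis" for i
  proof -
    have "\<exists>N. \<forall>m\<ge>N. \<forall>n\<ge>N. Lsq_norm M (\<lambda>x. weak_grad \<Omega> (f m) x \<bullet> i - weak_grad \<Omega> (f n) x \<bullet> i) < e"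
      if "e > 0" for e
      using C[OF that] le_less_trans[OF le(2)[OF i, unfolded inner_diff_left]] by fast
    then obtain h where "Lsq_lim M (\<lambda>n x. weak_grad \<Omega> (f n) x \<bullet> i) h"
      by (rule Lsq_complete[OF weak_grad_Lsq[OF f i]])
    then show ?thesis by blast
  qed
  then obtain h where h: "\<And>i. i \<in> Basis \<Longrightarrow> Lsq_lim M (\<lambda>n x. weak_grad \<Omega> (f n) x \<bullet> i) (h i)"
    using bchoice[of Basis "\<lambda>i h. Lsq_lim M (\<lambda>n x. weak_grad \<Omega> (f n) x \<bullet> i) h"] by blast
  have "H1_lim f y"
    by (rule H1_limI[where g = "\<lambda>n. weak_grad \<Omega> (f n)" and h = "\<lambda>x. \<Sum>i\<in>Basis. h i x *\<^sub>R i"])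
      (use h y f in \<open>simp_all add: H1_has_weak_grad inner_sum_left_Basis\<close>)
  then show ?thesis by (rule that)
qed

end

subsection \<open>Negative parts and traces\<close>

text \<open>With \<open>R = sqrt (s\<^sup>2 + e\<^sup>2)\<close> this is \<open>(R - s) (1 - e / R) / 2\<close>. The factor \<open>1 - e / R\<close> makes both the
  value and the derivative vanish at 0, so that the derivatives converge to \<open>-1\<close> for \<open>s < 0\<close> and
  to 0 elsewhere, including \<open>s = 0\<close>.\<close>

definition neg_reg :: "real \<Rightarrow> real \<Rightarrow> real" where
  "neg_reg e s = (sqrt (s\<^sup>2 + e\<^sup>2) - s - e + e * (s / sqrt (s\<^sup>2 + e\<^sup>2))) / 2"

text \<open>With R the square root, the cubic term comes from the last summand of
  \<open>neg_reg\<close>: e times the derivative of s / R is e^3 / R^3. At s = 0 it equals 1 and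
  cancels the -1.\<close>

definition neg_reg_deriv :: "real \<Rightarrow> real \<Rightarrow> real" where
  "neg_reg_deriv e s = (s / sqrt (s\<^sup>2 + e\<^sup>2) - 1 + (e / sqrt (s\<^sup>2 + e\<^sup>2)) ^ 3) / 2"

lemma sqrt_sum_pos: "e > 0 \<Longrightarrow> sqrt (s\<^sup>2 + e\<^sup>2) > (0::real)"
  by (simp add: add_nonneg_pos)

lemma neg_reg_has_derivative:
  assumes e: "e > 0"
  shows "(neg_reg e has_real_derivative neg_reg_deriv e s) (at s)"
proof -
  define R where "R = (\<lambda>s::real. sqrt (s\<^sup>2 + e\<^sup>2))"
  have pos: "R s > 0" for s using sqrt_sum_pos[OF e] by (simp add: R_def)
  have R2: "R s * R s = s * s + e * e" for s
    by (simp add: R_def flip: power2_eq_square)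
  have dR: "(R has_real_derivative s / R s) (at s)"
  proof -
    have "s\<^sup>2 + e\<^sup>2 > 0" using e by (simp add: add_nonneg_pos)
    then have "((\<lambda>s. sqrt (s\<^sup>2 + e\<^sup>2)) has_real_derivative inverse (sqrt (s\<^sup>2 + e\<^sup>2)) / 2 * (2 * s)) (at s)"
      by (intro DERIV_chain2[OF DERIV_real_sqrt]) (auto intro!: derivative_eq_intros)
    moreover have "inverse (sqrt (s\<^sup>2 + e\<^sup>2)) / 2 * (2 * s) = s / R s" by (simp add: R_def field_simps)
    ultimately show ?thesis by (simp add: R_def)
  qed
  have "((\<lambda>s. (R s - s - e + e * (s / R s)) / 2) has_real_derivative
      (s / R s - 1 - 0 + e * ((1 * R s - s * (s / R s)) / (R s * R s))) / 2) (at s)"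
    using pos[of s] by (intro DERIV_cdivide DERIV_add DERIV_diff dR DERIV_ident DERIV_const DERIV_cmult DERIV_divide) simp
  moreover have "e * ((1 * R s - s * (s / R s)) / (R s * R s)) = (e / R s) ^ 3"
  proof -
    have "1 * R s - s * (s / R s) = (R s * R s - s * s) / R s" using pos[of s] by (simp add: field_simps)
    also have "\<dots> = e * e / R s" by (simp add: R2)
    finally show ?thesis by (simp add: power3_eq_cube)
  qed
  moreover have "neg_reg e = (\<lambda>s. (R s - s - e + e * (s / R s)) / 2)"
    by (auto simp: neg_reg_def R_def)
  ultimately show ?thesis by (simp add: neg_reg_deriv_def R_def)
qed

text \<open>Each of the three terms before halving has absolute value at most 1. What counts is that
  the bound depends neither on e nor on s, so that it survives the limit e to 0.\<close>

lemma neg_reg_deriv_bound: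
  assumes e: "e > 0" shows "\<bar>neg_reg_deriv e s\<bar> \<le> 3 / 2"
proof -
  define R where "R = sqrt (s\<^sup>2 + e\<^sup>2)"
  have pos: "R > 0" using sqrt_sum_pos[OF e] by (simp add: R_def)
  have "\<bar>s\<bar> \<le> R" "e \<le> R" unfolding R_def by (auto intro: real_le_rsqrt)
  then have *: "\<bar>s / R\<bar> \<le> 1" "0 \<le> e / R" "e / R \<le> 1" using pos e by auto
  have "\<bar>(a - 1 + b) / 2\<bar> \<le> 3 / 2" if "\<bar>a\<bar> \<le> 1" "0 \<le> b" "b \<le> 1" for a b :: real
    using that by (simp add: abs_le_iff)
  from this[OF *(1) zero_le_power[OF *(2)] power_le_one[OF *(2,3)]]
  show ?thesis unfolding neg_reg_deriv_def R_def[symmetric] .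
qed

lemma neg_reg_deriv_continuous:
  assumes e: "e > 0" shows "continuous_on UNIV (neg_reg_deriv e)"
  unfolding neg_reg_deriv_def[abs_def]
  using sqrt_sum_pos[OF e] by (intro continuous_intros) (auto simp: less_imp_neq[symmetric])

lemma neg_reg_0: "e > 0 \<Longrightarrow> neg_reg e 0 = 0"
  by (simp add: neg_reg_def)

lemma smooth_neg_reg:
  assumes e: "e > 0" and f: "smooth f"
  shows "smooth (\<lambda>x. neg_reg e (f x))"
proof -
  \<comment> \<open>The roots are rewritten as the powers 1/2 and -1/2 of a smooth function that is
    bounded below by e^2, which is the form \<open>smooth_powr\<close> handles.\<close>
  define q where "q = (\<lambda>x. f x * f x + e\<^sup>2)"
  have q: "smooth q" unfolding q_def by (intro smooth_add smooth_mult smooth_const f)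
  have pos: "q x > 0" for x using e by (simp add: q_def add_nonneg_pos)
  have "smooth (\<lambda>x. (q x powr (1/2) - f x - e + e * (f x * q x powr (-1/2))) * (1/2))"
    by (intro smooth_mult smooth_add smooth_diff smooth_const smooth_powr q pos f)
  moreover have "(\<lambda>x. neg_reg e (f x)) = (\<lambda>x. (q x powr (1/2) - f x - e + e * (f x * q x powr (-1/2))) * (1/2))"
  proof
    fix x
    have "q x powr (1/2) = sqrt (q x)" using pos[of x] by (simp add: powr_half_sqrt)
    moreover have "q x powr (-1/2) = 1 / sqrt (q x)"
      using pos[of x] by (simp add: powr_minus_divide powr_half_sqrt)
    ultimately show "neg_reg e (f x) = (q x powr (1/2) - f x - e + e * (f x * q x powr (-1/2))) * (1/2)"
      by (simp add: neg_reg_def q_def power2_eq_square)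
  qed
  ultimately show ?thesis by simp
qed

lemma neg_reg_tendsto:
  "(\<lambda>n. neg_reg (inverse (real (Suc n))) s) \<longlonglongrightarrow> max (- s) 0" (is ?A)
  "(\<lambda>n. neg_reg_deriv (inverse (real (Suc n))) s) \<longlonglongrightarrow> (if s < 0 then - 1 else 0)" (is ?B)
proof -
  have "?A \<and> ?B"
  \<comment> \<open>At s = 0 the root equals the regularisation parameter and both expressions are 0
    for every n. Otherwise the root tends to |s| > 0, and the limit may be taken in the
    quotients.\<close>
  proof (cases "s = 0")
    case True
    then show ?thesis by (simp add: neg_reg_def neg_reg_deriv_def del: of_nat_Suc)
  next
    case False
    define E where "E n = inverse (real (Suc n))" for n
    have E: "E \<longlonglongrightarrow> 0" unfolding E_def by (rule LIMSEQ_inverse_real_of_nat)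
    have "(\<lambda>n. sqrt (s\<^sup>2 + (E n)\<^sup>2)) \<longlonglongrightarrow> sqrt (s\<^sup>2 + 0\<^sup>2)" by (intro tendsto_intros E)
    then have R: "(\<lambda>n. sqrt (s\<^sup>2 + (E n)\<^sup>2)) \<longlonglongrightarrow> \<bar>s\<bar>" by simp
    have "(\<lambda>n. neg_reg (E n) s) \<longlonglongrightarrow> (\<bar>s\<bar> - s - 0 + 0 * (s / \<bar>s\<bar>)) / 2"
      unfolding neg_reg_def by (intro tendsto_intros R E) (use False in auto)
    moreover have "(\<bar>s\<bar> - s - 0 + 0 * (s / \<bar>s\<bar>)) / 2 = max (- s) 0" by (auto simp: max_def abs_if)
    moreover have "(\<lambda>n. neg_reg_deriv (E n) s) \<longlonglongrightarrow> (s / \<bar>s\<bar> - 1 + (0 / \<bar>s\<bar>) ^ 3) / 2"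
      unfolding neg_reg_deriv_def by (intro tendsto_intros R E) (use False in auto)
    moreover have "(s / \<bar>s\<bar> - 1 + (0 / \<bar>s\<bar>) ^ 3) / 2 = (if s < 0 then - 1 else 0)"
      using False by (auto simp: abs_if)
    ultimately show ?thesis by (simp add: E_def)
  qed
  then show ?A ?B by auto
qed

section \<open>Traces of smooth functions of y and of its negative part\<close>

locale trace_domain = bounded_open_set \<Omega> for \<Omega> :: "'a::euclidean_space set" +
  fixes \<gamma> :: "('a \<Rightarrow> real) \<Rightarrow> 'a \<Rightarrow> real"
  assumes trace: "is_trace_operator \<Omega> \<gamma>"
begin

abbreviation S :: "'a measure" where "S \<equiv> surface_on (frontier \<Omega>)"

lemma trace_Lsq: "\<phi> \<in> H1 \<Omega> \<Longrightarrow> \<gamma> \<phi> \<in> Lsq S"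
  using trace by (simp add: is_trace_operator_def)

lemma trace_smooth: "smooth \<phi> \<Longrightarrow> AE x in S. \<gamma> \<phi> x = \<phi> x"
  using trace by (simp add: is_trace_operator_def)

lemma trace_lincomb:
  assumes "\<phi> \<in> H1 \<Omega>" "\<psi> \<in> H1 \<Omega>"
  shows "AE x in S. \<gamma> (\<lambda>z. a * \<phi> z + b * \<psi> z) x = a * \<gamma> \<phi> x + b * \<gamma> \<psi> x"
proof -
  have H: "(\<lambda>z. a * \<phi> z) \<in> H1 \<Omega>" "(\<lambda>z. b * \<psi> z) \<in> H1 \<Omega>"
    using H1_lincomb[OF assms(1,1), of a 0] H1_lincomb[OF assms(2,2), of b 0] by auto
  have "AE x in S. \<gamma> (\<lambda>z. a * \<phi> z + b * \<psi> z) x = \<gamma> (\<lambda>z. a * \<phi> z) x + \<gamma> (\<lambda>z. b * \<psi> z) x"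
    using trace H by (simp add: is_trace_operator_def)
  moreover have "AE x in S. \<gamma> (\<lambda>z. a * \<phi> z) x = a * \<gamma> \<phi> x" "AE x in S. \<gamma> (\<lambda>z. b * \<psi> z) x = b * \<gamma> \<psi> x"
    using trace assms by (simp_all add: is_trace_operator_def)
  ultimately show ?thesis by eventually_elim simp
qed

lemma trace_bounded: obtains C where "0 \<le> C" "\<And>\<phi>. \<phi> \<in> H1 \<Omega> \<Longrightarrow> Lsq_norm S (\<gamma> \<phi>) \<le> C * H1_norm \<Omega> \<phi>"
proof -
  obtain C where C: "\<And>\<phi>. \<phi> \<in> H1 \<Omega> \<Longrightarrow> Lsq_norm S (\<gamma> \<phi>) \<le> C * H1_norm \<Omega> \<phi>"
    using trace unfolding is_trace_operator_def by blast
  have "Lsq_norm S (\<gamma> \<phi>) \<le> \<bar>C\<bar> * H1_norm \<Omega> \<phi>" if "\<phi> \<in> H1 \<Omega>" for \<phi>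
    using C[OF that] mult_right_mono[OF abs_ge_self[of C] H1_norm_nonneg[OF that]] by linarith
  then show ?thesis by (rule that[OF abs_ge_zero])
qed

lemma trace_lim:
  assumes "H1_lim f y" shows "Lsq_lim S (\<lambda>n. \<gamma> (f n)) (\<gamma> y)"
proof -
  have H: "f n \<in> H1 \<Omega>" "y \<in> H1 \<Omega>" for n using assms by (auto simp: H1_lim_def)
  obtain C where C: "0 \<le> C" "\<And>\<phi>. \<phi> \<in> H1 \<Omega> \<Longrightarrow> Lsq_norm S (\<gamma> \<phi>) \<le> C * H1_norm \<Omega> \<phi>"
    using trace_bounded by blast
  have "Lsq_norm S (\<lambda>x. \<gamma> (f n) x - \<gamma> y x) \<le> C * H1_norm \<Omega> (\<lambda>x. f n x - y x)" for n
  proof -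
    have "Lsq_norm S (\<lambda>x. \<gamma> (f n) x - \<gamma> y x) = Lsq_norm S (\<gamma> (\<lambda>x. f n x - y x))"
    proof (rule Lsq_norm_cong_AE)
      show "AE x in S. \<gamma> (f n) x - \<gamma> y x = \<gamma> (\<lambda>x. f n x - y x) x"
        using trace_lincomb[OF H, of 1 n "-1"] by (auto elim!: eventually_mono)
    qed (intro Lsq_measurable Lsq_diff trace_Lsq H1_diff H)+
    then show ?thesis using C(2)[OF H1_diff[OF H]] by simp
  qed
  moreover have "(\<lambda>n. C * H1_norm \<Omega> (\<lambda>x. f n x - y x)) \<longlonglongrightarrow> 0"
    using assms by (intro tendsto_mult_right_zero) (simp add: H1_lim_def)
  ultimately have "(\<lambda>n. Lsq_norm S (\<lambda>x. \<gamma> (f n) x - \<gamma> y x)) \<longlonglongrightarrow> 0"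
    by (rule tendsto_0_squeeze[OF Lsq_norm_nonneg])
  then show ?thesis using H by (simp add: Lsq_lim_def trace_Lsq)
qed

lemma continuous_measurable_S: "continuous_on UNIV f \<Longrightarrow> f \<in> borel_measurable S"
  unfolding surface_on_def
  by (intro measurable_restrict_space1) (simp add: borel_measurable_continuous_onI cong: measurable_cong_sets)

lemma smooth_approximation:
  assumes "y \<in> H1 \<Omega>"
  obtains f where "\<And>n. smooth (f n)" "H1_lim f y" "Lsq_lim S f (\<gamma> y)"
proof -
  obtain f :: "nat \<Rightarrow> 'a \<Rightarrow> real" where f: "\<And>n. smooth (f n)"
    "(\<lambda>n. H1_norm \<Omega> (\<lambda>x. f n x - y x)) \<longlonglongrightarrow> 0" "(\<lambda>n. Lsq_norm S (\<lambda>x. f n x - \<gamma> y x)) \<longlonglongrightarrow> 0"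
    using trace assms unfolding is_trace_operator_def by blast
  have "f n \<in> Lsq S" for n
    by (rule Lsq_bound[OF trace_Lsq[OF smooth_H1[OF f(1)[of n]]], where c = 1])
      (use trace_smooth[OF f(1)[of n]] in \<open>auto intro!: continuous_measurable_S smooth_continuous_on f(1) elim!: eventually_mono\<close>)
  with f assms have "H1_lim f y" "Lsq_lim S f (\<gamma> y)"
    by (auto simp: H1_lim_def Lsq_lim_def smooth_H1 trace_Lsq)
  with f(1) show ?thesis by (rule that)
qed

text \<open>For smooth approximants this is the classical chain rule together with integration by
  parts. Along a subsequence converging a.e., continuity and boundedness of \<open>G'\<close> make
  the gradients converge in L2. On the boundary the approximants and their images under
  \<open>G\<close> are their own traces a.e., so the trace identity follows from uniqueness of L2
  limits.\<close>

lemma H1_chain_rule: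
  assumes y: "y \<in> H1 \<Omega>"
    and d: "\<And>s. (G has_real_derivative G' s) (at s)" and bd: "\<And>s. \<bar>G' s\<bar> \<le> C"
    and cont: "continuous_on UNIV G'" and G0: "G 0 = 0"
    and sm: "\<And>f. smooth f \<Longrightarrow> smooth (\<lambda>x::'a. G (f x))"
  shows "has_weak_gradient \<Omega> (\<lambda>x. G (y x)) (\<lambda>x. G' (y x) *\<^sub>R weak_grad \<Omega> y x)"
    and "(\<lambda>x. G (y x)) \<in> H1 \<Omega>"
    and "AE x in S. \<gamma> (\<lambda>x. G (y x)) x = G (\<gamma> y x)"
proof -
  have C: "0 \<le> C" using bd abs_ge_zero order_trans by blast
  have Lip: "\<bar>G s - G t\<bar> \<le> C * \<bar>s - t\<bar>" for s t
    using field_differentiable_bound[of UNIV G G' C s t] d bd by simp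
  have "continuous_on UNIV G" by (intro DERIV_continuous_on) (use d in blast)
  then have Gm: "G \<in> borel_measurable borel" by (rule borel_measurable_continuous_onI)
  have G'm: "G' \<in> borel_measurable borel" using cont by (rule borel_measurable_continuous_onI)
  obtain f0 where f0: "\<And>n. smooth (f0 n)" "H1_lim f0 y" "Lsq_lim S f0 (\<gamma> y)"
    using smooth_approximation[OF y] by blast
  \<comment> \<open>Convergence in H1 says nothing about \<open>G' (f n x)\<close> at single points;
    the subsequence supplies it a.e.\<close>
  obtain r where r: "\<And>k::nat. r k \<ge> k" "AE x in M. (\<lambda>k. f0 (r k) x) \<longlonglongrightarrow> y x"
    using Lsq_lim_AE_subseq[OF H1_limD(1)[OF f0(2)]] by blast
  define f where "f k = f0 (r k)" for k
  have f: "smooth (f k)" "f k \<in> H1 \<Omega>" for k using f0(1) by (auto simp: f_def smooth_H1)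
  have fS: "Lsq_lim S f (\<gamma> y)" and fM: "Lsq_lim M f y"
    using Lsq_lim_subseq[OF f0(3) r(1)] Lsq_lim_subseq[OF H1_limD(1)[OF f0(2)] r(1)]
    by (simp_all add: f_def[abs_def])
  have fg: "Lsq_lim M (\<lambda>n x. weak_grad \<Omega> (f n) x \<bullet> i) (\<lambda>x. weak_grad \<Omega> y x \<bullet> i)" if "i \<in> Basis" for i
    unfolding f_def using Lsq_lim_subseq[OF H1_limD(2)[OF f0(2) that] r(1)] by simp
  have gr: "has_weak_gradient \<Omega> (\<lambda>x. G (f n x)) (\<lambda>x. G' (f n x) *\<^sub>R weak_grad \<Omega> (f n) x)" for n
    unfolding has_weak_gradient_def
  proof (intro ballI conjI allI impI)
    fix i :: 'a assume i: "i \<in> Basis"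
    have eq: "pderivative (\<lambda>x. G (f n x)) i x = G' (f n x) * pderivative (f n) i x" for x
      by (intro pderivative_compose d smooth_differentiable f)
    have ae: "AE x in M. pderivative (\<lambda>x. G (f n x)) i x = (G' (f n x) *\<^sub>R weak_grad \<Omega> (f n) x) \<bullet> i"
      using weak_grad_eq_AE[OF smooth_Lsq[OF f(1)] smooth_has_weak_gradient[OF f(1)], of n]
      by eventually_elim (simp add: eq inner_sum_left_Basis i)
    show L: "(\<lambda>x. (G' (f n x) *\<^sub>R weak_grad \<Omega> (f n) x) \<bullet> i) \<in> Lsq M"
      unfolding inner_scaleR_left
      by (intro Lsq_bounded_mult[where c = C] weak_grad_Lsq f i AE_I2 bd
          measurable_compose[OF Lsq_measurable[OF H1_Lsq[OF f(2)]] G'm])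
    fix \<psi> assume \<psi>: "test_function \<Omega> \<psi>"
    have "Lsq_inner M (pderivative (\<lambda>x. G (f n x)) i) \<psi> = Lsq_inner M (\<lambda>x. (G' (f n x) *\<^sub>R weak_grad \<Omega> (f n) x) \<bullet> i) \<psi>"
      by (intro Lsq_inner_cong_AE ae Lsq_measurable L smooth_Lsq smooth_pderivative sm f i
          test_function_smooth[OF \<psi>]) simp
    then show "Lsq_inner M (\<lambda>x. G (f n x)) (pderivative \<psi> i) =
        - Lsq_inner M (\<lambda>x. (G' (f n x) *\<^sub>R weak_grad \<Omega> (f n) x) \<bullet> i) \<psi>"
      using integration_by_parts[OF sm[OF f(1)] \<psi> i] by simp
  qed
  have Gf: "Lsq_lim M (\<lambda>n x. G (f n x)) (\<lambda>x. G (y x))"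
    by (rule Lsq_lim_Lipschitz[OF fM Lip G0 Gm C])
  have Gg: "Lsq_lim M (\<lambda>n x. (G' (f n x) *\<^sub>R weak_grad \<Omega> (f n) x) \<bullet> i)
      (\<lambda>x. (G' (y x) *\<^sub>R weak_grad \<Omega> y x) \<bullet> i)" if i: "i \<in> Basis" for i
    unfolding inner_scaleR_left
  proof (rule Lsq_lim_bounded_mult[OF fg[OF i]])
    show "AE x in M. (\<lambda>n. G' (f n x)) \<longlonglongrightarrow> G' (y x)"
      using r(2)
    proof eventually_elim
      case (elim x)
      then show ?case unfolding f_def
        using continuous_on_tendsto_compose[OF cont] by (simp add: always_eventually)
    qed
    show "\<bar>G' (f n x)\<bar> \<le> C" for n x by (rule bd)
    show "(\<lambda>x. G' (f n x)) \<in> borel_measurable M" for n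
      by (rule measurable_compose[OF Lsq_measurable[OF H1_Lsq[OF f(2)]] G'm])
    show "(\<lambda>x. G' (y x)) \<in> borel_measurable M"
      by (rule measurable_compose[OF Lsq_measurable[OF H1_Lsq[OF y]] G'm])
  qed
  show wg: "has_weak_gradient \<Omega> (\<lambda>x. G (y x)) (\<lambda>x. G' (y x) *\<^sub>R weak_grad \<Omega> y x)"
    by (rule has_weak_gradient_lim[OF gr Gf Gg])
  have lim: "H1_lim (\<lambda>n x. G (f n x)) (\<lambda>x. G (y x))" by (rule H1_limI[OF gr Gf Gg])
  then show H: "(\<lambda>x. G (y x)) \<in> H1 \<Omega>" by (simp add: H1_lim_def)
  have "Lsq_lim S (\<lambda>n x. G (f n x)) (\<gamma> (\<lambda>x. G (y x)))"
  proof (rule Lsq_lim_cong_AE[OF trace_lim[OF lim]])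
    show "AE x in S. \<gamma> (\<lambda>x. G (f n x)) x = G (f n x)" for n by (rule trace_smooth[OF sm[OF f(1)]])
  qed (intro continuous_measurable_S smooth_continuous_on sm f Lsq_measurable[OF trace_Lsq[OF H]] AE_I2 refl)+
  moreover have "Lsq_lim S (\<lambda>n x. G (f n x)) (\<lambda>x. G (\<gamma> y x))"
    by (rule Lsq_lim_Lipschitz[OF fS Lip G0 Gm C])
  ultimately show "AE x in S. \<gamma> (\<lambda>x. G (y x)) x = G (\<gamma> y x)" by (rule Lsq_lim_unique)
qed

text \<open>Only the regularisation parameter moves here, so the factors
  \<open>neg_reg_deriv (E n) (y x)\<close> converge at every point, those with y x = 0 included,
  under a uniform bound. The traces are handled by collecting the countably many a.e. identities
  before passing to the limit.\<close>

theorem H1_negative_part: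
  assumes y: "y \<in> H1 \<Omega>"
  shows "has_weak_gradient \<Omega> (\<lambda>x. max (- y x) 0) (\<lambda>x. (if y x < 0 then - 1 else 0) *\<^sub>R weak_grad \<Omega> y x)"
    and "(\<lambda>x. max (- y x) 0) \<in> H1 \<Omega>"
    and "AE x in S. \<gamma> (\<lambda>x. max (- y x) 0) x = max (- \<gamma> y x) 0"
proof -
  define E where "E n = inverse (real (Suc n))" for n
  have E: "E n > 0" for n by (simp add: E_def)
  note chain = H1_chain_rule[OF y neg_reg_has_derivative[OF E] neg_reg_deriv_bound[OF E]
      neg_reg_deriv_continuous[OF E] neg_reg_0[OF E] smooth_neg_reg[OF E]]
  have ym: "y \<in> borel_measurable M" by (rule Lsq_measurable[OF H1_Lsq[OF y]])
  have Gm: "neg_reg (E n) \<in> borel_measurable borel" "neg_reg_deriv (E n) \<in> borel_measurable borel" for n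
    unfolding neg_reg_def[abs_def] neg_reg_deriv_def[abs_def] by measurable
  have bd: "\<bar>neg_reg (E n) s\<bar> \<le> 3 / 2 * \<bar>s\<bar>" for n s
    using field_differentiable_bound[of UNIV "neg_reg (E n)" "neg_reg_deriv (E n)" "3/2" 0 s]
      neg_reg_has_derivative[OF E] neg_reg_deriv_bound[OF E] neg_reg_0[OF E] by simp
  have L: "Lsq_lim M (\<lambda>n x. neg_reg (E n) (y x)) (\<lambda>x. max (- y x) 0)"
    by (rule Lsq_dominated_lim[OF H1_Lsq[OF y], where c = "3/2"])
      (use bd ym Gm neg_reg_tendsto(1) in \<open>auto simp: E_def intro: measurable_compose\<close>)
  have Lg: "Lsq_lim M (\<lambda>n x. (neg_reg_deriv (E n) (y x) *\<^sub>R weak_grad \<Omega> y x) \<bullet> i)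
      (\<lambda>x. ((if y x < 0 then - 1 else 0) *\<^sub>R weak_grad \<Omega> y x) \<bullet> i)" if i: "i \<in> Basis" for i
    unfolding inner_scaleR_left
  proof (rule Lsq_lim_bounded_mult[OF Lsq_lim_const[OF weak_grad_Lsq[OF y i]] neg_reg_deriv_bound[OF E]])
    show "(\<lambda>x. neg_reg_deriv (E n) (y x)) \<in> borel_measurable M" for n
      by (rule measurable_compose[OF ym Gm(2)])
    show "(\<lambda>x. if y x < 0 then - 1 else 0 :: real) \<in> borel_measurable M" using ym by measurable
    show "AE x in M. (\<lambda>n. neg_reg_deriv (E n) (y x)) \<longlonglongrightarrow> (if y x < 0 then - 1 else 0)"
      unfolding E_def by (intro AE_I2 neg_reg_tendsto)
  qed
  show "has_weak_gradient \<Omega> (\<lambda>x. max (- y x) 0) (\<lambda>x. (if y x < 0 then - 1 else 0) *\<^sub>R weak_grad \<Omega> y x)"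
    by (rule has_weak_gradient_lim[OF chain(1) L Lg])
  have lim: "H1_lim (\<lambda>n x. neg_reg (E n) (y x)) (\<lambda>x. max (- y x) 0)"
    by (rule H1_limI[OF chain(1) L Lg])
  then show "(\<lambda>x. max (- y x) 0) \<in> H1 \<Omega>" by (simp add: H1_lim_def)
  have \<gamma>m: "\<gamma> y \<in> borel_measurable S" by (rule Lsq_measurable[OF trace_Lsq[OF y]])
  have "AE x in S. \<forall>n. \<gamma> (\<lambda>x. neg_reg (E n) (y x)) x = neg_reg (E n) (\<gamma> y x)"
    using chain(3) by (simp add: AE_all_countable)
  then have "AE x in S. (\<lambda>n. \<gamma> (\<lambda>x. neg_reg (E n) (y x)) x) \<longlonglongrightarrow> max (- \<gamma> y x) 0"
    by eventually_elim (simp add: E_def neg_reg_tendsto(1) del: of_nat_Suc)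
  then show "AE x in S. \<gamma> (\<lambda>x. max (- y x) 0) x = max (- \<gamma> y x) 0"
    by (rule Lsq_lim_AE_unique[OF trace_lim[OF lim]]) (use \<gamma>m in measurable)
qed

end

subsection \<open>Minimisation of convex functionals\<close>

text \<open>Dividing by t and letting t tend to 0 leaves the first-order condition at a
  minimum.\<close>

lemma nonneg_if_quadratic_nonneg:
  fixes b c :: real
  assumes "\<And>t. 0 < t \<Longrightarrow> t \<le> 1 \<Longrightarrow> 0 \<le> t * b + t\<^sup>2 / 2 * c"
  shows "0 \<le> b"
proof -
  have "0 \<le> b + inverse (real (Suc n)) * (c / 2)" for n
  proof -
    define t where "t = inverse (real (Suc n))"
    have t: "0 < t" "t \<le> 1" by (auto simp: t_def field_simps)
    have "0 \<le> t * (b + t * (c / 2))"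
      using assms[OF t] by (simp add: power2_eq_square algebra_simps)
    then show ?thesis unfolding t_def[symmetric] using t by (simp add: zero_le_mult_iff)
  qed
  moreover have "(\<lambda>n. b + inverse (real (Suc n)) * (c / 2)) \<longlonglongrightarrow> b + 0 * (c / 2)"
    by (intro tendsto_intros LIMSEQ_inverse_real_of_nat)
  ultimately show ?thesis using LIMSEQ_le_const[of _ b 0] by fastforce
qed

text \<open>The minimising sequence need not converge in \<open>V\<close>; the last conclusion is the variational inequality
  satisfied by any limit for which the two terms converge.\<close>

lemma convex_minimising_sequence:
  fixes V :: "('a \<Rightarrow> real) set" and a :: "('a \<Rightarrow> real) \<Rightarrow> ('a \<Rightarrow> real) \<Rightarrow> real"
  assumes ne: "V \<noteq> {}"
    and V: "\<And>f g s t. f \<in> V \<Longrightarrow> g \<in> V \<Longrightarrow> (\<lambda>x. s * f x + t * g x) \<in> V"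
    and bil: "\<And>f g h s t. f \<in> V \<Longrightarrow> g \<in> V \<Longrightarrow> h \<in> V \<Longrightarrow> a (\<lambda>x. s * f x + t * g x) h = s * a f h + t * a g h"
    and sym: "\<And>f g. f \<in> V \<Longrightarrow> g \<in> V \<Longrightarrow> a f g = a g f"
    and conv: "\<And>f g t. f \<in> V \<Longrightarrow> g \<in> V \<Longrightarrow> 0 \<le> t \<Longrightarrow> t \<le> 1 \<Longrightarrow>
      P (\<lambda>x. (1 - t) * f x + t * g x) \<le> (1 - t) * P f + t * P g"
    and lower: "\<And>f. f \<in> V \<Longrightarrow> m0 \<le> a f f / 2 + P f"
  obtains y where "\<And>n::nat. y n \<in> V"
    and "\<And>e. e > 0 \<Longrightarrow> \<exists>N. \<forall>m\<ge>N. \<forall>n\<ge>N. a (\<lambda>x. y m x - y n x) (\<lambda>x. y m x - y n x) < e"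
    and "\<And>\<phi> \<beta>. \<phi> \<in> V \<Longrightarrow> (\<lambda>n. a (y n) \<phi> + P (\<lambda>x. y n x + \<phi> x) - P (y n)) \<longlonglongrightarrow> \<beta> \<Longrightarrow> 0 \<le> \<beta>"
proof -
  define J where "J f = a f f / 2 + P f" for f
  define m where "m = (INF f\<in>V. J f)"
  have bdd: "bdd_below (J ` V)" using lower by (intro bdd_belowI2[of _ m0]) (simp add: J_def)
  have mJ: "m \<le> J f" if "f \<in> V" for f unfolding m_def using bdd that by (rule cINF_lower)
  have quad: "a (\<lambda>x. s * f x + t * g x) (\<lambda>x. s * f x + t * g x) = s\<^sup>2 * a f f + 2 * s * t * a f g + t\<^sup>2 * a g g"
    if "f \<in> V" "g \<in> V" for f g s t
  proof -
    have "a h (\<lambda>x. s * f x + t * g x) = s * a f h + t * a g h" if "h \<in> V" for h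
      using sym[OF \<open>h \<in> V\<close> V] bil \<open>f \<in> V\<close> \<open>g \<in> V\<close> \<open>h \<in> V\<close> by simp
    then show ?thesis
      using bil[OF that V[OF that], of s t s t] sym[OF that] that
      by (simp add: power2_eq_square algebra_simps)
  qed
  have "\<exists>f. f \<in> V \<and> J f < m + inverse (real (Suc n))" for n
    using cINF_less_iff[OF ne bdd, of "m + inverse (real (Suc n))"] by (auto simp: m_def simp del: of_nat_Suc)
  then obtain y where y: "\<And>n. y n \<in> V" "\<And>n. J (y n) < m + inverse (real (Suc n))" by metis
  define \<delta> where "\<delta> n = J (y n) - m" for n
  have \<delta>0: "0 \<le> \<delta> n" for n using mJ[OF y(1)] by (simp add: \<delta>_def)
  have \<delta>: "\<delta> \<longlonglongrightarrow> 0"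
    by (rule tendsto_0_squeeze[OF \<delta>0 _ LIMSEQ_inverse_real_of_nat]) (use y(2) in \<open>simp add: \<delta>_def less_imp_le algebra_simps\<close>)
  \<comment> \<open>By the parallelogram identity the left-hand side is 2 a(y_k, y_k) + 2 a(y_n,
    y_n) - 4 a(w, w) with the midpoint w. In terms of J this is 4 J(y_k) + 4 J(y_n) - 8 J(w) plus
    terms in P that are nonpositive by convexity, and J(w) is at least m.\<close>
  have near: "a (\<lambda>x. y k x - y n x) (\<lambda>x. y k x - y n x) \<le> 4 * \<delta> k + 4 * \<delta> n" for k n
  proof -
    define w where "w = (\<lambda>x. (1/2) * y k x + (1/2) * y n x)"
    have "m \<le> J w" unfolding w_def by (intro mJ V y)
    moreover have "P w \<le> P (y k) / 2 + P (y n) / 2"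
      using conv[OF y(1) y(1), of "1/2" k n] by (simp add: w_def)
    moreover have "a (\<lambda>x. y k x - y n x) (\<lambda>x. y k x - y n x) = a (y k) (y k) - 2 * a (y k) (y n) + a (y n) (y n)"
      using quad[OF y(1) y(1), of 1 k "-1" n] by simp
    moreover have "a w w = a (y k) (y k) / 4 + a (y k) (y n) / 2 + a (y n) (y n) / 4"
      using quad[OF y(1) y(1), of "1/2" k "1/2" n] by (simp add: w_def power2_eq_square)
    ultimately show ?thesis unfolding J_def \<delta>_def right_diff_distrib distrib_left by linarith
  qed
  have cauchy: "\<exists>N. \<forall>k\<ge>N. \<forall>n\<ge>N. a (\<lambda>x. y k x - y n x) (\<lambda>x. y k x - y n x) < e" if "e > 0" for e
  proof -
    have "\<forall>\<^sub>F n in sequentially. \<delta> n < e / 8" using order_tendstoD(2)[OF \<delta>, of "e/8"] that by simp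
    then obtain N where N: "\<And>n. n \<ge> N \<Longrightarrow> \<delta> n < e / 8" by (auto simp: eventually_sequentially)
    have "a (\<lambda>x. y k x - y n x) (\<lambda>x. y k x - y n x) < e" if "k \<ge> N" "n \<ge> N" for k n
      using near[of k n] N[OF that(1)] N[OF that(2)] by linarith
    then show ?thesis by blast
  qed
  have var: "0 \<le> \<beta>" if \<phi>: "\<phi> \<in> V"
    and lim: "(\<lambda>n. a (y n) \<phi> + P (\<lambda>x. y n x + \<phi> x) - P (y n)) \<longlonglongrightarrow> \<beta>" for \<phi> \<beta>
  proof (rule nonneg_if_quadratic_nonneg)
    fix t :: real assume t: "0 < t" "t \<le> 1"
    let ?b = "\<lambda>n. a (y n) \<phi> + P (\<lambda>x. y n x + \<phi> x) - P (y n)"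
    \<comment> \<open>\<open>y n\<close> is compared with the point at parameter t on the segment
      towards \<open>y n + \<phi>\<close>. Since \<open>y n\<close> is minimal only up to
      \<open>\<delta> n\<close>, that defect appears; it vanishes as n grows with t fixed, and t
      tends to 0 afterwards.\<close>
    have "- \<delta> n \<le> t * ?b n + t\<^sup>2 / 2 * a \<phi> \<phi>" for n
    proof -
      have y\<phi>: "(\<lambda>x. y n x + \<phi> x) \<in> V" using V[OF y(1) \<phi>, of 1 n 1] by simp
      have eq: "(\<lambda>x. (1 - t) * y n x + t * (y n x + \<phi> x)) = (\<lambda>x. 1 * y n x + t * \<phi> x)"
        by (auto simp: algebra_simps)
      have "P (\<lambda>x. 1 * y n x + t * \<phi> x) \<le> (1 - t) * P (y n) + t * P (\<lambda>x. y n x + \<phi> x)"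
        using conv[OF y(1) y\<phi>, of t n] t unfolding eq by simp
      moreover have "m \<le> J (\<lambda>x. 1 * y n x + t * \<phi> x)" by (intro mJ V y \<phi>)
      moreover have "a (\<lambda>x. 1 * y n x + t * \<phi> x) (\<lambda>x. 1 * y n x + t * \<phi> x) =
          a (y n) (y n) + 2 * t * a (y n) \<phi> + t\<^sup>2 * a \<phi> \<phi>"
        using quad[OF y(1) \<phi>, of 1 n t] by simp
      ultimately show ?thesis unfolding J_def \<delta>_def by (simp add: algebra_simps add_divide_distrib)
    qed
    moreover have "(\<lambda>n. t * ?b n + t\<^sup>2 / 2 * a \<phi> \<phi>) \<longlonglongrightarrow> t * \<beta> + t\<^sup>2 / 2 * a \<phi> \<phi>"
      by (intro tendsto_intros lim)
    moreover have "(\<lambda>n. - \<delta> n) \<longlonglongrightarrow> 0" using tendsto_minus[OF \<delta>] by simp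
    ultimately show "0 \<le> t * \<beta> + t\<^sup>2 / 2 * a \<phi> \<phi>"
      by (intro LIMSEQ_le[of "\<lambda>n. - \<delta> n" 0]) auto
  qed
  show ?thesis by (rule that[OF y(1) cauchy var])
qed

text \<open>The representer arises by minimising ||f||^2 / 2 - L f, the case P = - L of the previous
  result. As V need not be closed, \<xi> may lie outside V; the sequence in V tending to it belongs
  to the conclusion because \<open>V_dense\<close> is read off from it.\<close>

lemma Lsq_Riesz:
  assumes VL: "V \<subseteq> Lsq M" and ne: "V \<noteq> {}"
    and V: "\<And>f g s t. f \<in> V \<Longrightarrow> g \<in> V \<Longrightarrow> (\<lambda>x. s * f x + t * g x) \<in> V"
    and lin: "\<And>f g s t. f \<in> V \<Longrightarrow> g \<in> V \<Longrightarrow> L (\<lambda>x. s * f x + t * g x) = s * L f + t * L g"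
    and bd: "\<And>f. f \<in> V \<Longrightarrow> \<bar>L f\<bar> \<le> K * Lsq_norm M f"
  obtains f \<xi> where "\<And>n::nat. f n \<in> V" "Lsq_lim M f \<xi>" "\<And>\<phi>. \<phi> \<in> V \<Longrightarrow> L \<phi> = Lsq_inner M \<xi> \<phi>"
proof -
  \<comment> \<open>The constant is the minimum of r^2 / 2 - K r over all real r.\<close>
  have low: "- (K\<^sup>2 / 2) \<le> Lsq_inner M f f / 2 + - L f" if "f \<in> V" for f
  proof -
    have "0 \<le> (Lsq_norm M f - K)\<^sup>2" by simp
    then have "2 * (K * Lsq_norm M f) \<le> (Lsq_norm M f)\<^sup>2 + K\<^sup>2" by (simp add: power2_diff algebra_simps)
    then show ?thesis using bd[OF that] by (simp add: Lsq_norm_power2)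
  qed
  obtain f where f: "\<And>n::nat. f n \<in> V"
    and C: "\<And>e. e > 0 \<Longrightarrow> \<exists>N. \<forall>m\<ge>N. \<forall>n\<ge>N. Lsq_inner M (\<lambda>x. f m x - f n x) (\<lambda>x. f m x - f n x) < e"
    and var: "\<And>\<phi> \<beta>. \<phi> \<in> V \<Longrightarrow> (\<lambda>n. Lsq_inner M (f n) \<phi> + - L (\<lambda>x. f n x + \<phi> x) - - L (f n)) \<longlonglongrightarrow> \<beta> \<Longrightarrow> 0 \<le> \<beta>"
  proof (rule convex_minimising_sequence[of V "Lsq_inner M" "\<lambda>f. - L f" "- (K\<^sup>2 / 2)"])
    show "V \<noteq> {}" by (rule ne)
    show "(\<lambda>x. s * f x + t * g x) \<in> V" if "f \<in> V" "g \<in> V" for f g s t using that by (rule V)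
    show "Lsq_inner M (\<lambda>x. s * f x + t * g x) h = s * Lsq_inner M f h + t * Lsq_inner M g h"
      if "f \<in> V" "g \<in> V" "h \<in> V" for f g h s t using that VL by (intro Lsq_inner_lincomb_left) auto
    show "Lsq_inner M f g = Lsq_inner M g f" for f g by (rule Lsq_inner_commute)
    show "- L (\<lambda>x. (1 - t) * f x + t * g x) \<le> (1 - t) * - L f + t * - L g" if "f \<in> V" "g \<in> V" for f g t
      using lin[OF that, of "1 - t" t] by simp
    show "- (K\<^sup>2 / 2) \<le> Lsq_inner M f f / 2 + - L f" if "f \<in> V" for f using that by (rule low)
  qed blast
  have fL: "f n \<in> Lsq M" for n using f VL by auto
  have "\<exists>N. \<forall>m\<ge>N. \<forall>n\<ge>N. Lsq_norm M (\<lambda>x. f m x - f n x) < e" if e: "e > 0" for e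
  proof -
    obtain N where "\<forall>m\<ge>N. \<forall>n\<ge>N. Lsq_inner M (\<lambda>x. f m x - f n x) (\<lambda>x. f m x - f n x) < e\<^sup>2"
      using C[of "e\<^sup>2"] e by auto
    then have "\<forall>m\<ge>N. \<forall>n\<ge>N. Lsq_norm M (\<lambda>x. f m x - f n x) < e"
      using e by (auto simp: Lsq_norm_def intro!: real_less_lsqrt)
    then show ?thesis ..
  qed
  then obtain \<xi> where \<xi>: "Lsq_lim M f \<xi>" by (rule Lsq_complete[OF fL])
  have ge: "0 \<le> Lsq_inner M \<xi> \<phi> - L \<phi>" if \<phi>: "\<phi> \<in> V" for \<phi>
  proof (rule var[OF \<phi>])
    have "(\<lambda>n. Lsq_inner M (f n) \<phi> - L \<phi>) \<longlonglongrightarrow> Lsq_inner M \<xi> \<phi> - L \<phi>"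
      using \<phi> VL by (intro tendsto_diff tendsto_const Lsq_lim_inner \<xi> Lsq_lim_const) auto
    moreover have "Lsq_inner M (f n) \<phi> + - L (\<lambda>x. f n x + \<phi> x) - - L (f n) = Lsq_inner M (f n) \<phi> - L \<phi>" for n
      using lin[OF f \<phi>, of 1 n 1] by simp
    ultimately show "(\<lambda>n. Lsq_inner M (f n) \<phi> + - L (\<lambda>x. f n x + \<phi> x) - - L (f n)) \<longlonglongrightarrow> Lsq_inner M \<xi> \<phi> - L \<phi>"
      by (simp only:)
  qed
  have "L \<phi> = Lsq_inner M \<xi> \<phi>" if \<phi>: "\<phi> \<in> V" for \<phi>
  proof -
    have \<xi>L: "\<xi> \<in> Lsq M" using \<xi> by (simp add: Lsq_lim_def)
    have "(\<lambda>x. 0 * \<phi> x + - 1 * \<phi> x) \<in> V" by (intro V \<phi>)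
    from ge[OF this] have "Lsq_inner M \<xi> \<phi> \<le> L \<phi>"
      using lin[OF \<phi> \<phi>, of 0 "-1"] Lsq_inner_lincomb_right[of \<phi> M \<phi> \<xi> 0 "-1"] \<xi>L \<phi> VL by auto
    with ge[OF \<phi>] show ?thesis by simp
  qed
  then show ?thesis using that f \<xi> by blast
qed

lemma AE_eq_0_if_nonpos_integral_nonneg:
  fixes h :: "'a \<Rightarrow> real"
  assumes "integrable M h" "AE x in M. h x \<le> 0" "0 \<le> (LINT x|M. h x)"
  shows "AE x in M. h x = 0"
proof -
  have "AE x in M. 0 \<le> - h x" using assms(2) by eventually_elim simp
  then have "0 \<le> (LINT x|M. - h x)" by (rule integral_nonneg_AE)
  then have "(LINT x|M. - h x) = 0" using assms by simp
  then have "AE x in M. - h x = 0"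
    using integral_nonneg_eq_0_iff_AE[of M "\<lambda>x. - h x"] assms(1) \<open>AE x in M. 0 \<le> - h x\<close> by simp
  then show ?thesis by eventually_elim simp
qed

section \<open>Restriction to parts of the boundary\<close>

lemma Lsq_restrict_space:
  assumes T: "T \<inter> space N \<in> sets N" and f: "f \<in> Lsq N"
  shows "f \<in> Lsq (restrict_space N T)" "Lsq_norm (restrict_space N T) f \<le> Lsq_norm N f"
proof -
  have int: "integrable N (\<lambda>x. f x * f x)" using f f by (rule Lsq_integrable_mult)
  have intT: "integrable N (\<lambda>x. indicator T x *\<^sub>R (f x * f x))"
  proof (rule Bochner_Integration.integrable_bound[OF int])
    show "(\<lambda>x. indicator T x *\<^sub>R (f x * f x)) \<in> borel_measurable N"
      using borel_measurable_restrict_space_iff[OF T, of "\<lambda>x. f x * f x"] int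
      by (auto intro: measurable_restrict_space1)
  qed (auto simp: indicator_def)
  show "f \<in> Lsq (restrict_space N T)"
    using f intT integrable_restrict_space[OF T, of "\<lambda>x. f x * f x"]
    by (simp add: Lsq_def measurable_restrict_space1 power2_eq_square)
  have "Lsq_inner (restrict_space N T) f f \<le> Lsq_inner N f f"
    unfolding Lsq_inner_def integral_restrict_space[OF T]
    by (rule integral_mono[OF intT int]) (auto simp: indicator_def)
  then show "Lsq_norm (restrict_space N T) f \<le> Lsq_norm N f" by (simp add: Lsq_norm_def)
qed

text \<open>Facts about traces hold a.e. on the whole boundary. Viewing the measure on a part as a
  restriction of the measure on the boundary carries them over to \<Gamma>D and \<Gamma>C.\<close>

lemma surface_on_subset:
  assumes "T \<in> sets borel" "U \<in> sets borel" "T \<subseteq> U"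
  shows "T \<inter> space (surface_on U) \<in> sets (surface_on U)"
    and "surface_on T = restrict_space (surface_on U) T"
proof -
  show "T \<inter> space (surface_on U) \<in> sets (surface_on U)"
    using assms unfolding surface_on_def sets_restrict_space space_restrict_space
    by (auto simp: Int_absorb1 intro!: image_eqI[of _ _ T] dest: sets.sets_into_space)
  have "restrict_space (restrict_space N U) T = restrict_space N (U \<inter> T)" if "sets N = sets borel" for N :: "'a measure"
    using assms that sets_eq_imp_space_eq[OF that] by (intro restrict_restrict_space) auto
  then show "surface_on T = restrict_space (surface_on U) T"
    using assms unfolding surface_on_def by (simp add: Int_absorb1)
qed

subsection \<open>The variational problem\<close>

locale semi_discrete = trace_domain \<Omega> \<gamma> for \<Omega> :: "'a::euclidean_space set" and \<gamma> +
  fixes \<Gamma>D \<Gamma>C :: "'a set" and \<tau> :: real and \<kappa> :: "'a \<Rightarrow> real"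
  assumes \<Gamma>_borel: "\<Gamma>D \<in> sets borel" "\<Gamma>C \<in> sets borel"
    and \<Gamma>_frontier: "\<Gamma>D \<subseteq> frontier \<Omega>" "\<Gamma>C \<subseteq> frontier \<Omega>"
    and \<tau>_pos: "\<tau> > 0"
    and \<kappa>_Linfty: "\<kappa> \<in> Linfty (lebesgue_on \<Omega>)"
    and coercive: "coercive_on \<Omega> (V_space \<Omega> \<Gamma>D \<gamma>) (A_op \<Omega> \<tau> \<kappa>)"
begin

abbreviation V :: "('a \<Rightarrow> real) set" where "V \<equiv> V_space \<Omega> \<Gamma>D \<gamma>"
abbreviation A :: "('a \<Rightarrow> real) \<Rightarrow> ('a \<Rightarrow> real) \<Rightarrow> real" where "A \<equiv> A_op \<Omega> \<tau> \<kappa>"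

lemma frontier_borel: "frontier \<Omega> \<in> sets borel"
  by (intro borel_closed frontier_closed)

lemmas \<Gamma>D_sub = surface_on_subset[OF \<Gamma>_borel(1) frontier_borel \<Gamma>_frontier(1)]
lemmas \<Gamma>C_sub = surface_on_subset[OF \<Gamma>_borel(2) frontier_borel \<Gamma>_frontier(2)]

section \<open>The closed subspace V\<close>

lemma V_iff: "\<phi> \<in> V \<longleftrightarrow> \<phi> \<in> H1 \<Omega> \<and> (AE x in S. x \<in> \<Gamma>D \<longrightarrow> \<gamma> \<phi> x = 0)"
  unfolding V_space_def \<Gamma>D_sub(2) AE_restrict_space_iff[OF \<Gamma>D_sub(1)] by simp

lemma V_H1: "\<phi> \<in> V \<Longrightarrow> \<phi> \<in> H1 \<Omega>"
  by (simp add: V_iff)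

lemma V_Lsq: "\<phi> \<in> V \<Longrightarrow> \<phi> \<in> Lsq M"
  by (intro H1_Lsq V_H1)

lemma V_lincomb:
  assumes "\<phi> \<in> V" "\<psi> \<in> V" shows "(\<lambda>x. a * \<phi> x + b * \<psi> x) \<in> V"
proof -
  have "AE x in S. x \<in> \<Gamma>D \<longrightarrow> \<gamma> \<phi> x = 0" "AE x in S. x \<in> \<Gamma>D \<longrightarrow> \<gamma> \<psi> x = 0"
    using assms by (simp_all add: V_iff)
  with trace_lincomb[OF V_H1[OF assms(1)] V_H1[OF assms(2)], of a b]
  have "AE x in S. x \<in> \<Gamma>D \<longrightarrow> \<gamma> (\<lambda>x. a * \<phi> x + b * \<psi> x) x = 0"
    by eventually_elim simp
  then show ?thesis using assms by (simp add: V_iff H1_lincomb)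
qed

lemma V_diff: "\<phi> \<in> V \<Longrightarrow> \<psi> \<in> V \<Longrightarrow> (\<lambda>x. \<phi> x - \<psi> x) \<in> V"
  using V_lincomb[of \<phi> \<psi> 1 "-1"] by simp

lemma test_function_V: assumes "test_function \<Omega> \<psi>" shows "\<psi> \<in> V"
proof -
  have s: "smooth \<psi>" using assms by (rule test_function_smooth)
  obtain K where K: "K \<subseteq> \<Omega>" "\<And>x. x \<notin> K \<Longrightarrow> \<psi> x = 0" using assms unfolding test_function_def by auto
  have "\<psi> x = 0" if "x \<in> \<Gamma>D" for x
    using K that \<Gamma>_frontier(1) open_\<Omega> by (auto simp: frontier_def interior_open)
  with trace_smooth[OF s] have "AE x in S. x \<in> \<Gamma>D \<longrightarrow> \<gamma> \<psi> x = 0" by (auto elim!: eventually_mono)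
  then show ?thesis by (simp add: V_iff smooth_H1[OF s])
qed

lemma zero_V: "(\<lambda>x. 0) \<in> V"
  by (rule test_function_V) (auto simp: test_function_def smooth_const intro: exI[of _ "{}"])

text \<open>The traces converge in L2 on the boundary, and along an a.e. convergent subsequence the
  value 0 on \<Gamma>D survives.\<close>

lemma V_closed:
  assumes f: "\<And>n. f n \<in> V" and lim: "H1_lim f y" shows "y \<in> V"
proof -
  obtain r where r: "AE x in S. (\<lambda>k. \<gamma> (f (r k)) x) \<longlonglongrightarrow> \<gamma> y x"
    using Lsq_lim_AE_subseq[OF trace_lim[OF lim]] by blast
  have "AE x in S. \<forall>k. x \<in> \<Gamma>D \<longrightarrow> \<gamma> (f (r k)) x = 0"
    unfolding AE_all_countable using f by (simp add: V_iff)
  with r have "AE x in S. x \<in> \<Gamma>D \<longrightarrow> \<gamma> y x = 0"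
    by eventually_elim (use LIMSEQ_unique[OF _ tendsto_const] in auto)
  then show ?thesis using lim by (simp add: V_iff H1_lim_def)
qed

lemma V_negative_part:
  assumes "y \<in> V" shows "(\<lambda>x. max (- y x) 0) \<in> V"
proof -
  have "AE x in S. x \<in> \<Gamma>D \<longrightarrow> \<gamma> y x = 0" using assms by (simp add: V_iff)
  with H1_negative_part(3)[OF V_H1[OF assms]]
  have "AE x in S. x \<in> \<Gamma>D \<longrightarrow> \<gamma> (\<lambda>x. max (- y x) 0) x = 0" by eventually_elim simp
  then show ?thesis by (simp add: V_iff H1_negative_part(2)[OF V_H1[OF assms]])
qed

section \<open>The bilinear form and uniqueness\<close>

lemma \<kappa>_mult_Lsq: assumes "f \<in> Lsq M" shows "(\<lambda>x. \<kappa> x * f x) \<in> Lsq M"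
proof -
  obtain K where "\<kappa> \<in> borel_measurable M" "AE x in M. \<bar>\<kappa> x\<bar> \<le> K" using \<kappa>_Linfty by (auto simp: Linfty_def)
  then show ?thesis by (intro Lsq_bounded_mult assms)
qed

text \<open>Attaching \<kappa> to the second gradient keeps plain gradient components in the first
  slot, paired with a fixed L2 function; linearity and limits in the first argument then follow from
  those of \<open>Lsq_inner\<close>.\<close>

lemma A_eq:
  assumes L: "\<psi> \<in> Lsq M" "\<phi> \<in> Lsq M" and g: "has_weak_gradient \<Omega> \<psi> g" and h: "has_weak_gradient \<Omega> \<phi> h"
  shows "A \<psi> \<phi> = Lsq_inner M \<psi> \<phi> + \<tau> * (\<Sum>i\<in>Basis. Lsq_inner M (\<lambda>x. g x \<bullet> i) (\<lambda>x. \<kappa> x * (h x \<bullet> i)))"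
proof -
  have H: "\<psi> \<in> H1 \<Omega>" "\<phi> \<in> H1 \<Omega>" using H1I[OF L(1) g] H1I[OF L(2) h] by auto
  have "(LINT x|M. (\<kappa> x *\<^sub>R weak_grad \<Omega> \<psi> x) \<bullet> weak_grad \<Omega> \<phi> x) =
      (\<Sum>i\<in>Basis. Lsq_inner M (\<lambda>x. (\<kappa> x *\<^sub>R weak_grad \<Omega> \<psi> x) \<bullet> i) (\<lambda>x. weak_grad \<Omega> \<phi> x \<bullet> i))"
    by (rule integral_inner_Basis) (simp_all add: weak_grad_Lsq[OF H(1)] weak_grad_Lsq[OF H(2)] \<kappa>_mult_Lsq)
  also have "\<dots> = (\<Sum>i\<in>Basis. Lsq_inner M (\<lambda>x. weak_grad \<Omega> \<psi> x \<bullet> i) (\<lambda>x. \<kappa> x * (weak_grad \<Omega> \<phi> x \<bullet> i)))"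
    by (simp add: Lsq_inner_def mult_ac)
  also have "\<dots> = (\<Sum>i\<in>Basis. Lsq_inner M (\<lambda>x. g x \<bullet> i) (\<lambda>x. \<kappa> x * (h x \<bullet> i)))"
  proof (intro sum.cong refl Lsq_inner_cong_AE)
    fix i :: 'a assume i: "i \<in> Basis"
    show "AE x in M. weak_grad \<Omega> \<psi> x \<bullet> i = g x \<bullet> i"
      using weak_grad_eq_AE[OF L(1) g] by eventually_elim simp
    show "AE x in M. \<kappa> x * (weak_grad \<Omega> \<phi> x \<bullet> i) = \<kappa> x * (h x \<bullet> i)"
      using weak_grad_eq_AE[OF L(2) h] by eventually_elim simp
  qed (intro Lsq_measurable \<kappa>_mult_Lsq weak_grad_Lsq H has_weak_gradient_Lsq[OF g] has_weak_gradient_Lsq[OF h]; assumption)+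
  finally show ?thesis by (simp add: A_op_def)
qed

lemma A_eq_weak_grad:
  assumes "\<psi> \<in> H1 \<Omega>" "\<phi> \<in> H1 \<Omega>"
  shows "A \<psi> \<phi> = Lsq_inner M \<psi> \<phi> + \<tau> * (\<Sum>i\<in>Basis.
      Lsq_inner M (\<lambda>x. weak_grad \<Omega> \<psi> x \<bullet> i) (\<lambda>x. \<kappa> x * (weak_grad \<Omega> \<phi> x \<bullet> i)))"
  by (rule A_eq[OF H1_Lsq[OF assms(1)] H1_Lsq[OF assms(2)] H1_has_weak_grad[OF assms(1)] H1_has_weak_grad[OF assms(2)]])

lemma A_sym: "\<psi> \<in> H1 \<Omega> \<Longrightarrow> \<phi> \<in> H1 \<Omega> \<Longrightarrow> A \<psi> \<phi> = A \<phi> \<psi>"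
  unfolding A_op_def by (simp add: Lsq_inner_commute[of M \<psi> \<phi>] inner_commute)

lemma A_lincomb:
  assumes H: "\<phi> \<in> H1 \<Omega>" "\<psi> \<in> H1 \<Omega>" "\<eta> \<in> H1 \<Omega>"
  shows "A (\<lambda>x. a * \<phi> x + b * \<psi> x) \<eta> = a * A \<phi> \<eta> + b * A \<psi> \<eta>"
proof -
  let ?G = "\<lambda>\<phi> i x. weak_grad \<Omega> \<phi> x \<bullet> i"
  have "A (\<lambda>x. a * \<phi> x + b * \<psi> x) \<eta> = Lsq_inner M (\<lambda>x. a * \<phi> x + b * \<psi> x) \<eta> + \<tau> * (\<Sum>i\<in>Basis.
      Lsq_inner M (\<lambda>x. (a *\<^sub>R weak_grad \<Omega> \<phi> x + b *\<^sub>R weak_grad \<Omega> \<psi> x) \<bullet> i) (\<lambda>x. \<kappa> x * ?G \<eta> i x))"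
    by (intro A_eq Lsq_lincomb has_weak_gradient_lincomb H1_Lsq H1_has_weak_grad H)
  also have "\<dots> = a * A \<phi> \<eta> + b * A \<psi> \<eta>"
    by (simp add: A_eq_weak_grad H inner_add_left Lsq_inner_lincomb_left H1_Lsq weak_grad_Lsq \<kappa>_mult_Lsq
        sum.distrib sum_distrib_left algebra_simps)
  finally show ?thesis .
qed

lemma A_diff: "\<phi> \<in> H1 \<Omega> \<Longrightarrow> \<psi> \<in> H1 \<Omega> \<Longrightarrow> \<eta> \<in> H1 \<Omega> \<Longrightarrow> A (\<lambda>x. \<phi> x - \<psi> x) \<eta> = A \<phi> \<eta> - A \<psi> \<eta>"
  using A_lincomb[of \<phi> \<psi> \<eta> 1 "-1"] by simp

lemma A_lim:
  assumes "H1_lim f y" "\<phi> \<in> H1 \<Omega>" shows "(\<lambda>n. A (f n) \<phi>) \<longlonglongrightarrow> A y \<phi>"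
proof -
  have H: "f n \<in> H1 \<Omega>" "y \<in> H1 \<Omega>" for n using assms(1) by (auto simp: H1_lim_def)
  show ?thesis
    unfolding A_eq_weak_grad[OF H(1) assms(2)] A_eq_weak_grad[OF H(2) assms(2)]
    by (intro tendsto_add tendsto_mult tendsto_const tendsto_sum Lsq_lim_inner H1_limD assms(1) Lsq_lim_const
        \<kappa>_mult_Lsq weak_grad_Lsq H1_Lsq assms(2))
qed

text \<open>A function of norm 0 vanishes only a.e., so the conclusion goes through Cauchy-Schwarz
  for each term of the form.\<close>

lemma A_H1_norm_eq_0:
  assumes d: "d \<in> H1 \<Omega>" "H1_norm \<Omega> d = 0" and \<phi>: "\<phi> \<in> H1 \<Omega>" shows "A d \<phi> = 0"
proof -
  note le = Lsq_norm_le_H1_norm[OF H1_Lsq[OF d(1)] H1_has_weak_grad[OF d(1)]]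
  have "Lsq_inner M d \<phi> = 0"
    using Cauchy_Schwarz_Lsq[OF H1_Lsq[OF d(1)] H1_Lsq[OF \<phi>]] le(1) d(2) Lsq_norm_nonneg[of M d] by simp
  moreover have "Lsq_inner M (\<lambda>x. weak_grad \<Omega> d x \<bullet> i) (\<lambda>x. \<kappa> x * (weak_grad \<Omega> \<phi> x \<bullet> i)) = 0" if i: "i \<in> Basis" for i
    using Cauchy_Schwarz_Lsq[OF weak_grad_Lsq[OF d(1) i] \<kappa>_mult_Lsq[OF weak_grad_Lsq[OF \<phi> i]]] le(2)[OF i] d(2)
      Lsq_norm_nonneg[of M "\<lambda>x. weak_grad \<Omega> d x \<bullet> i"] by simp
  ultimately show ?thesis by (simp add: A_eq_weak_grad d \<phi>)
qed

lemma coercivity: obtains c where "c > 0" "\<And>\<psi>. \<psi> \<in> V \<Longrightarrow> c * (H1_norm \<Omega> \<psi>)\<^sup>2 \<le> A \<psi> \<psi>"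
  using coercive unfolding coercive_on_def by blast

lemma A_nonpos_imp_0:
  assumes "d \<in> V" "A d d \<le> 0" shows "H1_norm \<Omega> d = 0" "AE x in M. d x = 0"
proof -
  obtain c where c: "c > 0" "c * (H1_norm \<Omega> d)\<^sup>2 \<le> A d d" using coercivity assms(1) by blast
  have "c * (H1_norm \<Omega> d)\<^sup>2 \<le> 0" using c(2) assms(2) by (rule order_trans)
  then have "(H1_norm \<Omega> d)\<^sup>2 \<le> 0" using c(1) by (simp add: mult_le_0_iff)
  then show 0: "H1_norm \<Omega> d = 0" by simp
  have "Lsq_norm M d = 0"
    using Lsq_norm_le_H1_norm(1)[OF H1_Lsq H1_has_weak_grad, OF V_H1 V_H1, OF assms(1,1)] 0 Lsq_norm_nonneg[of M d] by simp
  then show "AE x in M. d x = 0" by (rule Lsq_norm_eq_0[OF V_Lsq[OF assms(1)]])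
qed

text \<open>The functional \<open>F\<close> cancels in the difference. Once y and y' agree, the
  equation itself makes \<xi> - \<xi>' orthogonal to every test function. Monotonicity is a
  hypothesis because the two systems provide it for different reasons.\<close>

lemma uniqueness:
  assumes V: "y \<in> V" "y' \<in> V" and L: "\<xi> \<in> Lsq M" "\<xi>' \<in> Lsq M"
    and eq: "\<And>\<phi>. \<phi> \<in> V \<Longrightarrow> A y \<phi> = Lsq_inner M \<xi> \<phi> + F \<phi>" "\<And>\<phi>. \<phi> \<in> V \<Longrightarrow> A y' \<phi> = Lsq_inner M \<xi>' \<phi> + F \<phi>"
    and mono: "Lsq_inner M (\<lambda>x. \<xi> x - \<xi>' x) (\<lambda>x. y x - y' x) \<le> 0"
  shows "AE x in M. y x = y' x" "AE x in M. \<xi> x = \<xi>' x"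
proof -
  define d where "d = (\<lambda>x. y x - y' x)"
  have d: "d \<in> V" unfolding d_def by (rule V_diff[OF V])
  have Ad: "A d \<phi> = Lsq_inner M (\<lambda>x. \<xi> x - \<xi>' x) \<phi>" if \<phi>: "\<phi> \<in> V" for \<phi>
    unfolding d_def using eq[OF \<phi>] by (simp add: A_diff V_H1 V \<phi> Lsq_inner_diff_left L V_Lsq)
  have "A d d \<le> 0" using Ad[OF d] mono by (simp add: d_def)
  note z = A_nonpos_imp_0[OF d this]
  show "AE x in M. y x = y' x" using z(2) by eventually_elim (simp add: d_def)
  have "AE x in M. \<xi> x - \<xi>' x = 0"
  proof (rule fundamental_lemma)
    fix \<psi> assume "test_function \<Omega> \<psi>"
    then have "\<psi> \<in> V" by (rule test_function_V)
    then show "Lsq_inner M (\<lambda>x. \<xi> x - \<xi>' x) \<psi> = 0"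
      using Ad A_H1_norm_eq_0[OF V_H1[OF d] z(1) V_H1] by metis
  qed (intro Lsq_diff L)
  then show "AE x in M. \<xi> x = \<xi>' x" by eventually_elim simp
qed

lemma V_Riesz:
  assumes lin: "\<And>f g s t. f \<in> V \<Longrightarrow> g \<in> V \<Longrightarrow> L (\<lambda>x. s * f x + t * g x) = s * L f + t * L g"
    and bd: "\<And>f. f \<in> V \<Longrightarrow> \<bar>L f\<bar> \<le> K * Lsq_norm M f"
  obtains f \<xi> where "\<And>n::nat. f n \<in> V" "Lsq_lim M f \<xi>" "\<And>\<phi>. \<phi> \<in> V \<Longrightarrow> L \<phi> = Lsq_inner M \<xi> \<phi>"
  by (rule Lsq_Riesz[of V M L K]) (use zero_V V_Lsq V_lincomb lin bd in \<open>blast+\<close>)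

text \<open>The pairing with \<phi> is represented on V by a limit of elements of V. Its difference
  from \<phi> is orthogonal to all test functions, hence 0 a.e., so \<phi> is such a limit
  itself.\<close>

lemma V_dense:
  assumes \<phi>: "\<phi> \<in> Lsq M" obtains f where "\<And>n::nat. f n \<in> V" "Lsq_lim M f \<phi>"
proof -
  obtain f \<xi> where f: "\<And>n::nat. f n \<in> V" "Lsq_lim M f \<xi>"
    and \<xi>: "\<And>\<psi>. \<psi> \<in> V \<Longrightarrow> Lsq_inner M \<phi> \<psi> = Lsq_inner M \<xi> \<psi>"
  proof (rule V_Riesz[of "Lsq_inner M \<phi>" "Lsq_norm M \<phi>"])
    show "Lsq_inner M \<phi> (\<lambda>x. s * f x + t * g x) = s * Lsq_inner M \<phi> f + t * Lsq_inner M \<phi> g"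
      if "f \<in> V" "g \<in> V" for f g s t using that by (intro Lsq_inner_lincomb_right V_Lsq \<phi>)
    show "\<bar>Lsq_inner M \<phi> f\<bar> \<le> Lsq_norm M \<phi> * Lsq_norm M f" if "f \<in> V" for f
      using that by (intro Cauchy_Schwarz_Lsq V_Lsq \<phi>)
  qed blast
  have \<xi>L: "\<xi> \<in> Lsq M" and fL: "f n \<in> Lsq M" for n using f(2) by (auto simp: Lsq_lim_def)
  have "AE x in M. \<xi> x - \<phi> x = 0"
  proof (rule fundamental_lemma)
    fix \<psi> assume \<psi>: "test_function \<Omega> \<psi>"
    then show "Lsq_inner M (\<lambda>x. \<xi> x - \<phi> x) \<psi> = 0"
      using \<xi>[OF test_function_V] by (simp add: Lsq_inner_diff_left \<xi>L \<phi> V_Lsq test_function_V)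
  qed (intro Lsq_diff \<xi>L \<phi>)
  then have "AE x in M. \<xi> x = \<phi> x" by eventually_elim simp
  then have "Lsq_lim M f \<phi>"
    by (rule Lsq_lim_cong_AE[OF f(2) AE_I2[OF refl]]) (simp_all add: Lsq_measurable fL \<phi>)
  with f(1) show ?thesis by (rule that)
qed

section \<open>The convex penalty\<close>

definition neg_integral :: "('a \<Rightarrow> real) \<Rightarrow> real" where
  "neg_integral f = Lsq_inner M (\<lambda>x. max (- f x) 0) (\<lambda>_. 1)"

lemma one_Lsq: "(\<lambda>_. 1) \<in> Lsq M"
  by (rule smooth_Lsq[OF smooth_const])

lemma neg_part_Lsq: "f \<in> Lsq M \<Longrightarrow> (\<lambda>x. max (- f x) 0) \<in> Lsq M"
  by (rule Lsq_bound[where c = 1 and f = f]) (auto dest: Lsq_measurable)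

lemma neg_integral_eq: "neg_integral f = (LINT x|M. max (- f x) 0)"
  by (simp add: neg_integral_def Lsq_inner_def)

lemma neg_part_integrable: "f \<in> Lsq M \<Longrightarrow> integrable M (\<lambda>x. max (- f x) 0)"
  by (intro Lsq_integrable_finite finite_measure_M neg_part_Lsq)

lemma neg_integral_nonneg: "0 \<le> neg_integral f"
  by (simp add: neg_integral_eq)

text \<open>The negative part is a Lipschitz map vanishing at 0, and pairing with the constant 1 is
  continuous because \<Omega> has finite measure.\<close>

lemma neg_integral_lim: assumes "Lsq_lim M f g" shows "(\<lambda>n. neg_integral (f n)) \<longlonglongrightarrow> neg_integral g"
  unfolding neg_integral_def
  by (intro Lsq_lim_inner Lsq_lim_const one_Lsq
      Lsq_lim_Lipschitz[OF assms, where G = "\<lambda>s. max (- s) 0" and C = 1]) (auto simp: max_def)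

lemma neg_integral_convex:
  assumes fg: "f \<in> Lsq M" "g \<in> Lsq M" and t: "0 \<le> t" "t \<le> 1"
  shows "neg_integral (\<lambda>x. (1 - t) * f x + t * g x) \<le> (1 - t) * neg_integral f + t * neg_integral g"
proof -
  have "neg_integral (\<lambda>x. (1 - t) * f x + t * g x) \<le> (LINT x|M. (1 - t) * max (- f x) 0 + t * max (- g x) 0)"
    unfolding neg_integral_eq
  proof (rule integral_mono)
    fix x
    have "(1 - t) * - f x \<le> (1 - t) * max (- f x) 0" "t * - g x \<le> t * max (- g x) 0"
      "0 \<le> (1 - t) * max (- f x) 0" "0 \<le> t * max (- g x) 0"
      using t by (intro mult_left_mono mult_nonneg_nonneg; simp)+
    then show "max (- ((1 - t) * f x + t * g x)) 0 \<le> (1 - t) * max (- f x) 0 + t * max (- g x) 0" by simp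
  qed (intro neg_part_integrable Lsq_lincomb fg Bochner_Integration.integrable_add integrable_mult_right)+
  also have "\<dots> = (1 - t) * neg_integral f + t * neg_integral g"
    unfolding neg_integral_eq by (simp add: neg_part_integrable fg)
  finally show ?thesis .
qed

lemma neg_integral_eq_0: assumes "AE x in M. 0 \<le> f x" "f \<in> Lsq M" shows "neg_integral f = 0"
proof -
  have "neg_integral f = (LINT x|M. 0)" unfolding neg_integral_eq
    by (rule integral_cong_AE) (use assms Lsq_measurable[OF neg_part_Lsq] in \<open>auto elim!: eventually_mono\<close>)
  then show ?thesis by simp
qed

section \<open>The load functional and existence of a solution for given data\<close>

definition load :: "('a \<Rightarrow> real) \<Rightarrow> ('a \<Rightarrow> real) \<Rightarrow> ('a \<Rightarrow> real) \<Rightarrow> real" where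
  "load u f \<phi> = \<tau> * Lsq_inner (surface_on \<Gamma>C) u (\<gamma> \<phi>) + Lsq_inner M f \<phi>"

lemma trace_Lsq_\<Gamma>C: "\<phi> \<in> H1 \<Omega> \<Longrightarrow> \<gamma> \<phi> \<in> Lsq (surface_on \<Gamma>C)"
  unfolding \<Gamma>C_sub(2) by (rule Lsq_restrict_space(1)[OF \<Gamma>C_sub(1) trace_Lsq])

lemma AE_\<Gamma>C: "AE x in S. P x \<Longrightarrow> AE x in surface_on \<Gamma>C. P x"
  unfolding \<Gamma>C_sub(2) AE_restrict_space_iff[OF \<Gamma>C_sub(1)] by (auto elim: eventually_mono)

context
  fixes u f assumes u: "u \<in> Lsq (surface_on \<Gamma>C)" and f: "f \<in> Lsq M"
begin

lemma load_lincomb: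
  assumes H: "\<phi> \<in> H1 \<Omega>" "\<psi> \<in> H1 \<Omega>"
  shows "load u f (\<lambda>x. a * \<phi> x + b * \<psi> x) = a * load u f \<phi> + b * load u f \<psi>"
proof -
  have "Lsq_inner (surface_on \<Gamma>C) u (\<gamma> (\<lambda>x. a * \<phi> x + b * \<psi> x)) =
      Lsq_inner (surface_on \<Gamma>C) u (\<lambda>x. a * \<gamma> \<phi> x + b * \<gamma> \<psi> x)"
    by (intro Lsq_inner_cong_AE AE_I2 refl AE_\<Gamma>C trace_lincomb H Lsq_measurable u Lsq_lincomb
        trace_Lsq_\<Gamma>C H1_lincomb)
  then show ?thesis
    by (simp add: load_def Lsq_inner_lincomb_right u f trace_Lsq_\<Gamma>C H H1_Lsq algebra_simps)
qed

lemma load_bounded: obtains K where "\<And>\<phi>. \<phi> \<in> H1 \<Omega> \<Longrightarrow> \<bar>load u f \<phi>\<bar> \<le> K * H1_norm \<Omega> \<phi>"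
proof -
  obtain C where C: "0 \<le> C" "\<And>\<phi>. \<phi> \<in> H1 \<Omega> \<Longrightarrow> Lsq_norm S (\<gamma> \<phi>) \<le> C * H1_norm \<Omega> \<phi>"
    using trace_bounded by blast
  let ?U = "Lsq_norm (surface_on \<Gamma>C) u"
  have "\<bar>load u f \<phi>\<bar> \<le> (\<tau> * (?U * C) + Lsq_norm M f) * H1_norm \<Omega> \<phi>" if \<phi>: "\<phi> \<in> H1 \<Omega>" for \<phi>
  proof -
    have "Lsq_norm (surface_on \<Gamma>C) (\<gamma> \<phi>) \<le> C * H1_norm \<Omega> \<phi>"
      using Lsq_restrict_space(2)[OF \<Gamma>C_sub(1) trace_Lsq[OF \<phi>]] C(2)[OF \<phi>] unfolding \<Gamma>C_sub(2) by (rule order_trans)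
    then have "\<bar>Lsq_inner (surface_on \<Gamma>C) u (\<gamma> \<phi>)\<bar> \<le> ?U * (C * H1_norm \<Omega> \<phi>)"
      by (intro order_trans[OF Cauchy_Schwarz_Lsq[OF u trace_Lsq_\<Gamma>C[OF \<phi>]]] mult_left_mono Lsq_norm_nonneg)
    then have "\<bar>\<tau> * Lsq_inner (surface_on \<Gamma>C) u (\<gamma> \<phi>)\<bar> \<le> \<tau> * (?U * (C * H1_norm \<Omega> \<phi>))"
      using \<tau>_pos by (simp add: abs_mult)
    moreover have "\<bar>Lsq_inner M f \<phi>\<bar> \<le> Lsq_norm M f * H1_norm \<Omega> \<phi>"
      by (intro order_trans[OF Cauchy_Schwarz_Lsq[OF f H1_Lsq[OF \<phi>]]] mult_left_mono Lsq_norm_nonneg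
          Lsq_norm_le_H1_norm(1)[OF H1_Lsq[OF \<phi>] H1_has_weak_grad[OF \<phi>]])
    ultimately show ?thesis unfolding load_def by (simp add: algebra_simps)
  qed
  then show ?thesis by (rule that)
qed

text \<open>Coercivity turns the Cauchy property in the form A into one in the H1 norm, and V is
  closed under H1 limits. The variational inequality is linear in y apart from the penalty, and both
  parts are continuous along the sequence.\<close>

lemma energy_minimiser:
  obtains y where "y \<in> V"
    "\<And>\<phi>. \<phi> \<in> V \<Longrightarrow> 0 \<le> A y \<phi> - load u f \<phi> + neg_integral (\<lambda>x. y x + \<phi> x) - neg_integral y"
proof -
  obtain c where c: "c > 0" "\<And>\<psi>. \<psi> \<in> V \<Longrightarrow> c * (H1_norm \<Omega> \<psi>)\<^sup>2 \<le> A \<psi> \<psi>" using coercivity by blast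
  obtain K where K: "\<And>\<phi>. \<phi> \<in> H1 \<Omega> \<Longrightarrow> \<bar>load u f \<phi>\<bar> \<le> K * H1_norm \<Omega> \<phi>" using load_bounded by blast
  define P where "P g = neg_integral g - load u f g" for g
  \<comment> \<open>The constant is the minimum of c r^2 / 2 - K r over all real r; the penalty is
    nonnegative and only helps.\<close>
  have low: "- (K\<^sup>2 / (2 * c)) \<le> A g g / 2 + P g" if g: "g \<in> V" for g
  proof -
    have "0 \<le> (c * H1_norm \<Omega> g - K)\<^sup>2 / (2 * c)" using c(1) by simp
    also have "\<dots> = c * (H1_norm \<Omega> g)\<^sup>2 / 2 - K * H1_norm \<Omega> g + K\<^sup>2 / (2 * c)"
      using c(1) by (simp add: power2_eq_square field_simps)
    finally show ?thesis
      using c(2)[OF g] K[OF V_H1[OF g]] neg_integral_nonneg[of g] unfolding P_def by linarith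
  qed
  obtain y where y: "\<And>n::nat. y n \<in> V"
    and C: "\<And>e. e > 0 \<Longrightarrow> \<exists>N. \<forall>m\<ge>N. \<forall>n\<ge>N. A (\<lambda>x. y m x - y n x) (\<lambda>x. y m x - y n x) < e"
    and var: "\<And>\<phi> \<beta>. \<phi> \<in> V \<Longrightarrow> (\<lambda>n. A (y n) \<phi> + P (\<lambda>x. y n x + \<phi> x) - P (y n)) \<longlonglongrightarrow> \<beta> \<Longrightarrow> 0 \<le> \<beta>"
  proof (rule convex_minimising_sequence[of V A P "- (K\<^sup>2 / (2 * c))"])
    show "V \<noteq> {}" using zero_V by blast
    show "(\<lambda>x. s * g x + t * h x) \<in> V" if "g \<in> V" "h \<in> V" for g h s t using that by (rule V_lincomb)
    show "A (\<lambda>x. s * g x + t * h x) k = s * A g k + t * A h k" if "g \<in> V" "h \<in> V" "k \<in> V" for g h k s t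
      using that by (intro A_lincomb V_H1)
    show "A g h = A h g" if "g \<in> V" "h \<in> V" for g h using that by (intro A_sym V_H1)
    show "P (\<lambda>x. (1 - t) * g x + t * h x) \<le> (1 - t) * P g + t * P h"
      if "g \<in> V" "h \<in> V" "0 \<le> t" "t \<le> 1" for g h t
      using neg_integral_convex[OF V_Lsq V_Lsq, of g h t] load_lincomb[OF V_H1 V_H1, of g h "1 - t" t] that
      by (simp add: P_def right_diff_distrib)
    show "- (K\<^sup>2 / (2 * c)) \<le> A g g / 2 + P g" if "g \<in> V" for g using that by (rule low)
  qed blast
  have "\<exists>N. \<forall>m\<ge>N. \<forall>n\<ge>N. H1_norm \<Omega> (\<lambda>x. y m x - y n x) < e" if e: "e > 0" for e
  proof -
    obtain N where N: "\<forall>m\<ge>N. \<forall>n\<ge>N. A (\<lambda>x. y m x - y n x) (\<lambda>x. y m x - y n x) < c * e\<^sup>2"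
      using C[of "c * e\<^sup>2"] e c(1) by auto
    have "H1_norm \<Omega> (\<lambda>x. y m x - y n x) < e" if "m \<ge> N" "n \<ge> N" for m n
    proof -
      have "c * (H1_norm \<Omega> (\<lambda>x. y m x - y n x))\<^sup>2 < c * e\<^sup>2"
        using le_less_trans[OF c(2)[OF V_diff[OF y y]]] N that by blast
      then have "(H1_norm \<Omega> (\<lambda>x. y m x - y n x))\<^sup>2 < e\<^sup>2" using c(1) by simp
      then show ?thesis using e by (intro power_less_imp_less_base[of _ 2 e]) auto
    qed
    then show ?thesis by blast
  qed
  then obtain z where z: "H1_lim y z" by (rule H1_complete[OF V_H1[OF y]])
  have zV: "z \<in> V" by (rule V_closed[OF y z])
  have "0 \<le> A z \<phi> - load u f \<phi> + neg_integral (\<lambda>x. z x + \<phi> x) - neg_integral z" if \<phi>: "\<phi> \<in> V" for \<phi>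
  proof (rule var[OF \<phi>])
    have "Lsq_lim M (\<lambda>n x. y n x + \<phi> x) (\<lambda>x. z x + \<phi> x)"
      using Lsq_lim_diff_const[OF H1_limD(1)[OF z] Lsq_uminus[OF V_Lsq[OF \<phi>]]] by simp
    note lim_sum = neg_integral_lim[OF this]
    have "(\<lambda>n. A (y n) \<phi> - load u f \<phi> + neg_integral (\<lambda>x. y n x + \<phi> x) - neg_integral (y n)) \<longlonglongrightarrow>
        A z \<phi> - load u f \<phi> + neg_integral (\<lambda>x. z x + \<phi> x) - neg_integral z"
      by (intro tendsto_add tendsto_diff tendsto_const lim_sum neg_integral_lim[OF H1_limD(1)[OF z]]
          A_lim[OF z V_H1[OF \<phi>]])
    moreover have "A (y n) \<phi> + P (\<lambda>x. y n x + \<phi> x) - P (y n) =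
        A (y n) \<phi> - load u f \<phi> + neg_integral (\<lambda>x. y n x + \<phi> x) - neg_integral (y n)" for n
      using load_lincomb[OF V_H1[OF y] V_H1[OF \<phi>], of 1 n 1] by (simp add: P_def)
    ultimately show "(\<lambda>n. A (y n) \<phi> + P (\<lambda>x. y n x + \<phi> x) - P (y n)) \<longlonglongrightarrow>
        A z \<phi> - load u f \<phi> + neg_integral (\<lambda>x. z x + \<phi> x) - neg_integral z" by (simp only:)
  qed
  with zV show ?thesis by (rule that)
qed

text \<open>The signs of the data enter only through the test with the negative part of y. From then
  on y \<ge> 0 makes the penalty of y vanish, and the bounds on \<xi> come from choosing directions
  in the variational inequality.\<close>

theorem existence:
  assumes u0: "AE x in surface_on \<Gamma>C. 0 \<le> u x" and f1: "AE x in M. - 1 \<le> f x"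
  obtains y \<xi> where "y \<in> V" "\<xi> \<in> Lsq M" "\<And>\<phi>. \<phi> \<in> V \<Longrightarrow> A y \<phi> = Lsq_inner M \<xi> \<phi> + load u f \<phi>"
    "AE x in M. 0 \<le> y x" "AE x in M. 0 \<le> \<xi> x \<and> \<xi> x \<le> 1" "AE x in M. y x * \<xi> x = 0"
proof -
  obtain y where y: "y \<in> V"
    and vi: "\<And>\<phi>. \<phi> \<in> V \<Longrightarrow> 0 \<le> A y \<phi> - load u f \<phi> + neg_integral (\<lambda>x. y x + \<phi> x) - neg_integral y"
    using energy_minimiser by blast
  note yL = V_Lsq[OF y] and yH = V_H1[OF y]
  note ym = Lsq_measurable[OF yL]
  define w where "w = (\<lambda>x. max (- y x) 0)"
  have w: "w \<in> V" unfolding w_def by (rule V_negative_part[OF y])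
  note wL = V_Lsq[OF w]
  have y0: "AE x in M. 0 \<le> y x"
  proof -
    \<comment> \<open>\<open>y + w\<close> is the positive part of y, so the direction w removes the
      whole penalty.\<close>
    have N0: "neg_integral (\<lambda>x. y x + w x) = 0"
      by (rule neg_integral_eq_0[OF AE_I2 Lsq_add[OF yL wL]]) (simp add: w_def)
    have Ny: "neg_integral y = Lsq_inner M w (\<lambda>_. 1)" by (simp add: neg_integral_def w_def)
    have "AE x in surface_on \<Gamma>C. 0 \<le> u x * \<gamma> w x"
      using u0 AE_\<Gamma>C[OF H1_negative_part(3)[OF yH]] by eventually_elim (simp add: w_def)
    then have "0 \<le> Lsq_inner (surface_on \<Gamma>C) u (\<gamma> w)" unfolding Lsq_inner_def by (rule integral_nonneg_AE)
    moreover have "- Lsq_inner M w (\<lambda>_. 1) \<le> Lsq_inner M f w"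
    proof -
      have "(LINT x|M. - (w x * 1)) \<le> (LINT x|M. f x * w x)"
      proof (rule integral_mono_AE)
        show "AE x in M. - (w x * 1) \<le> f x * w x"
          using f1
        proof eventually_elim
          case (elim x)
          then have "- 1 * w x \<le> f x * w x" by (intro mult_right_mono) (auto simp: w_def)
          then show ?case by simp
        qed
      qed (intro Bochner_Integration.integrable_minus Lsq_integrable_mult wL one_Lsq f)+
      then show ?thesis by (simp add: Lsq_inner_def)
    qed
    \<comment> \<open>The boundary term is nonnegative because the trace of w is a negative part
      too. The remaining loss is at most the integral of w, which is exactly the penalty of y, and
      the two cancel in the variational inequality.\<close>
    ultimately have "- Lsq_inner M w (\<lambda>_. 1) \<le> load u f w"
      unfolding load_def using \<tau>_pos by (intro add_increasing) auto
    then have "0 \<le> A y w" using vi[OF w] N0 Ny by simp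
    moreover have "A y w = - A w w"
    proof -
      let ?g = "weak_grad \<Omega> y" and ?h = "\<lambda>x. (if y x < 0 then - 1 else 0) *\<^sub>R weak_grad \<Omega> y x"
      have h: "has_weak_gradient \<Omega> w ?h" unfolding w_def by (rule H1_negative_part(1)[OF yH])
      have "Lsq_inner M y w = - Lsq_inner M w w"
        unfolding Lsq_inner_def integral_minus[symmetric] w_def
        by (rule Bochner_Integration.integral_cong) (auto simp: max_def)
      \<comment> \<open>Pointwise, \<open>?h\<close> is either 0, so that both products vanish, or
        equal to - \<open>?g\<close>.\<close>
      moreover have "Lsq_inner M (\<lambda>x. ?g x \<bullet> i) (\<lambda>x. \<kappa> x * (?h x \<bullet> i)) =
          - Lsq_inner M (\<lambda>x. ?h x \<bullet> i) (\<lambda>x. \<kappa> x * (?h x \<bullet> i))" for i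
        unfolding Lsq_inner_def integral_minus[symmetric]
        by (rule Bochner_Integration.integral_cong) auto
      ultimately show ?thesis
        using A_eq[OF yL wL H1_has_weak_grad[OF yH] h] A_eq[OF wL wL h h]
        by (simp add: sum_negf)
    qed
    ultimately have "A w w \<le> 0" by simp
    from A_nonpos_imp_0(2)[OF w this] show ?thesis by eventually_elim (simp add: w_def max_def split: if_splits)
  qed
  have Ny: "neg_integral y = 0" by (rule neg_integral_eq_0[OF y0 yL])
  define L where "L \<phi> = A y \<phi> - load u f \<phi>" for \<phi>
  have lin: "L (\<lambda>x. s * g x + t * h x) = s * L g + t * L h" if "g \<in> V" "h \<in> V" for g h s t
    using A_lincomb[OF V_H1 V_H1 yH, of g h s t] A_sym[OF yH V_H1] that V_lincomb[OF that, of s t]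
      load_lincomb[OF V_H1 V_H1, of g h s t]
    by (simp add: L_def algebra_simps)
  have Lge: "0 \<le> L \<phi> + neg_integral (\<lambda>x. y x + \<phi> x)" if "\<phi> \<in> V" for \<phi>
    using vi[OF that] Ny by (simp add: L_def)
  \<comment> \<open>As y \<ge> 0, the negative part of \<open>y + \<phi>\<close> is at most
    |\<phi>|; pairing with the constant 1 turns the L1 bound into an L2 bound. Used for \<phi> and -
    \<phi> it makes \<open>L\<close> bounded.\<close>
  have Nle: "neg_integral (\<lambda>x. y x + \<phi> x) \<le> Lsq_norm M (\<lambda>_. 1) * Lsq_norm M \<phi>" if \<phi>: "\<phi> \<in> Lsq M" for \<phi>
  proof -
    have abs: "(\<lambda>x. \<bar>\<phi> x\<bar>) \<in> Lsq M"
      by (rule Lsq_bound[OF \<phi>, where c = 1]) (use Lsq_measurable[OF \<phi>] in auto)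
    have "neg_integral (\<lambda>x. y x + \<phi> x) \<le> (LINT x|M. 1 * \<bar>\<phi> x\<bar>)"
      unfolding neg_integral_eq
    proof (rule integral_mono_AE)
      show "AE x in M. max (- (y x + \<phi> x)) 0 \<le> 1 * \<bar>\<phi> x\<bar>" using y0 by eventually_elim auto
    qed (intro neg_part_integrable Lsq_add yL \<phi> Lsq_integrable_mult one_Lsq abs)+
    also have "\<dots> \<le> \<bar>Lsq_inner M (\<lambda>_. 1) (\<lambda>x. \<bar>\<phi> x\<bar>)\<bar>" by (simp add: Lsq_inner_def)
    also have "\<dots> \<le> Lsq_norm M (\<lambda>_. 1) * Lsq_norm M (\<lambda>x. \<bar>\<phi> x\<bar>)" by (rule Cauchy_Schwarz_Lsq[OF one_Lsq abs])
    also have "Lsq_norm M (\<lambda>x. \<bar>\<phi> x\<bar>) = Lsq_norm M \<phi>" by (simp add: Lsq_norm_def Lsq_inner_def)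
    finally show ?thesis .
  qed
  obtain g0 \<xi> where \<xi>L: "Lsq_lim M g0 \<xi>" and \<xi>: "\<And>\<phi>. \<phi> \<in> V \<Longrightarrow> L \<phi> = Lsq_inner M \<xi> \<phi>"
  proof (rule V_Riesz[of L "Lsq_norm M (\<lambda>_. 1)"])
    show "L (\<lambda>x. s * g x + t * h x) = s * L g + t * L h" if "g \<in> V" "h \<in> V" for g h s t using that by (rule lin)
    show "\<bar>L \<phi>\<bar> \<le> Lsq_norm M (\<lambda>_. 1) * Lsq_norm M \<phi>" if \<phi>: "\<phi> \<in> V" for \<phi>
    proof -
      have m: "(\<lambda>x. - \<phi> x) \<in> V" using V_lincomb[OF \<phi> \<phi>, of 0 "-1"] by simp
      have "L (\<lambda>x. - \<phi> x) = - L \<phi>" using lin[OF \<phi> \<phi>, of 0 "-1"] by simp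
      moreover have "Lsq_norm M (\<lambda>x. - \<phi> x) = Lsq_norm M \<phi>" by (simp add: Lsq_norm_def Lsq_inner_def)
      ultimately show ?thesis
        using Lge[OF \<phi>] Nle[OF V_Lsq[OF \<phi>]] Lge[OF m] Nle[OF V_Lsq[OF m]] by simp
    qed
  qed blast
  have \<xi>L: "\<xi> \<in> Lsq M" using \<xi>L by (simp add: Lsq_lim_def)
  have \<xi>m: "\<xi> \<in> borel_measurable M" by (rule Lsq_measurable[OF \<xi>L])
  \<comment> \<open>Both terms are continuous in L2, so density of V admits discontinuous
    directions, in particular the indicators below.\<close>
  have sub: "0 \<le> Lsq_inner M \<xi> \<phi> + neg_integral (\<lambda>x. y x + \<phi> x)" if \<phi>: "\<phi> \<in> Lsq M" for \<phi>
  proof -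
    obtain g where g: "\<And>n::nat. g n \<in> V" "Lsq_lim M g \<phi>" using V_dense[OF \<phi>] by blast
    have "Lsq_lim M (\<lambda>n x. y x + g n x) (\<lambda>x. y x + \<phi> x)"
      using Lsq_lim_diff_const[OF g(2) Lsq_uminus[OF yL]] by (simp add: add.commute)
    then have "(\<lambda>n. Lsq_inner M \<xi> (g n) + neg_integral (\<lambda>x. y x + g n x)) \<longlonglongrightarrow>
        Lsq_inner M \<xi> \<phi> + neg_integral (\<lambda>x. y x + \<phi> x)"
      by (intro tendsto_add Lsq_lim_inner Lsq_lim_const \<xi>L g neg_integral_lim)
    then show ?thesis
      by (rule LIMSEQ_le_const) (use Lge[OF g(1)] \<xi>[OF g(1)] in auto)
  qed
  have ind_Lsq: "(\<lambda>x. c * indicator B (\<xi> x)) \<in> Lsq M" if "B \<in> sets borel" for c and B :: "real set"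
  proof (rule Lsq_bounded_finite[OF finite_measure_M, where c = "\<bar>c\<bar>"])
    show "(\<lambda>x. c * indicator B (\<xi> x)) \<in> borel_measurable M" using \<xi>m that by measurable
  qed (auto simp: indicator_def)
  have \<xi>0: "AE x in M. 0 \<le> \<xi> x"
  proof -
    \<comment> \<open>A nonnegative direction costs no penalty, which leaves the integral of \<xi>
      over {\<xi> < 0} nonnegative.\<close>
    let ?\<phi> = "\<lambda>x. 1 * indicator {..<0} (\<xi> x) :: real"
    have \<phi>: "?\<phi> \<in> Lsq M" by (rule ind_Lsq) simp
    have "neg_integral (\<lambda>x. y x + ?\<phi> x) = 0"
      by (rule neg_integral_eq_0[OF _ Lsq_add[OF yL \<phi>]]) (use y0 in \<open>auto elim!: eventually_mono\<close>)
    then have "0 \<le> (LINT x|M. \<xi> x * ?\<phi> x)" using sub[OF \<phi>] by (simp add: Lsq_inner_def)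
    then have "AE x in M. \<xi> x * ?\<phi> x = 0"
      by (intro AE_eq_0_if_nonpos_integral_nonneg Lsq_integrable_mult \<xi>L \<phi>) (auto simp: indicator_def)
    then show ?thesis by eventually_elim (auto simp: indicator_def split: if_splits)
  qed
  have \<xi>1: "AE x in M. \<xi> x \<le> 1"
  proof -
    \<comment> \<open>Lowering y by 1 on {\<xi> > 1} costs at most the measure of that set, which
      leaves the integral of 1 - \<xi> over it nonnegative.\<close>
    let ?\<phi> = "\<lambda>x. - 1 * indicator {1<..} (\<xi> x) :: real"
    have \<phi>: "?\<phi> \<in> Lsq M" by (rule ind_Lsq) simp
    have "neg_integral (\<lambda>x. y x + ?\<phi> x) \<le> (LINT x|M. - ?\<phi> x)"
      unfolding neg_integral_eq
    proof (rule integral_mono_AE)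
      show "AE x in M. max (- (y x + ?\<phi> x)) 0 \<le> - ?\<phi> x" using y0 by eventually_elim auto
    qed (intro neg_part_integrable Lsq_add yL \<phi> Bochner_Integration.integrable_minus
        Lsq_integrable_finite[OF finite_measure_M])+
    then have "0 \<le> (LINT x|M. \<xi> x * ?\<phi> x) + (LINT x|M. - ?\<phi> x)" using sub[OF \<phi>] by (simp add: Lsq_inner_def)
    also have "\<dots> = (LINT x|M. \<xi> x * ?\<phi> x + - ?\<phi> x)"
      by (intro Bochner_Integration.integral_add[symmetric] Lsq_integrable_mult \<xi>L \<phi>
          Bochner_Integration.integrable_minus Lsq_integrable_finite[OF finite_measure_M])
    finally have "AE x in M. \<xi> x * ?\<phi> x + - ?\<phi> x = 0"
      by (intro AE_eq_0_if_nonpos_integral_nonneg Bochner_Integration.integrable_add Lsq_integrable_mult \<xi>L \<phi>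
          Bochner_Integration.integrable_minus Lsq_integrable_finite[OF finite_measure_M]) (auto simp: indicator_def)
    then show ?thesis by eventually_elim (auto simp: indicator_def split: if_splits)
  qed
  have y\<xi>: "AE x in M. y x * \<xi> x = 0"
  proof -
    \<comment> \<open>The direction - y leads to 0 without penalty, so the integral of y \<xi> is at
      most 0, while the integrand is nonnegative.\<close>
    have "neg_integral (\<lambda>x. y x + - y x) = 0" by (simp add: neg_integral_eq)
    then have "0 \<le> Lsq_inner M \<xi> (\<lambda>x. - y x)" using sub[OF Lsq_uminus[OF yL]] by simp
    then have "0 \<le> (LINT x|M. - (y x * \<xi> x))" by (simp add: Lsq_inner_def mult.commute)
    moreover have "AE x in M. - (y x * \<xi> x) \<le> 0" using y0 \<xi>0 by eventually_elim simp
    ultimately have "AE x in M. - (y x * \<xi> x) = 0"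
      by (intro AE_eq_0_if_nonpos_integral_nonneg Bochner_Integration.integrable_minus Lsq_integrable_mult \<xi>L yL)
    then show ?thesis by eventually_elim simp
  qed
  have "A y \<phi> = Lsq_inner M \<xi> \<phi> + load u f \<phi>" if "\<phi> \<in> V" for \<phi>
    using \<xi>[OF that] by (simp add: L_def)
  moreover have "AE x in M. 0 \<le> \<xi> x \<and> \<xi> x \<le> 1" using \<xi>0 \<xi>1 by eventually_elim simp
  ultimately show ?thesis by (intro that[OF y \<xi>L _ y0 _ y\<xi>])
qed

end

end

section \<open>Passage from the abstract problem to the two systems\<close>

theorem theorem1:
  fixes \<Omega> \<Gamma>N \<Gamma>D \<Gamma>C :: "'a::euclidean_space set"
    and \<gamma>0 :: "('a \<Rightarrow> real) \<Rightarrow> 'a \<Rightarrow> real"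
    and \<tau> t :: real
    and \<kappa> :: "'a \<Rightarrow> real"
    and v :: "'a \<Rightarrow> real \<Rightarrow> 'a"
    and X :: "'a \<Rightarrow> 'a"
    and u y_prev \<xi>_prev :: "'a \<Rightarrow> real"
  assumes dim: "DIM('a) = 1 \<or> DIM('a) = 2"
    and domain: "open \<Omega>" "bounded \<Omega>" "smooth_boundary \<Omega>"
    and parts_borel: "\<Gamma>N \<in> sets borel" "\<Gamma>D \<in> sets borel" "\<Gamma>C \<in> sets borel"
    and parts_union: "\<Gamma>N \<union> \<Gamma>D \<union> \<Gamma>C = frontier \<Omega>"
    and parts_disjoint: "\<Gamma>N \<inter> \<Gamma>D = {}" "\<Gamma>N \<inter> \<Gamma>C = {}" "\<Gamma>D \<inter> \<Gamma>C = {}"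
    and trace: "is_trace_operator \<Omega> \<gamma>0"
    and tau: "\<tau> > 0"
    and kappa: "\<kappa> \<in> Linfty (lebesgue_on \<Omega>)"
    and coercive: "coercive_on \<Omega> (V_space \<Omega> \<Gamma>D \<gamma>0) (A_op \<Omega> \<tau> \<kappa>)"
    and X_eq: "\<And>x. X x = x - \<tau> *\<^sub>R v x t"
    and X_map: "L2_composition_map \<Omega> X"
    and u: "u \<in> Lsq (surface_on \<Gamma>C)" "AE x in surface_on \<Gamma>C. u x \<ge> 0"
    and y_prev: "y_prev \<in> V_space \<Omega> \<Gamma>D \<gamma>0" "AE x in lebesgue_on \<Omega>. y_prev x \<ge> 0"
    and xi_prev: "\<xi>_prev \<in> Lsq (lebesgue_on \<Omega>)"
      "AE x in lebesgue_on \<Omega>. 0 \<le> \<xi>_prev x \<and> \<xi>_prev x \<le> 1"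
  shows "(\<exists>y \<xi>. solves_inclusion \<Omega> \<Gamma>D \<Gamma>C \<gamma>0 \<tau> \<kappa> X u y_prev \<xi>_prev y \<xi>) \<and>
    (\<forall>y \<xi> y' \<xi>'.
       solves_inclusion \<Omega> \<Gamma>D \<Gamma>C \<gamma>0 \<tau> \<kappa> X u y_prev \<xi>_prev y \<xi> \<and>
       solves_inclusion \<Omega> \<Gamma>D \<Gamma>C \<gamma>0 \<tau> \<kappa> X u y_prev \<xi>_prev y' \<xi>' \<longrightarrow>
       (AE x in lebesgue_on \<Omega>. y x = y' x) \<and> (AE x in lebesgue_on \<Omega>. \<xi> x = \<xi>' x)) \<and>
    (\<forall>y \<xi>. solves_inclusion \<Omega> \<Gamma>D \<Gamma>C \<gamma>0 \<tau> \<kappa> X u y_prev \<xi>_prev y \<xi> \<longleftrightarrow>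
           solves_complementarity \<Omega> \<Gamma>D \<Gamma>C \<gamma>0 \<tau> \<kappa> X u y_prev \<xi>_prev y \<xi>)"
proof -
  have bdry: "\<Gamma>D \<subseteq> frontier \<Omega>" "\<Gamma>C \<subseteq> frontier \<Omega>" using parts_union by auto
  interpret semi_discrete \<Omega> \<gamma>0 \<Gamma>D \<Gamma>C \<tau> \<kappa>
    by unfold_locales (fact domain(1,2) trace parts_borel(2,3) bdry tau kappa coercive)+
  define f where "f = (\<lambda>x. (y_prev \<circ> X) x - (\<xi>_prev \<circ> X) x)"
  have compL: "y_prev \<circ> X \<in> Lsq M" "\<xi>_prev \<circ> X \<in> Lsq M"
    using X_map V_Lsq[OF y_prev(1)] xi_prev(1) by (simp_all add: L2_composition_map_def)
  have f: "f \<in> Lsq M" unfolding f_def by (intro Lsq_diff compL)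
  \<comment> \<open>The hypothesis on X speaks of a.e. equal L2 functions, not of null sets. Bounds
    are therefore carried through X as equalities: \<open>y_prev\<close> with its maximum with 0,
    \<open>\<xi>_prev\<close> with its minimum with 1.\<close>
  have comp_cong: "AE x in M. \<phi> (X x) = \<psi> (X x)"
    if "\<phi> \<in> Lsq M" "\<psi> \<in> borel_measurable M" "AE x in M. \<phi> x = \<psi> x" for \<phi> \<psi>
  proof -
    have "\<psi> \<in> Lsq M"
      by (rule Lsq_bound[OF that(1,2), where c = 1]) (use that(3) in \<open>auto elim!: eventually_mono\<close>)
    then show ?thesis using X_map that by (simp add: L2_composition_map_def)
  qed
  have "AE x in M. y_prev (X x) = max (y_prev (X x)) 0"
    by (rule comp_cong[OF V_Lsq[OF y_prev(1)]])
      (use y_prev Lsq_measurable[OF V_Lsq[OF y_prev(1)]] in \<open>auto elim!: eventually_mono\<close>)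
  moreover have "AE x in M. \<xi>_prev (X x) = min (\<xi>_prev (X x)) 1"
  proof (rule comp_cong[OF xi_prev(1)])
    show "AE x in M. \<xi>_prev x = min (\<xi>_prev x) 1" using xi_prev(2) by eventually_elim simp
  qed (use Lsq_measurable[OF xi_prev(1)] in simp)
  ultimately have f1: "AE x in M. - 1 \<le> f x"
    by eventually_elim (simp add: f_def max_def min_def split: if_splits)
  have state: "state_equation \<Omega> \<Gamma>D \<Gamma>C \<gamma>0 \<tau> \<kappa> X u y_prev \<xi>_prev y \<xi> \<longleftrightarrow>
      (\<forall>\<phi>\<in>V. A y \<phi> = Lsq_inner M \<xi> \<phi> + load u f \<phi>)" for y \<xi>
  proof -
    have e: "Lsq_inner M f \<phi> = Lsq_inner M (y_prev \<circ> X) \<phi> - Lsq_inner M (\<xi>_prev \<circ> X) \<phi>" if "\<phi> \<in> V" for \<phi>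
      unfolding f_def by (rule Lsq_inner_diff_left[OF compL V_Lsq[OF that]])
    then show ?thesis
      unfolding state_equation_def dual_eq_def L2_dual_def B_op_def load_def
      by (intro ball_cong refl) (simp only: e add_diff_eq add.assoc)
  qed
  let ?incl = "solves_inclusion \<Omega> \<Gamma>D \<Gamma>C \<gamma>0 \<tau> \<kappa> X u y_prev \<xi>_prev"
  let ?compl = "solves_complementarity \<Omega> \<Gamma>D \<Gamma>C \<gamma>0 \<tau> \<kappa> X u y_prev \<xi>_prev"
  have compl_AE: "AE x in M. 0 \<le> y x \<and> 0 \<le> \<xi> x \<and> y x * \<xi> x = 0" if "?compl y \<xi>" for y \<xi>
  proof -
    note s = that[unfolded solves_complementarity_def]
    have "AE x in M. - (y x * \<xi> x) = 0"
    proof (rule AE_eq_0_if_nonpos_integral_nonneg)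
      show "AE x in M. - (y x * \<xi> x) \<le> 0"
        using s by (auto elim!: eventually_elim2)
      show "integrable M (\<lambda>x. - (y x * \<xi> x))"
        using s V_Lsq by (intro Bochner_Integration.integrable_minus Lsq_integrable_mult) auto
      show "0 \<le> (LINT x|M. - (y x * \<xi> x))" using s by (simp add: Lsq_inner_def)
    qed
    moreover have "AE x in M. 0 \<le> y x" "AE x in M. 0 \<le> \<xi> x" using s by auto
    ultimately show ?thesis by eventually_elim simp
  qed
  have unique: "(AE x in M. y x = y' x) \<and> (AE x in M. \<xi> x = \<xi>' x)"
    if s: "y \<in> V" "\<xi> \<in> Lsq M" "state_equation \<Omega> \<Gamma>D \<Gamma>C \<gamma>0 \<tau> \<kappa> X u y_prev \<xi>_prev y \<xi>"
      and s': "y' \<in> V" "\<xi>' \<in> Lsq M" "state_equation \<Omega> \<Gamma>D \<Gamma>C \<gamma>0 \<tau> \<kappa> X u y_prev \<xi>_prev y' \<xi>'"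
      and mono: "AE x in M. 0 \<le> - ((\<xi> x - \<xi>' x) * (y x - y' x))" for y \<xi> y' \<xi>'
  proof -
    have "0 \<le> (LINT x|M. - ((\<xi> x - \<xi>' x) * (y x - y' x)))" by (rule integral_nonneg_AE[OF mono])
    then have "Lsq_inner M (\<lambda>x. \<xi> x - \<xi>' x) (\<lambda>x. y x - y' x) \<le> 0" by (simp add: Lsq_inner_def)
    then show ?thesis
      using uniqueness[OF s(1) s'(1) s(2) s'(2), of "load u f"] s(3) s'(3) unfolding state by blast
  qed
  have incl_unique: "(AE x in M. y x = y' x) \<and> (AE x in M. \<xi> x = \<xi>' x)" if "?incl y \<xi>" "?incl y' \<xi>'" for y \<xi> y' \<xi>'
  proof (rule unique)
    have "AE x in M. \<xi> x \<in> Hmap (y x)" "AE x in M. \<xi>' x \<in> Hmap (y' x)"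
      using that by (simp_all add: solves_inclusion_def)
    \<comment> \<open>\<open>Hmap\<close> is a decreasing graph: if s < t, every element of
      \<open>Hmap s\<close> is at least every element of \<open>Hmap t\<close>.\<close>
    then show "AE x in M. 0 \<le> - ((\<xi> x - \<xi>' x) * (y x - y' x))"
    proof eventually_elim
      case (elim x)
      then show ?case
        by (auto simp: Hmap_def mult_le_0_iff split: if_splits)
    qed
  qed (use that in \<open>simp_all add: solves_inclusion_def\<close>)
  have compl_unique: "(AE x in M. y x = y' x) \<and> (AE x in M. \<xi> x = \<xi>' x)" if "?compl y \<xi>" "?compl y' \<xi>'" for y \<xi> y' \<xi>'
  proof (rule unique)
    show "AE x in M. 0 \<le> - ((\<xi> x - \<xi>' x) * (y x - y' x))"
      using compl_AE[OF that(1)] compl_AE[OF that(2)]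
    proof eventually_elim
      case (elim x)
      \<comment> \<open>Both diagonal products vanish, so only the cross terms remain, and they are
        nonnegative.\<close>
      then have "0 \<le> \<xi> x * y' x" "0 \<le> \<xi>' x * y x" "y x * \<xi> x = 0" "y' x * \<xi>' x = 0" by auto
      then show ?case by (auto simp: left_diff_distrib right_diff_distrib mult.commute)
    qed
  qed (use that in \<open>simp_all add: solves_complementarity_def\<close>)
  obtain y \<xi> where y: "y \<in> V" and \<xi>: "\<xi> \<in> Lsq M"
    and eq: "\<And>\<phi>. \<phi> \<in> V \<Longrightarrow> A y \<phi> = Lsq_inner M \<xi> \<phi> + load u f \<phi>"
    and ae: "AE x in M. 0 \<le> y x" "AE x in M. 0 \<le> \<xi> x \<and> \<xi> x \<le> 1" "AE x in M. y x * \<xi> x = 0"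
    using existence[OF u(1) f u(2) f1] by blast
  have st: "state_equation \<Omega> \<Gamma>D \<Gamma>C \<gamma>0 \<tau> \<kappa> X u y_prev \<xi>_prev y \<xi>" using eq by (simp add: state)
  \<comment> \<open>Where y > 0 the product condition forces \<xi> = 0; where y = 0 the bounds 0 and
    1 are all that \<open>Hmap\<close> demands.\<close>
  have H: "AE x in M. \<xi> x \<in> Hmap (y x)" using ae by eventually_elim (auto simp: Hmap_def)
  have incl: "?incl y \<xi>" using y \<xi> st H by (simp add: solves_inclusion_def)
  have "Lsq_inner M y \<xi> = (LINT x|M. 0)"
    unfolding Lsq_inner_def
    by (rule integral_cong_AE) (use ae(3) Lsq_measurable[OF V_Lsq[OF y]] Lsq_measurable[OF \<xi>] in auto)
  then have compl: "?compl y \<xi>"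
    using y \<xi> st ae by (auto simp: solves_complementarity_def elim!: eventually_mono)
  \<comment> \<open>Each system has an a.e. unique solution and \<open>(y, \<xi>)\<close> solves both, so they have the same solutions.\<close>
  have "?incl y' \<xi>' \<longleftrightarrow> ?compl y' \<xi>'" for y' \<xi>'
  proof
    assume s: "?incl y' \<xi>'"
    note c = incl_unique[OF s incl]
    have L: "y' \<in> Lsq M" "\<xi>' \<in> Lsq M" using s V_Lsq by (auto simp: solves_inclusion_def)
    have "AE x in M. 0 \<le> y' x" using conjunct1[OF c] ae(1) by eventually_elim simp
    moreover have "AE x in M. 0 \<le> \<xi>' x" using conjunct2[OF c] ae(2) by eventually_elim simp
    moreover have "Lsq_inner M y' \<xi>' = Lsq_inner M y \<xi>"
      using c by (intro Lsq_inner_cong_AE Lsq_measurable L V_Lsq[OF y] \<xi>) auto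
    ultimately show "?compl y' \<xi>'" using s compl by (simp add: solves_complementarity_def solves_inclusion_def)
  next
    assume s: "?compl y' \<xi>'"
    note c = compl_unique[OF s compl]
    \<comment> \<open>The upper bound \<xi>' \<le> 1, which is not among the complementarity
      conditions, is inherited from the constructed solution.\<close>
    have "AE x in M. \<xi>' x \<in> Hmap (y' x)" using conjunct1[OF c] conjunct2[OF c] H by eventually_elim simp
    then show "?incl y' \<xi>'" using s by (simp add: solves_complementarity_def solves_inclusion_def)
  qed
  with incl incl_unique show ?thesis by blast
qed

end
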